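(* The following two statements hold. (a) (Artin groups) If $\operatorname{asdim} A_\Gamma\le Sim(\Gamma)$ for every finite simplicial labeled graph $\Gamma$ such that the Artin group $A_\Gamma$ is free of infinity, then $\operatorname{asdim} A_\Gamma\le Sim(\Gamma)$ for every finite simplicial labeled graph $\Gamma$. (b) (Coxeter groups) If $\operatorname{asdim} W_\Gamma\le Sim(\Gamma)$ for every finite simplicial labeled graph $\Gamma$ such that the Coxeter group $W_\Gamma$ is free of infinity, then $\operatorname{asdim} W_\Gamma\le Sim(\Gamma)$ for every finite simplicial labeled graph $\Gamma$.
   Context: A finite simplicial labeled graph is a finite simplicial graph $\Gamma$ in which every edge $[a,b]$ is labeled by a natural number $m_{ab}>1$. Its vertex set is $V(\Gamma)$. The Artin group associated to $\Gamma$ is $$A_\Gamma=\langle V(\Gamma) \mid \underbrace{aba\cdots}_{m_{ab}}=\underbrace{bab\cdots}_{m_{ab}} \text{ whenever } a,b \text{ are connected by an edge}\rangle,$$ and the Coxeter group associated to $\Gamma$ is $$W_\Gamma=\langle V(\Gamma) \mid a^2 \text{ for all } a\in V(\Gamma),\ \underbrace{aba\cdots}_{m_{ab}}=\underbrace{bab\cdots}_{m_{ab}} \text{ whenever } a,b \text{ are connected by an edge}\rangle,$$ where each side is the alternating word of length $m_{ab}$ (there is no relation between distinct $a$ and $b$ if they are not joined by an edge). The Artin group $A_\Gamma$ (resp. Coxeter group $W_\Gamma$) is called free of infinity if $\Gamma$ is complete, i.e. any two distinct vertices are connected by an edge. $Sim(\Gamma)$ is the number of vertices of the largest clique in $\Gamma$,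 i.e. the largest $n$ such that $\Gamma$ contains a complete subgraph on $n$ vertices. The asymptotic dimension of a metric space $X$ is defined by: $\operatorname{asdim}X\le n$ if and only if for every $R>0$ there is a uniformly bounded covering $\mathcal U$ of $X$ such that every $R$-ball in $X$ intersects at most $n+1$ elements of $\mathcal U$. For a finitely generated group, $\operatorname{asdim}$ is that of the group with the word metric of any finite generating set. *)

theory Defs
  imports
    "HOL-Algebra.Generated_Groups"
    "HOL-Analysis.Abstract_Metric_Spaces"
    "HOL-Library.Extended_Nat"
begin

section \<open>Asymptotic dimension\<close>

context Metric_space
begin

definition asdim_at_most :: "nat \<Rightarrow> bool" where
  "asdim_at_most n \<longleftrightarrow>
     (\<forall>R>0. \<exists>\<U>. \<Union>\<U> = M
        \<and> (\<exists>D. \<forall>U\<in>\<U>. \<forall>x\<in>U. \<forall>y\<in>U. d x y \<le> D)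
        \<and> (\<forall>x\<in>M. finite {U\<in>\<U>. U \<inter> mball x R \<noteq> {}}
                \<and> card {U\<in>\<U>. U \<inter> mball x R \<noteq> {}} \<le> n + 1))"

definition asdim :: enat where
  "asdim = Inf (enat ` {n. asdim_at_most n})"

lemma asdim_at_most_mono:
  assumes "asdim_at_most m" "m \<le> n"
  shows "asdim_at_most n"
  unfolding asdim_at_most_def
proof (intro allI impI)
  fix R :: real assume R: "R > 0"
  obtain \<U> D where U: "\<Union>\<U> = M" "\<forall>U\<in>\<U>. \<forall>x\<in>U. \<forall>y\<in>U. d x y \<le> D"
    "\<forall>x\<in>M. finite {U\<in>\<U>. U \<inter> mball x R \<noteq> {}} \<and> card {U\<in>\<U>. U \<inter> mball x R \<noteq> {}} \<le> m + 1"
    using assms(1)[unfolded asdim_at_most_def, rule_format, OF R] by (elim exE conjE)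
  have "\<forall>x\<in>M. finite {U\<in>\<U>. U \<inter> mball x R \<noteq> {}} \<and> card {U\<in>\<U>. U \<inter> mball x R \<noteq> {}} \<le> n + 1"
    using U(3) assms(2) by fastforce
  with U(1,2) show "\<exists>\<U>. \<Union>\<U> = M
      \<and> (\<exists>D. \<forall>U\<in>\<U>. \<forall>x\<in>U. \<forall>y\<in>U. d x y \<le> D)
      \<and> (\<forall>x\<in>M. finite {U\<in>\<U>. U \<inter> mball x R \<noteq> {}}
              \<and> card {U\<in>\<U>. U \<inter> mball x R \<noteq> {}} \<le> n + 1)"
    by (intro exI[of _ \<U>] conjI exI[of _ D])
qed

lemma asdim_le_iff: "asdim \<le> enat n \<longleftrightarrow> asdim_at_most n"
proof
  assume le: "asdim \<le> enat n"
  have "enat ` {n. asdim_at_most n} \<noteq> {}"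
  proof
    assume "enat ` {n. asdim_at_most n} = {}"
    then have "asdim = \<infinity>" by (simp add: asdim_def Inf_enat_def)
    with le show False by simp
  qed
  then have "asdim \<in> enat ` {n. asdim_at_most n}"
    unfolding asdim_def Inf_enat_def by (metis (mono_tags, lifting) LeastI ex_in_conv)
  then obtain m where "asdim = enat m" "asdim_at_most m" by auto
  then show "asdim_at_most n" using le asdim_at_most_mono by auto
next
  assume "asdim_at_most n"
  then show "asdim \<le> enat n" unfolding asdim_def by (auto intro: Inf_lower)
qed

end

lemma asdim_at_most_bilipschitz:
  assumes "Metric_space M d" "Metric_space M d'" and C: "C > 0"
    and 1: "\<And>x y. x \<in> M \<Longrightarrow> y \<in> M \<Longrightarrow> d x y \<le> C * d' x y"
    and 2: "\<And>x y. x \<in> M \<Longrightarrow> y \<in> M \<Longrightarrow> d' x y \<le> C * d x y"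
    and at_most: "Metric_space.asdim_at_most M d n"
  shows "Metric_space.asdim_at_most M d' n"
proof -
  interpret A: Metric_space M d by fact
  interpret B: Metric_space M d' by fact
  show ?thesis unfolding B.asdim_at_most_def
  proof (intro allI impI)
    fix R :: real assume "R > 0"
    with C have CR: "C * R > 0" by simp
    obtain \<U> D where U: "\<Union>\<U> = M" "\<forall>U\<in>\<U>. \<forall>x\<in>U. \<forall>y\<in>U. d x y \<le> D"
      "\<forall>x\<in>M. finite {U\<in>\<U>. U \<inter> A.mball x (C * R) \<noteq> {}}
                \<and> card {U\<in>\<U>. U \<inter> A.mball x (C * R) \<noteq> {}} \<le> n + 1"
      using at_most[unfolded A.asdim_at_most_def, rule_format, OF CR] by (elim exE conjE)
    have sub: "B.mball x R \<subseteq> A.mball x (C * R)" for x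
    proof
      fix y assume "y \<in> B.mball x R"
      then have "x \<in> M" "y \<in> M" "d' x y < R" by auto
      then show "y \<in> A.mball x (C * R)"
        using 1[of x y] mult_strict_left_mono[OF _ C, of "d' x y" R] by auto
    qed
    then have sub': "{U\<in>\<U>. U \<inter> B.mball x R \<noteq> {}} \<subseteq> {U\<in>\<U>. U \<inter> A.mball x (C * R) \<noteq> {}}" for x
      by blast
    have "\<forall>U\<in>\<U>. \<forall>x\<in>U. \<forall>y\<in>U. d' x y \<le> C * D"
    proof (intro ballI)
      fix U x y assume "U \<in> \<U>" "x \<in> U" "y \<in> U"
      then have "x \<in> M" "y \<in> M" "d x y \<le> D" using U by auto
      then show "d' x y \<le> C * D"
        using 2 C by (meson less_imp_le mult_left_mono order_trans)
    qed
    moreover have "\<forall>x\<in>M. finite {U\<in>\<U>. U \<inter> B.mball x R \<noteq> {}}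
                \<and> card {U\<in>\<U>. U \<inter> B.mball x R \<noteq> {}} \<le> n + 1"
      using U(3) sub' by (meson card_mono finite_subset le_trans)
    ultimately show "\<exists>\<U>. \<Union>\<U> = M
        \<and> (\<exists>D. \<forall>U\<in>\<U>. \<forall>x\<in>U. \<forall>y\<in>U. d' x y \<le> D)
        \<and> (\<forall>x\<in>M. finite {U\<in>\<U>. U \<inter> B.mball x R \<noteq> {}}
                \<and> card {U\<in>\<U>. U \<inter> B.mball x R \<noteq> {}} \<le> n + 1)"
      using U(1) by blast
  qed
qed

section \<open>Word metrics\<close>

definition finite_generating_set :: "('a, 'b) monoid_scheme \<Rightarrow> 'a set \<Rightarrow> bool" where
  "finite_generating_set G S \<longleftrightarrow> finite S \<and> S \<subseteq> carrier G \<and> generate G S = carrier G"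

definition word_prod :: "('a, 'b) monoid_scheme \<Rightarrow> 'a list \<Rightarrow> 'a" where
  "word_prod G ws = foldr (\<otimes>\<^bsub>G\<^esub>) ws \<one>\<^bsub>G\<^esub>"

definition word_length :: "('a, 'b) monoid_scheme \<Rightarrow> 'a set \<Rightarrow> 'a \<Rightarrow> nat" where
  "word_length G S g =
     (LEAST n. \<exists>ws. length ws = n \<and> set ws \<subseteq> S \<union> m_inv G ` S \<and> word_prod G ws = g)"

text \<open>The value outside the carrier only serves to satisfy the locale \<open>Metric_space\<close>,
  which asks for symmetry on the whole type.\<close>

definition word_dist :: "('a, 'b) monoid_scheme \<Rightarrow> 'a set \<Rightarrow> 'a \<Rightarrow> 'a \<Rightarrow> real" where
  "word_dist G S g h =
     (if g \<in> carrier G \<and> h \<in> carrier G then real (word_length G S (inv\<^bsub>G\<^esub> g \<otimes>\<^bsub>G\<^esub> h)) else 0)"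

text \<open>Only meaningful for finitely generated groups; the lemma \<open>asdim_group_eq\<close> below shows that
  the choice of the generating set is immaterial.\<close>

definition asdim_group :: "('a, 'b) monoid_scheme \<Rightarrow> enat" where
  "asdim_group G = Metric_space.asdim (carrier G) (word_dist G (SOME S. finite_generating_set G S))"

context group
begin

lemma word_prod_Nil [simp]: "word_prod G [] = \<one>"
  and word_prod_Cons [simp]: "word_prod G (x # xs) = x \<otimes> word_prod G xs"
  by (simp_all add: word_prod_def)

lemma word_prod_closed [simp]: "set ws \<subseteq> carrier G \<Longrightarrow> word_prod G ws \<in> carrier G"
  by (induction ws) auto

lemma word_prod_append:
  "set us \<subseteq> carrier G \<Longrightarrow> set vs \<subseteq> carrier G \<Longrightarrow>
     word_prod G (us @ vs) = word_prod G us \<otimes> word_prod G vs"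
  by (induction us) (auto simp: m_assoc)

lemma word_prod_inv:
  "set ws \<subseteq> carrier G \<Longrightarrow> word_prod G (rev (map (m_inv G) ws)) = inv (word_prod G ws)"
proof (induction ws)
  case (Cons a ws)
  have "set (rev (map (m_inv G) ws)) \<subseteq> carrier G" using Cons.prems by auto
  then show ?case using Cons by (simp add: word_prod_append inv_mult_group)
qed simp

lemma letters_closed: "S \<subseteq> carrier G \<Longrightarrow> S \<union> m_inv G ` S \<subseteq> carrier G"
  by auto

lemma generate_word:
  assumes "S \<subseteq> carrier G" "g \<in> generate G S"
  shows "\<exists>ws. set ws \<subseteq> S \<union> m_inv G ` S \<and> word_prod G ws = g"
  using assms(2)
proof (induction rule: generate.induct)
  case one
  have "set [] \<subseteq> S \<union> m_inv G ` S \<and> word_prod G [] = \<one>" by simp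
  then show ?case by blast
next
  case (incl h)
  then have "set [h] \<subseteq> S \<union> m_inv G ` S \<and> word_prod G [h] = h" using assms(1) by auto
  then show ?case by blast
next
  case (inv h)
  then have "set [inv h] \<subseteq> S \<union> m_inv G ` S \<and> word_prod G [inv h] = inv h" using assms(1) by auto
  then show ?case by blast
next
  case (eng h1 h2)
  then obtain us vs where "set us \<subseteq> S \<union> m_inv G ` S" "word_prod G us = h1"
    "set vs \<subseteq> S \<union> m_inv G ` S" "word_prod G vs = h2" by blast
  then have "set (us @ vs) \<subseteq> S \<union> m_inv G ` S \<and> word_prod G (us @ vs) = h1 \<otimes> h2"
    using letters_closed[OF assms(1)] by (subst word_prod_append) auto
  then show ?case by blast
qed

lemma word_length_le:
  "set ws \<subseteq> S \<union> m_inv G ` S \<Longrightarrow> word_prod G ws = g \<Longrightarrow> word_length G S g \<le> length ws"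
  unfolding word_length_def by (rule Least_le) blast

lemma word_length_word:
  assumes "S \<subseteq> carrier G" "generate G S = carrier G" "g \<in> carrier G"
  obtains ws where "length ws = word_length G S g" "set ws \<subseteq> S \<union> m_inv G ` S" "word_prod G ws = g"
proof -
  have "\<exists>n ws. length ws = n \<and> set ws \<subseteq> S \<union> m_inv G ` S \<and> word_prod G ws = g"
    using generate_word[OF assms(1)] assms(2,3) by blast
  from LeastI_ex[OF this] show ?thesis using that unfolding word_length_def by blast
qed

lemma word_length_mult_le:
  assumes "S \<subseteq> carrier G" "generate G S = carrier G" "g \<in> carrier G" "h \<in> carrier G"
  shows "word_length G S (g \<otimes> h) \<le> word_length G S g + word_length G S h"
proof -
  obtain us where us: "length us = word_length G S g" "set us \<subseteq> S \<union> m_inv G ` S" "word_prod G us = g"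
    using word_length_word assms by metis
  obtain vs where vs: "length vs = word_length G S h" "set vs \<subseteq> S \<union> m_inv G ` S" "word_prod G vs = h"
    using word_length_word assms by metis
  have "word_prod G (us @ vs) = g \<otimes> h"
    using us vs letters_closed[OF assms(1)] by (subst word_prod_append) auto
  then have "word_length G S (g \<otimes> h) \<le> length (us @ vs)"
    using us vs by (intro word_length_le) auto
  then show ?thesis using us vs by simp
qed

lemma word_length_inv_le:
  assumes "S \<subseteq> carrier G" "generate G S = carrier G" "g \<in> carrier G"
  shows "word_length G S (inv g) \<le> word_length G S g"
proof -
  obtain us where us: "length us = word_length G S g" "set us \<subseteq> S \<union> m_inv G ` S" "word_prod G us = g"
    using word_length_word assms by metis
  have "set us \<subseteq> carrier G" using us letters_closed[OF assms(1)] by blast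
  then have "word_prod G (rev (map (m_inv G) us)) = inv g" using us word_prod_inv by simp
  moreover have "set (rev (map (m_inv G) us)) \<subseteq> S \<union> m_inv G ` S"
    using us assms(1) by (auto simp: subset_iff)
  ultimately have "word_length G S (inv g) \<le> length (rev (map (m_inv G) us))"
    by (intro word_length_le)
  then show ?thesis using us by simp
qed

lemma word_length_0_iff:
  assumes "S \<subseteq> carrier G" "generate G S = carrier G" "g \<in> carrier G"
  shows "word_length G S g = 0 \<longleftrightarrow> g = \<one>"
proof
  assume "word_length G S g = 0"
  then show "g = \<one>" using word_length_word[OF assms] by (metis length_0_conv word_prod_Nil)
next
  assume "g = \<one>"
  then show "word_length G S g = 0" using word_length_le[of "[]" S g] by simp
qed

lemma Metric_space_word_dist:
  assumes "S \<subseteq> carrier G" "generate G S = carrier G"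
  shows "Metric_space (carrier G) (word_dist G S)"
proof
  show "0 \<le> word_dist G S x y" for x y by (simp add: word_dist_def)
  have le: "word_length G S (inv x \<otimes> y) \<le> word_length G S (inv y \<otimes> x)"
    if "x \<in> carrier G" "y \<in> carrier G" for x y
    using word_length_inv_le[OF assms, of "inv y \<otimes> x"] that by (simp add: inv_mult_group)
  show "word_dist G S x y = word_dist G S y x" for x y
    using le[of x y] le[of y x] by (auto simp: word_dist_def intro: le_antisym)
  show "(word_dist G S x y = 0) = (x = y)" if "x \<in> carrier G" "y \<in> carrier G" for x y
  proof -
    have "inv x \<otimes> y = \<one> \<longleftrightarrow> x = y"
      using that by (metis inv_closed inv_equality inv_inv l_inv)
    then show ?thesis using that word_length_0_iff[OF assms, of "inv x \<otimes> y"]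
      by (simp add: word_dist_def)
  qed
  show "word_dist G S x z \<le> word_dist G S x y + word_dist G S y z"
    if "x \<in> carrier G" "y \<in> carrier G" "z \<in> carrier G" for x y z
  proof -
    have "(inv x \<otimes> y) \<otimes> (inv y \<otimes> z) = inv x \<otimes> z"
      using that by (metis inv_closed inv_solve_left m_assoc m_closed)
    then have "word_length G S (inv x \<otimes> z) \<le> word_length G S (inv x \<otimes> y) + word_length G S (inv y \<otimes> z)"
      using word_length_mult_le[OF assms, of "inv x \<otimes> y" "inv y \<otimes> z"] that by simp
    then show ?thesis using that by (simp add: word_dist_def flip: of_nat_add)
  qed
qed

lemma word_length_lipschitz:
  assumes S: "S \<subseteq> carrier G" "generate G S = carrier G"
    and T: "finite T" "T \<subseteq> carrier G" "generate G T = carrier G"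
  shows "\<exists>C. \<forall>g\<in>carrier G. word_length G S g \<le> C * word_length G T g"
proof -
  let ?L = "T \<union> m_inv G ` T"
  define C where "C = (\<Sum>t\<in>?L. word_length G S t)"
  have C: "word_length G S t \<le> C" if "t \<in> ?L" for t
    unfolding C_def using that T(1) by (intro member_le_sum) auto
  have words: "word_length G S (word_prod G ws) \<le> C * length ws" if "set ws \<subseteq> ?L" for ws
    using that
  proof (induction ws)
    case Nil
    then show ?case using word_length_0_iff[OF S, of \<one>] by simp
  next
    case (Cons a ws)
    have "a \<in> carrier G" "word_prod G ws \<in> carrier G"
      using Cons.prems letters_closed[OF T(2)] by (auto intro!: word_prod_closed)
    then have "word_length G S (word_prod G (a # ws)) \<le> word_length G S a + word_length G S (word_prod G ws)"
      using word_length_mult_le[OF S] by simp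
    also have "\<dots> \<le> C + C * length ws" using Cons C[of a] by (intro add_mono) auto
    finally show ?case by simp
  qed
  show ?thesis
  proof (intro exI ballI)
    fix g assume "g \<in> carrier G"
    then obtain ws where "length ws = word_length G T g" "set ws \<subseteq> ?L" "word_prod G ws = g"
      using word_length_word[OF T(2,3)] by metis
    then show "word_length G S g \<le> C * word_length G T g" using words[of ws] by metis
  qed
qed

lemma asdim_at_most_generators:
  assumes S: "finite_generating_set G S" and T: "finite_generating_set G T"
    and at_most: "Metric_space.asdim_at_most (carrier G) (word_dist G S) n"
  shows "Metric_space.asdim_at_most (carrier G) (word_dist G T) n"
proof -
  note S' = S[unfolded finite_generating_set_def] and T' = T[unfolded finite_generating_set_def]
  obtain A where A: "\<forall>g\<in>carrier G. word_length G S g \<le> A * word_length G T g"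
    using word_length_lipschitz S' T' by metis
  obtain B where B: "\<forall>g\<in>carrier G. word_length G T g \<le> B * word_length G S g"
    using word_length_lipschitz S' T' by metis
  have A': "word_length G S g \<le> (A + B + 1) * word_length G T g" if "g \<in> carrier G" for g
    using A that by (meson le_add1 le_trans mult_le_mono1 trans_le_add1)
  have B': "word_length G T g \<le> (A + B + 1) * word_length G S g" if "g \<in> carrier G" for g
    using B that by (meson le_add2 le_trans mult_le_mono1 trans_le_add1)
  show ?thesis
  proof (rule asdim_at_most_bilipschitz[OF _ _ _ _ _ at_most, where C = "real (A + B + 1)"])
    show "Metric_space (carrier G) (word_dist G S)" "Metric_space (carrier G) (word_dist G T)"
      using Metric_space_word_dist S' T' by auto
  qed (use A' B' in \<open>auto simp: word_dist_def simp flip: of_nat_mult of_nat_add of_nat_Suc\<close>)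
qed

lemma asdim_group_eq:
  assumes "finite_generating_set G S"
  shows "asdim_group G = Metric_space.asdim (carrier G) (word_dist G S)"
proof -
  define T where "T = (SOME S. finite_generating_set G S)"
  have T: "finite_generating_set G T" unfolding T_def using assms by (rule someI)
  interpret S: Metric_space "carrier G" "word_dist G S"
    using Metric_space_word_dist assms unfolding finite_generating_set_def by auto
  interpret T: Metric_space "carrier G" "word_dist G T"
    using Metric_space_word_dist T unfolding finite_generating_set_def by auto
  have "S.asdim_at_most = T.asdim_at_most"
    using asdim_at_most_generators[OF assms T] asdim_at_most_generators[OF T assms] by blast
  then have "S.asdim = T.asdim" unfolding S.asdim_def T.asdim_def by simp
  then show ?thesis unfolding asdim_group_def T_def by simp
qed

lemma asdim_group_le_iff:
  assumes "finite_generating_set G S"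
  shows "asdim_group G \<le> enat n \<longleftrightarrow> Metric_space.asdim_at_most (carrier G) (word_dist G S) n"
  using Metric_space.asdim_le_iff[OF Metric_space_word_dist] assms asdim_group_eq[OF assms]
  unfolding finite_generating_set_def by simp

end

section \<open>Group presentations\<close>

text \<open>The letter \<open>(a, True)\<close> stands for the generator \<open>a\<close> and \<open>(a, False)\<close> for its formal inverse;
  a pair \<open>(u, v)\<close> of words in \<open>R\<close> is the relation \<open>u = v\<close>.\<close>

type_synonym 'v word = "('v \<times> bool) list"

inductive pres_eq :: "'v set \<Rightarrow> ('v word \<times> 'v word) set \<Rightarrow> 'v word \<Rightarrow> 'v word \<Rightarrow> bool"
  for S R where
  refl: "w \<in> lists (S \<times> UNIV) \<Longrightarrow> pres_eq S R w w"
| sym: "pres_eq S R u v \<Longrightarrow> pres_eq S R v u"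
| trans: "pres_eq S R u v \<Longrightarrow> pres_eq S R v w \<Longrightarrow> pres_eq S R u w"
| append: "pres_eq S R u u' \<Longrightarrow> pres_eq S R v v' \<Longrightarrow> pres_eq S R (u @ v) (u' @ v')"
| cancel: "a \<in> S \<Longrightarrow> pres_eq S R [(a, e), (a, \<not> e)] []"
| rel: "(u, v) \<in> R \<Longrightarrow> u \<in> lists (S \<times> UNIV) \<Longrightarrow> v \<in> lists (S \<times> UNIV) \<Longrightarrow> pres_eq S R u v"

definition pres_rel :: "'v set \<Rightarrow> ('v word \<times> 'v word) set \<Rightarrow> ('v word \<times> 'v word) set" where
  "pres_rel S R = {(u, v). pres_eq S R u v}"

definition presented_group :: "'v set \<Rightarrow> ('v word \<times> 'v word) set \<Rightarrow> 'v word set monoid" where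
  "presented_group S R =
     \<lparr>carrier = lists (S \<times> UNIV) // pres_rel S R,
      mult = (\<lambda>A B. \<Union>u\<in>A. \<Union>v\<in>B. pres_rel S R `` {u @ v}),
      one = pres_rel S R `` {[]}\<rparr>"

lemma pres_eq_lists: "pres_eq S R u v \<Longrightarrow> u \<in> lists (S \<times> UNIV) \<and> v \<in> lists (S \<times> UNIV)"
  by (induction rule: pres_eq.induct) auto

lemma equiv_pres_rel: "equiv (lists (S \<times> UNIV)) (pres_rel S R)"
proof (rule equivI)
  show "pres_rel S R \<subseteq> lists (S \<times> UNIV) \<times> lists (S \<times> UNIV)"
    using pres_eq_lists unfolding pres_rel_def by blast
  show "refl_on (lists (S \<times> UNIV)) (pres_rel S R)"
    using pres_eq.refl by (auto simp: refl_on_def pres_rel_def)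
  show "Relation.sym (pres_rel S R)" "Relation.trans (pres_rel S R)"
    unfolding pres_rel_def by (auto intro!: symI transI intro: pres_eq.sym pres_eq.trans)
qed

abbreviation pres_class :: "'v set \<Rightarrow> ('v word \<times> 'v word) set \<Rightarrow> 'v word \<Rightarrow> 'v word set" where
  "pres_class S R w \<equiv> pres_rel S R `` {w}"

lemma pres_class_eq_iff:
  "u \<in> lists (S \<times> UNIV) \<Longrightarrow> v \<in> lists (S \<times> UNIV) \<Longrightarrow>
     pres_class S R u = pres_class S R v \<longleftrightarrow> pres_eq S R u v"
  using eq_equiv_class_iff[OF equiv_pres_rel, of u S v R] by (simp add: pres_rel_def)

lemma carrier_presented_group: "carrier (presented_group S R) = pres_class S R ` lists (S \<times> UNIV)"
  by (auto simp: presented_group_def quotient_def)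

lemma one_presented_group: "\<one>\<^bsub>presented_group S R\<^esub> = pres_class S R []"
  by (simp add: presented_group_def)

lemma mult_presented_group:
  assumes "u \<in> lists (S \<times> UNIV)" "v \<in> lists (S \<times> UNIV)"
  shows "pres_class S R u \<otimes>\<^bsub>presented_group S R\<^esub> pres_class S R v = pres_class S R (u @ v)"
proof -
  have "congruent2 (pres_rel S R) (pres_rel S R) (\<lambda>u v. pres_class S R (u @ v))"
  proof (rule congruent2I')
    fix u u' v v' assume "(u, u') \<in> pres_rel S R" "(v, v') \<in> pres_rel S R"
    then have "pres_eq S R (u @ v) (u' @ v')"
      by (simp add: pres_rel_def pres_eq.append)
    then show "pres_class S R (u @ v) = pres_class S R (u' @ v')"
      using pres_class_eq_iff pres_eq_lists by metis
  qed
  from UN_equiv_class2[OF equiv_pres_rel equiv_pres_rel this assms]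
  show ?thesis by (simp add: presented_group_def)
qed

lemma group_presented_group: "group (presented_group S R)" (is "group ?G")
proof (rule groupI)
  have inv: "\<exists>u\<in>lists (S \<times> UNIV). pres_eq S R (u @ w) []" if "w \<in> lists (S \<times> UNIV)" for w
    using that
  proof (induction w)
    case Nil
    then show ?case using pres_eq.refl[of "[]" S R] by force
  next
    case (Cons x w)
    obtain a e where x: "x = (a, e)" by (cases x)
    then have a: "a \<in> S" using Cons by auto
    obtain u where u: "u \<in> lists (S \<times> UNIV)" "pres_eq S R (u @ w) []" using Cons by auto
    have w: "w \<in> lists (S \<times> UNIV)" using Cons by auto
    have "pres_eq S R ((u @ [(a, \<not> e), (a, \<not> \<not> e)]) @ w) ((u @ []) @ w)"
      using u w a by (intro pres_eq.append pres_eq.refl pres_eq.cancel) auto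
    then have "pres_eq S R ((u @ [(a, \<not> e)]) @ x # w) []"
      using u(2) x by (auto intro: pres_eq.trans)
    moreover have "u @ [(a, \<not> e)] \<in> lists (S \<times> UNIV)" using u a by auto
    ultimately show ?case by blast
  qed
  show "\<exists>y\<in>carrier ?G. y \<otimes>\<^bsub>?G\<^esub> x = \<one>\<^bsub>?G\<^esub>" if x: "x \<in> carrier ?G" for x
  proof -
    obtain w where w: "w \<in> lists (S \<times> UNIV)" "x = pres_class S R w"
      using x by (auto simp: carrier_presented_group)
    obtain u where u: "u \<in> lists (S \<times> UNIV)" "pres_eq S R (u @ w) []" using inv w by blast
    then have "pres_class S R u \<otimes>\<^bsub>?G\<^esub> x = \<one>\<^bsub>?G\<^esub>"
      using w pres_eq_lists[OF u(2)]
      by (simp add: mult_presented_group one_presented_group pres_class_eq_iff)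
    then show ?thesis using u by (auto simp: carrier_presented_group)
  qed
  show "x \<otimes>\<^bsub>?G\<^esub> y \<in> carrier ?G" if xy: "x \<in> carrier ?G" "y \<in> carrier ?G" for x y
  proof -
    obtain u v where uv: "u \<in> lists (S \<times> UNIV)" "x = pres_class S R u"
      "v \<in> lists (S \<times> UNIV)" "y = pres_class S R v"
      using xy unfolding carrier_presented_group by blast
    then have "x \<otimes>\<^bsub>?G\<^esub> y = pres_class S R (u @ v)"
      by (simp only: mult_presented_group)
    moreover have "u @ v \<in> lists (S \<times> UNIV)" using uv by simp
    ultimately show ?thesis unfolding carrier_presented_group by (rule image_eqI)
  qed
  show "(x \<otimes>\<^bsub>?G\<^esub> y) \<otimes>\<^bsub>?G\<^esub> z = x \<otimes>\<^bsub>?G\<^esub> (y \<otimes>\<^bsub>?G\<^esub> z)"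
    if xyz: "x \<in> carrier ?G" "y \<in> carrier ?G" "z \<in> carrier ?G" for x y z
  proof -
    obtain u v w where "u \<in> lists (S \<times> UNIV)" "x = pres_class S R u"
      "v \<in> lists (S \<times> UNIV)" "y = pres_class S R v" "w \<in> lists (S \<times> UNIV)" "z = pres_class S R w"
      using xyz unfolding carrier_presented_group by blast
    then show ?thesis
      by (simp only: mult_presented_group append_in_lists_conv append_assoc)
  qed
  show "\<one>\<^bsub>?G\<^esub> \<in> carrier ?G"
    unfolding carrier_presented_group one_presented_group by (rule imageI) simp
  show "\<one>\<^bsub>?G\<^esub> \<otimes>\<^bsub>?G\<^esub> x = x" if x: "x \<in> carrier ?G" for x
  proof -
    obtain u where "u \<in> lists (S \<times> UNIV)" "x = pres_class S R u"
      using x unfolding carrier_presented_group by blast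
    then show ?thesis
      by (simp only: one_presented_group mult_presented_group lists.Nil append_Nil)
  qed
qed

lemma finite_generating_set_presented_group:
  assumes "finite S"
  shows "finite_generating_set (presented_group S R) ((\<lambda>a. pres_class S R [(a, True)]) ` S)"
    (is "finite_generating_set ?G (?g ` S)")
proof -
  interpret G: group ?G by (rule group_presented_group)
  have sub: "?g ` S \<subseteq> carrier ?G" by (auto simp: carrier_presented_group)
  have "pres_class S R w \<in> generate ?G (?g ` S)" if "w \<in> lists (S \<times> UNIV)" for w
    using that
  proof (induction w)
    case Nil
    then show ?case using generate.one[of ?G "?g ` S"] by (simp add: one_presented_group)
  next
    case (Cons x w)
    obtain a e where x: "x = (a, e)" by (cases x)
    have a: "a \<in> S" and w: "w \<in> lists (S \<times> UNIV)" using Cons x by auto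
    have "pres_class S R [(a, False)] \<otimes>\<^bsub>?G\<^esub> ?g a = \<one>\<^bsub>?G\<^esub>"
      using a pres_eq.cancel[of a S R False]
      by (simp add: mult_presented_group one_presented_group pres_class_eq_iff)
    then have "pres_class S R [(a, False)] = inv\<^bsub>?G\<^esub> (?g a)"
      using a by (intro G.inv_equality[symmetric]) (auto simp: carrier_presented_group)
    then have "pres_class S R [x] \<in> generate ?G (?g ` S)"
      using a x by (cases e) (auto intro: generate.incl generate.inv)
    moreover have "pres_class S R (x # w) = pres_class S R [x] \<otimes>\<^bsub>?G\<^esub> pres_class S R w"
      using a w x by (simp add: mult_presented_group)
    ultimately show ?case using Cons by (auto intro: generate.eng)
  qed
  then have "carrier ?G \<subseteq> generate ?G (?g ` S)" by (auto simp: carrier_presented_group)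
  then show ?thesis
    using assms sub G.generate_incl[OF sub] unfolding finite_generating_set_def by auto
qed

section \<open>Artin and Coxeter groups\<close>

text \<open>An edge is the two-element set of its endpoints.\<close>

record 'v labeled_graph =
  verts :: "'v set"
  edges :: "'v set set"
  label :: "'v set \<Rightarrow> nat"

definition finite_simplicial_labeled_graph :: "'v labeled_graph \<Rightarrow> bool" where
  "finite_simplicial_labeled_graph \<Gamma> \<longleftrightarrow>
     finite (verts \<Gamma>)
     \<and> (\<forall>e\<in>edges \<Gamma>. e \<subseteq> verts \<Gamma> \<and> card e = 2)
     \<and> (\<forall>e\<in>edges \<Gamma>. label \<Gamma> e > 1)"

definition clique :: "'v labeled_graph \<Rightarrow> 'v set \<Rightarrow> bool" where
  "clique \<Gamma> C \<longleftrightarrow> C \<subseteq> verts \<Gamma> \<and> (\<forall>a\<in>C. \<forall>b\<in>C. a \<noteq> b \<longrightarrow> {a, b} \<in> edges \<Gamma>)"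

definition Sim :: "'v labeled_graph \<Rightarrow> nat" where
  "Sim \<Gamma> = Max (card ` {C. clique \<Gamma> C})"

text \<open>Completeness of the graph, i.e. the associated groups being free of infinity.\<close>

definition free_of_infinity :: "'v labeled_graph \<Rightarrow> bool" where
  "free_of_infinity \<Gamma> \<longleftrightarrow> (\<forall>a\<in>verts \<Gamma>. \<forall>b\<in>verts \<Gamma>. a \<noteq> b \<longrightarrow> {a, b} \<in> edges \<Gamma>)"

text \<open>The alternating word \<open>a b a \<dots>\<close> with the given number of letters.\<close>

primrec alternating :: "'v \<Rightarrow> 'v \<Rightarrow> nat \<Rightarrow> 'v word" where
  "alternating a b 0 = []"
| "alternating a b (Suc n) = (a, True) # alternating b a n"

definition braid_relations :: "'v labeled_graph \<Rightarrow> ('v word \<times> 'v word) set" where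
  "braid_relations \<Gamma> =
     {(alternating a b (label \<Gamma> {a, b}), alternating b a (label \<Gamma> {a, b})) | a b. {a, b} \<in> edges \<Gamma>}"

definition artin_group :: "'v labeled_graph \<Rightarrow> 'v word set monoid" where
  "artin_group \<Gamma> = presented_group (verts \<Gamma>) (braid_relations \<Gamma>)"

definition coxeter_group :: "'v labeled_graph \<Rightarrow> 'v word set monoid" where
  "coxeter_group \<Gamma> =
     presented_group (verts \<Gamma>)
       ({([(a, True), (a, True)], []) | a. a \<in> verts \<Gamma>} \<union> braid_relations \<Gamma>)"

end

theory Submission
  imports Defs "HOL-Library.Sublist"
begin

text \<open>
  Induction on the number of vertices. If \<open>\<Gamma>\<close> is not complete, some vertex \<open>a\<close> is not joined to all
  others, and \<open>A\<^sub>\<Gamma>\<close> is the amalgam of the groups of the star of \<open>a\<close> and of \<open>\<Gamma> - a\<close> along the group of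
  the link of \<open>a\<close>. As \<open>Sim (link a) + 1 \<le> Sim \<Gamma>\<close>, the bound follows from Dranishnikov's inequality
  \<open>asdim (A *\<^sub>C B) \<le> max (asdim A) (asdim B) (asdim C + 1)\<close>.

  The inequality is proved by colourings whose colour classes have bounded \<open>r\<close>-chain components. The Bass-Serre
  tree is cut at levels far apart, every cut edge space is surrounded by \<open>n + 1\<close> concentric shells, and the
  \<open>j\<close>-th shell is coloured by the \<open>n\<close> colours different from \<open>j\<close>; so no colour can connect the two sides.

  That subgraphs generate isometrically embedded subgroups follows from a retraction of words (Charney and Paris;
  Blufstein and Paris): the group acts on the shortest coset representatives of a parabolic subgroup of the
  Coxeter group, and a generator that fixes a coset contributes a letter of the subgraph. The necessary facts on
  cosets come from the positivity of roots in the geometric representation.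
\<close>

section \<open>Asymptotic dimension by colourings\<close>

text \<open>In terms of colours, \<open>unif_colorable n\<close> expresses asymptotic dimension at
  most n - 1. An edge space that gets by with n of the n + 1 colours leaves one to spare, and a
  shell spends this freedom on the colour that it omits; with one shell per colour, every colour is
  blocked once. This is where the term \<open>asdim C + 1\<close> comes from.

  The main obstacle is metric. The induction hypothesis concerns the abstract group of a subgraph
  with its own word metric, while the amalgam theorem concerns a subset of the large group with the
  restricted metric. Only an identification that preserves distances closes this gap. It has to work
  for Artin groups too, although the available geometry is that of Coxeter groups: therefore
  operators of the Coxeter group move the cosets, while the letters are recorded in any group H that
  satisfies the braid relations. Both kinds of groups then share one argument, and the squares of
  generators are one more relation to check.

  The factors of the amalgam are subgroups of the whole group from the outset, so normal forms are
  built from its own elements.\<close>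

context Metric_space
begin

definition near :: "real \<Rightarrow> 'a set \<Rightarrow> ('a \<times> 'a) set" where
  "near r Z = {(x, y). x \<in> Z \<and> y \<in> Z \<and> d x y \<le> r}"

definition chain_bounded :: "real \<Rightarrow> real \<Rightarrow> 'a set \<Rightarrow> bool" where
  "chain_bounded r D Z \<longleftrightarrow> (\<forall>x\<in>Z. \<forall>y. (x, y) \<in> (near r Z)\<^sup>* \<longrightarrow> d x y \<le> D)"

definition colorable :: "nat \<Rightarrow> real \<Rightarrow> real \<Rightarrow> 'a set \<Rightarrow> bool" where
  "colorable N r D Y \<longleftrightarrow>
     (\<exists>\<kappa>. (\<forall>x\<in>Y. \<kappa> x < N) \<and> (\<forall>i<N. chain_bounded r D {x\<in>Y. \<kappa> x = i}))"

text \<open>The bound depends on the scale but not on the member; this allows infinitely many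
  translates to be assembled.\<close>

definition unif_colorable :: "nat \<Rightarrow> 'a set set \<Rightarrow> bool" where
  "unif_colorable N \<Y> \<longleftrightarrow> (\<forall>r>0. \<exists>D. \<forall>Y\<in>\<Y>. colorable N r D Y)"

lemma near_mono: "Z \<subseteq> Z' \<Longrightarrow> r \<le> r' \<Longrightarrow> near r Z \<subseteq> near r' Z'"
  by (auto simp: near_def)

lemma near_rtrancl_mem: "(x, y) \<in> (near r Z)\<^sup>* \<Longrightarrow> x \<in> Z \<Longrightarrow> y \<in> Z"
  by (induction rule: rtrancl_induct) (auto simp: near_def)

lemma near_rtrancl_sym: "(x, y) \<in> (near r Z)\<^sup>* \<Longrightarrow> (y, x) \<in> (near r Z)\<^sup>*"
proof -
  have "sym (near r Z)" by (auto intro!: symI simp: near_def commute)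
  then show "(x, y) \<in> (near r Z)\<^sup>* \<Longrightarrow> (y, x) \<in> (near r Z)\<^sup>*"
    using sym_rtrancl by (blast dest: symD)
qed

lemma chain_bounded_mono:
  assumes "chain_bounded r' D' Z'" "Z \<subseteq> Z'" "r \<le> r'" "D' \<le> D"
  shows "chain_bounded r D Z"
  unfolding chain_bounded_def
proof (intro ballI allI impI)
  fix x y assume "x \<in> Z" "(x, y) \<in> (near r Z)\<^sup>*"
  moreover have "(near r Z)\<^sup>* \<subseteq> (near r' Z')\<^sup>*" using near_mono[OF assms(2,3)] by (rule rtrancl_mono)
  ultimately have "d x y \<le> D'" using assms(1,2) unfolding chain_bounded_def by blast
  then show "d x y \<le> D" using assms(4) by simp
qed

lemma chain_boundedD: "chain_bounded r D Z \<Longrightarrow> (x, y) \<in> (near r Z)\<^sup>* \<Longrightarrow> x \<in> Z \<Longrightarrow> d x y \<le> D"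
  by (simp add: chain_bounded_def)

text \<open>A chain cannot leave a fibre of P, so a bound common to all fibres suffices. Most
  colourings below are estimated by finding a suitable P.\<close>

lemma chain_bounded_invariant:
  assumes inv: "\<And>x y. (x, y) \<in> near r Z \<Longrightarrow> P x = P y"
    and bdd: "\<And>p. chain_bounded r D {x\<in>Z. P x = p}"
  shows "chain_bounded r D Z"
  unfolding chain_bounded_def
proof (intro ballI allI impI)
  fix x y assume x: "x \<in> Z" and xy: "(x, y) \<in> (near r Z)\<^sup>*"
  have "(x, y) \<in> (near r {z\<in>Z. P z = P x})\<^sup>* \<and> P y = P x"
    using xy
  proof (induction rule: rtrancl_induct)
    case (step y z)
    then have "(y, z) \<in> near r {z\<in>Z. P z = P x}" using inv[of y z] by (auto simp: near_def)
    then show ?case using step inv[of y z] by (auto intro: rtrancl_into_rtrancl)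
  qed simp
  then show "d x y \<le> D" using chain_boundedD[OF bdd, of x y "P x"] x by auto
qed

text \<open>An excursion of an r-chain from Z2 into Z1 stays in one r-component of Z1, so it returns
  to Z2 at most \<open>D1 + 2 * r\<close> away from its departure. For s this large the visited
  points of Z2 form an s-chain, and each end of the chain adds at most
  \<open>D1 + r\<close>.\<close>

lemma chain_bounded_Un:
  assumes Z: "Z1 \<subseteq> M" "Z2 \<subseteq> M"
    and b1: "chain_bounded r D1 Z1" and b2: "chain_bounded s D2 Z2"
    and s: "D1 + 2 * r \<le> s" and pos: "0 \<le> r" "0 \<le> D1" "0 \<le> D2"
  shows "chain_bounded r (D2 + 2 * (D1 + r)) (Z1 \<union> Z2)"
proof -
  let ?Z = "Z1 \<union> Z2"
  \<comment> \<open>Here z is the last visited point of Z2: the current point y is z itself or lies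
    in a component of Z1 entered within r of z.\<close>
  define close where "close z y \<longleftrightarrow> z = y \<or> (\<exists>y'\<in>Z1. d z y' \<le> r \<and> (y', y) \<in> (near r Z1)\<^sup>*)" for z y
  have close_d: "d z y \<le> D1 + r" if "close z y" "z \<in> ?Z" "y \<in> ?Z" for z y
  proof (cases "z = y")
    case True
    then show ?thesis using pos that Z by auto
  next
    case False
    then obtain y' where y': "y' \<in> Z1" "d z y' \<le> r" "(y', y) \<in> (near r Z1)\<^sup>*"
      using \<open>close z y\<close> by (auto simp: close_def)
    then have *: "d y' y \<le> D1" "y \<in> Z1" using b1 chain_boundedD near_rtrancl_mem by blast+
    have "z \<in> M" "y' \<in> M" "y \<in> M" using * y' that Z by auto
    then show ?thesis using triangle[of z y' y] * y' by simp
  qed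
  have from2: "\<exists>z\<in>Z2. (x, z) \<in> (near s Z2)\<^sup>* \<and> close z y"
    if x: "x \<in> Z2" and xy: "(x, y) \<in> (near r ?Z)\<^sup>*" for x y
    using xy
  proof (induction rule: rtrancl_induct)
    case base
    show ?case using x by (auto simp: close_def)
  next
    case (step y y2)
    then obtain z where z: "z \<in> Z2" "(x, z) \<in> (near s Z2)\<^sup>*" "close z y" by blast
    have y: "y \<in> ?Z" "y2 \<in> ?Z" "d y y2 \<le> r" using step by (auto simp: near_def)
    show ?case
    proof (cases "y2 \<in> Z2")
      case True
      have "d z y2 \<le> D1 + r + r"
        using close_d[OF z(3)] z(1) y triangle[of z y y2] Z by (auto simp: subset_iff)
      then have "(z, y2) \<in> near s Z2" using s z(1) True by (auto simp: near_def)
      then have "(x, y2) \<in> (near s Z2)\<^sup>*" using z(2) by (rule rtrancl_into_rtrancl[rotated])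
      then show ?thesis using True by (auto simp: close_def)
    next
      case False
      then have y2: "y2 \<in> Z1" using y by auto
      have "close z y2"
      proof (cases "z = y")
        case True
        then show ?thesis using y y2 unfolding close_def by blast
      next
        case False
        then obtain y' where y': "y' \<in> Z1" "d z y' \<le> r" "(y', y) \<in> (near r Z1)\<^sup>*"
          using z(3) by (auto simp: close_def)
        then have "y \<in> Z1" using near_rtrancl_mem by blast
        then have "(y, y2) \<in> near r Z1" using y2 y by (auto simp: near_def)
        then show ?thesis using y' unfolding close_def by (meson rtrancl_into_rtrancl)
      qed
      then show ?thesis using z by blast
    qed
  qed
  have dist2: "d x y \<le> D2 + (D1 + r)" if x: "x \<in> Z2" and xy: "(x, y) \<in> (near r ?Z)\<^sup>*" for x y
  proof -
    have y: "y \<in> ?Z" using near_rtrancl_mem[OF xy] x by auto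
    obtain z where z: "z \<in> Z2" "(x, z) \<in> (near s Z2)\<^sup>*" "close z y" using from2[OF x xy] by blast
    have "d x z \<le> D2" using chain_boundedD[OF b2 z(2) x] .
    moreover have "d z y \<le> D1 + r" using close_d[OF z(3)] z(1) y by auto
    ultimately show ?thesis using triangle[of x z y] x y z(1) Z by (auto simp: subset_iff)
  qed
  have from1: "(x, y) \<in> (near r Z1)\<^sup>* \<or>
      (\<exists>y1\<in>Z1. \<exists>y2\<in>Z2. (x, y1) \<in> (near r Z1)\<^sup>* \<and> d y1 y2 \<le> r \<and> (y2, y) \<in> (near r ?Z)\<^sup>*)"
    if x: "x \<in> Z1" and xy: "(x, y) \<in> (near r ?Z)\<^sup>*" for x y
    using xy
  proof (induction rule: rtrancl_induct)
    case (step y z)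
    from step.IH show ?case
    proof
      assume *: "(x, y) \<in> (near r Z1)\<^sup>*"
      then have y: "y \<in> Z1" using near_rtrancl_mem x by blast
      show ?thesis
      proof (cases "z \<in> Z1")
        case True
        then have "(y, z) \<in> near r Z1" using step.hyps y by (auto simp: near_def)
        then show ?thesis using * by (auto intro: rtrancl_into_rtrancl)
      next
        case False
        then have "z \<in> Z2" "d y z \<le> r" using step.hyps by (auto simp: near_def)
        then show ?thesis using * y by blast
      qed
    next
      assume "\<exists>y1\<in>Z1. \<exists>y2\<in>Z2. (x, y1) \<in> (near r Z1)\<^sup>* \<and> d y1 y2 \<le> r \<and> (y2, y) \<in> (near r ?Z)\<^sup>*"
      then show ?thesis using step.hyps by (meson rtrancl_into_rtrancl)
    qed
  qed simp
  show ?thesis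
    unfolding chain_bounded_def
  proof (intro ballI allI impI)
    fix x y assume x: "x \<in> ?Z" and xy: "(x, y) \<in> (near r ?Z)\<^sup>*"
    have y: "y \<in> ?Z" using near_rtrancl_mem[OF xy x] .
    show "d x y \<le> D2 + 2 * (D1 + r)"
    proof (cases "x \<in> Z2")
      case True
      then show ?thesis using dist2[OF _ xy] pos by simp
    next
      case False
      then have x1: "x \<in> Z1" using x by auto
      from from1[OF this xy] show ?thesis
      proof
        assume "(x, y) \<in> (near r Z1)\<^sup>*"
        then show ?thesis using chain_boundedD[OF b1 _ x1] pos by fastforce
      next
        assume "\<exists>y1\<in>Z1. \<exists>y2\<in>Z2. (x, y1) \<in> (near r Z1)\<^sup>* \<and> d y1 y2 \<le> r \<and> (y2, y) \<in> (near r ?Z)\<^sup>*"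
        then obtain y1 y2 where *: "y1 \<in> Z1" "y2 \<in> Z2" "(x, y1) \<in> (near r Z1)\<^sup>*" "d y1 y2 \<le> r"
          "(y2, y) \<in> (near r ?Z)\<^sup>*" by blast
        have "d x y1 \<le> D1" using chain_boundedD[OF b1 *(3) x1] .
        moreover have "d y2 y \<le> D2 + (D1 + r)" using dist2 * by blast
        moreover have "d x y \<le> d x y1 + (d y1 y2 + d y2 y)"
          using triangle[of x y1 y] triangle[of y1 y2 y] * x y Z by (auto simp: subset_iff)
        ultimately show ?thesis using * by simp
      qed
    qed
  qed
qed

lemma colorable_mono:
  assumes "colorable N' r' D' Y'" "Y \<subseteq> Y'" "N' \<le> N" "r \<le> r'" "D' \<le> D"
  shows "colorable N r D Y"
proof -
  obtain \<kappa> where \<kappa>: "\<forall>x\<in>Y'. \<kappa> x < N'" "\<forall>i<N'. chain_bounded r' D' {x\<in>Y'. \<kappa> x = i}"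
    using assms(1) by (auto simp: colorable_def)
  have "chain_bounded r D {x\<in>Y. \<kappa> x = i}" for i
  proof (cases "i < N'")
    case True
    then show ?thesis using \<kappa>(2) assms by (blast intro: chain_bounded_mono)
  next
    case False
    then have "{x\<in>Y. \<kappa> x = i} = {}" using \<kappa>(1) assms(2) by auto
    then show ?thesis unfolding \<open>{x\<in>Y. \<kappa> x = i} = {}\<close> by (simp add: chain_bounded_def)
  qed
  moreover have "\<forall>x\<in>Y. \<kappa> x < N" using \<kappa>(1) assms by (meson order_less_le_trans subset_iff)
  ultimately show ?thesis unfolding colorable_def by blast
qed

lemma colorableE:
  assumes "colorable N r D Y"
  obtains \<kappa> where "\<forall>x\<in>Y. \<kappa> x < N" "\<forall>i. chain_bounded r D {x\<in>Y. \<kappa> x = i}"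
proof -
  obtain \<kappa> where \<kappa>: "\<forall>x\<in>Y. \<kappa> x < N" "\<forall>i<N. chain_bounded r D {x\<in>Y. \<kappa> x = i}"
    using assms by (auto simp: colorable_def)
  have "chain_bounded r D {x\<in>Y. \<kappa> x = i}" for i
  proof (cases "i < N")
    case False
    then have "{x\<in>Y. \<kappa> x = i} = {}" using \<kappa>(1) by auto
    then show ?thesis unfolding \<open>{x\<in>Y. \<kappa> x = i} = {}\<close> by (simp add: chain_bounded_def)
  qed (use \<kappa> in blast)
  then show ?thesis using that \<kappa>(1) by blast
qed

lemma colorable_Un:
  assumes "Y1 \<subseteq> M" "Y2 \<subseteq> M" "colorable N r D1 Y1" "colorable N s D2 Y2"
    and "D1 + 2 * r \<le> s" "0 \<le> r" "0 \<le> D1" "0 \<le> D2"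
  shows "colorable N r (D2 + 2 * (D1 + r)) (Y1 \<union> Y2)"
proof -
  obtain \<kappa>1 where \<kappa>1: "\<forall>x\<in>Y1. \<kappa>1 x < N" "\<forall>i. chain_bounded r D1 {x\<in>Y1. \<kappa>1 x = i}"
    using assms(3) by (elim colorableE)
  obtain \<kappa>2 where \<kappa>2: "\<forall>x\<in>Y2. \<kappa>2 x < N" "\<forall>i. chain_bounded s D2 {x\<in>Y2. \<kappa>2 x = i}"
    using assms(4) by (elim colorableE)
  define \<kappa> where "\<kappa> x = (if x \<in> Y1 then \<kappa>1 x else \<kappa>2 x)" for x
  have "chain_bounded r (D2 + 2 * (D1 + r)) {x\<in>Y1 \<union> Y2. \<kappa> x = i}" for i
  proof (rule chain_bounded_mono)
    show "chain_bounded r (D2 + 2 * (D1 + r)) ({x\<in>Y1. \<kappa>1 x = i} \<union> {x\<in>Y2. \<kappa>2 x = i})"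
      using assms \<kappa>1(2) \<kappa>2(2) by (intro chain_bounded_Un) auto
  qed (auto simp: \<kappa>_def)
  moreover have "\<forall>x\<in>Y1 \<union> Y2. \<kappa> x < N" using \<kappa>1(1) \<kappa>2(1) by (auto simp: \<kappa>_def)
  ultimately show ?thesis unfolding colorable_def by blast
qed

lemma unif_colorableE:
  assumes "unif_colorable N \<Y>"
  obtains D where "D \<ge> 0" "\<And>Y. Y \<in> \<Y> \<Longrightarrow> colorable N r D Y"
proof -
  \<comment> \<open>A colouring at scale \<open>max r 1\<close> serves all smaller scales, so the
    rule puts no sign condition on r; \<open>max D 0\<close> provides the sign that unions ask
    for.\<close>
  obtain D where D: "\<forall>Y\<in>\<Y>. colorable N (max r 1) D Y"
    using assms unfolding unif_colorable_def by (metis max.strict_coboundedI2 zero_less_one)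
  show ?thesis
  proof (rule that[of "max D 0"])
    show "colorable N r (max D 0) Y" if "Y \<in> \<Y>" for Y
      using colorable_mono[of N "max r 1" D Y Y N r "max D 0"] D that by simp
  qed simp
qed

lemma unif_colorable_mono:
  assumes "unif_colorable N' \<Y>'" "N' \<le> N" "\<And>Y. Y \<in> \<Y> \<Longrightarrow> \<exists>Y'\<in>\<Y>'. Y \<subseteq> Y'"
  shows "unif_colorable N \<Y>"
  unfolding unif_colorable_def
proof (intro allI impI)
  fix r :: real
  obtain D where "\<And>Y. Y \<in> \<Y>' \<Longrightarrow> colorable N' r D Y" using assms(1) by (rule unif_colorableE) blast
  then have "\<forall>Y\<in>\<Y>. colorable N r D Y"
    using assms(2,3) by (meson colorable_mono order_refl)
  then show "\<exists>D. \<forall>Y\<in>\<Y>. colorable N r D Y" by blast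
qed

definition nbhd :: "real \<Rightarrow> 'a set \<Rightarrow> 'a set" where
  "nbhd R Y = {x\<in>M. \<exists>y\<in>Y. d x y \<le> R}"

text \<open>Every point borrows the colour of a point of Y within R. Moving both ends of a step
  costs R each, whence the scale \<open>r + 2 * R\<close> and the bound
  \<open>D + 2 * R\<close>.\<close>

lemma unif_colorable_nbhd:
  assumes "unif_colorable N \<Y>" "\<And>Y. Y \<in> \<Y> \<Longrightarrow> Y \<subseteq> M"
  shows "unif_colorable N (nbhd R ` \<Y>)"
  unfolding unif_colorable_def
proof (intro allI impI)
  fix r :: real assume "r > 0"
  obtain D where D: "D \<ge> 0" "\<And>Y. Y \<in> \<Y> \<Longrightarrow> colorable N (r + 2 * R) D Y"
    using assms(1) by (rule unif_colorableE) blast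
  have "colorable N r (D + 2 * R) (nbhd R Y)" if Y: "Y \<in> \<Y>" for Y
  proof -
    obtain \<kappa> where \<kappa>: "\<forall>x\<in>Y. \<kappa> x < N" "\<forall>i. chain_bounded (r + 2 * R) D {x\<in>Y. \<kappa> x = i}"
      using D(2)[OF Y] by (elim colorableE)
    have "\<exists>f. \<forall>x\<in>nbhd R Y. f x \<in> Y \<and> d x (f x) \<le> R" unfolding nbhd_def by (rule bchoice) auto
    then obtain f where f: "\<And>x. x \<in> nbhd R Y \<Longrightarrow> f x \<in> Y \<and> d x (f x) \<le> R" by blast
    have in_M: "x \<in> M" if "x \<in> nbhd R Y \<or> x \<in> Y" for x
      using that assms(2)[OF Y] by (auto simp: nbhd_def)
    have "chain_bounded r (D + 2 * R) {x\<in>nbhd R Y. \<kappa> (f x) = i}" (is "chain_bounded r _ ?Z") for i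
      unfolding chain_bounded_def
    proof (intro ballI allI impI)
      fix x y assume x: "x \<in> ?Z" and xy: "(x, y) \<in> (near r ?Z)\<^sup>*"
      have y: "y \<in> ?Z" using near_rtrancl_mem[OF xy x] .
      have "(f x, f y) \<in> (near (r + 2 * R) {x\<in>Y. \<kappa> x = i})\<^sup>*" using xy
      proof (induction rule: rtrancl_induct)
        case (step y z)
        then have yz: "y \<in> ?Z" "z \<in> ?Z" "d y z \<le> r" by (auto simp: near_def)
        have "d (f y) (f z) \<le> d (f y) y + (d y z + d z (f z))"
          using triangle[of "f y" y "f z"] triangle[of y z "f z"] yz f in_M
          by (smt (verit) mem_Collect_eq)
        also have "\<dots> \<le> r + 2 * R" using f[of y] f[of z] yz commute[of y "f y"] by auto
        finally show ?case using step yz f by (auto simp: near_def intro: rtrancl_into_rtrancl)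
      qed simp
      then have "d (f x) (f y) \<le> D" using chain_boundedD[OF \<kappa>(2)[rule_format]] f x by auto
      moreover have "d x y \<le> d x (f x) + (d (f x) (f y) + d (f y) y)"
        using triangle[of x "f x" y] triangle[of "f x" "f y" y] x y f in_M
        by (smt (verit) mem_Collect_eq)
      ultimately show "d x y \<le> D + 2 * R"
        using f[of x] f[of y] x y commute[of y "f y"] by auto
    qed
    moreover have "\<forall>x\<in>nbhd R Y. \<kappa> (f x) < N" using \<kappa>(1) f by blast
    ultimately show ?thesis unfolding colorable_def by (intro exI[of _ "\<lambda>x. \<kappa> (f x)"]) blast
  qed
  then show "\<exists>D. \<forall>Y\<in>nbhd R ` \<Y>. colorable N r D Y" by blast
qed

text \<open>The colour counts the cover elements near a point. Over n + 2 growing radii the sets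
  \<open>K i x\<close> increase but keep between 1 and n + 1 elements, so two consecutive ones
  coincide; this stable set \<tau> x is the signature of x. Close points whose signatures have the
  same size have the same signature, and points with the same signature are near a common cover
  element.\<close>

lemma asdim_at_most_imp_unif_colorable:
  assumes "asdim_at_most n"
  shows "unif_colorable (Suc n) {M}"
  unfolding unif_colorable_def
proof (intro allI impI)
  fix r :: real assume r: "r > 0"
  \<comment> \<open>One increment of the radius exceeds r, so raising the index by one absorbs a
    move from x to a close y.\<close>
  define \<rho> where "\<rho> = r + 1"
  define R where "R = real (n + 2) * \<rho>"
  have "R > 0" using r by (auto simp: R_def \<rho>_def)
  then obtain \<U> D where U: "\<Union>\<U> = M" "\<forall>U\<in>\<U>. \<forall>x\<in>U. \<forall>y\<in>U. d x y \<le> D"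
    "\<forall>x\<in>M. finite {U\<in>\<U>. U \<inter> mball x R \<noteq> {}} \<and> card {U\<in>\<U>. U \<inter> mball x R \<noteq> {}} \<le> n + 1"
    using assms unfolding asdim_at_most_def by meson
  define K where "K i x = {U\<in>\<U>. U \<inter> mball x (real (Suc i) * \<rho>) \<noteq> {}}" for i x
  have mb: "mball x s \<subseteq> mball x t" if "s \<le> t" for x s t using that by auto
  have K_mono: "K i x \<subseteq> K j x" if "i \<le> j" for i j x
  proof -
    have "real (Suc i) * \<rho> \<le> real (Suc j) * \<rho>" using that r by (auto simp: \<rho>_def intro!: mult_right_mono)
    from mb[OF this] show ?thesis unfolding K_def by blast
  qed
  have K_top: "K (Suc n) x = {U\<in>\<U>. U \<inter> mball x R \<noteq> {}}" for x
    by (simp add: K_def R_def algebra_simps)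
  have fin: "finite (K i x)" and card_le: "card (K i x) \<le> n + 1" if "i \<le> Suc n" "x \<in> M" for i x
  proof -
    have "finite (K (Suc n) x)" "card (K (Suc n) x) \<le> n + 1" using U(3) that(2) unfolding K_top by auto
    then show "finite (K i x)" "card (K i x) \<le> n + 1"
      using K_mono[OF that(1), of x] by (meson finite_subset card_mono le_trans)+
  qed
  have K_ne: "K i x \<noteq> {}" if "x \<in> M" for i x
  proof -
    obtain U where "U \<in> \<U>" "x \<in> U" using U(1) \<open>x \<in> M\<close> by auto
    moreover have "x \<in> mball x (real (Suc i) * \<rho>)" using \<open>x \<in> M\<close> r by (auto simp: \<rho>_def)
    ultimately show ?thesis unfolding K_def by blast
  qed
  have "\<exists>i\<le>n. K i x = K (Suc i) x" if x: "x \<in> M" for x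
  proof (rule ccontr)
    assume "\<not> ?thesis"
    then have strict: "K i x \<subset> K (Suc i) x" if "i \<le> n" for i using K_mono[of i "Suc i" x] that by auto
    have "i < card (K i x)" if "i \<le> Suc n" for i using that
    proof (induction i)
      case 0
      then show ?case using fin[of 0 x] K_ne[OF x, of 0] x by (simp add: card_gt_0_iff)
    next
      case (Suc i)
      have "card (K i x) < card (K (Suc i) x)" using Suc.prems strict[of i] fin[of "Suc i" x] x by (intro psubset_card_mono) auto
      then show ?case using Suc by simp
    qed
    from this[of "Suc n"] show False using card_le[of "Suc n" x] x by simp
  qed
  then obtain I where I: "\<And>x. x \<in> M \<Longrightarrow> I x \<le> n \<and> K (I x) x = K (Suc (I x)) x" by metis
  define \<tau> where "\<tau> x = K (I x) x" for x
  have step: "\<tau> x = \<tau> y"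
    if xy: "x \<in> M" "y \<in> M" "d x y \<le> r" "card (\<tau> x) = card (\<tau> y)" "I x \<le> I y" for x y
  proof -
    have sub: "mball x (real (Suc (I x)) * \<rho>) \<subseteq> mball y (real (Suc (Suc (I x))) * \<rho>)"
    proof
      fix z assume "z \<in> mball x (real (Suc (I x)) * \<rho>)"
      then have z: "z \<in> M" "d x z < real (Suc (I x)) * \<rho>" by auto
      have "d y z \<le> r + d x z" using triangle[of y x z] xy z commute[of x y] by simp
      also have "\<dots> < \<rho> + real (Suc (I x)) * \<rho>" using z by (simp add: \<rho>_def)
      also have "\<dots> = real (Suc (Suc (I x))) * \<rho>" by (simp add: algebra_simps)
      finally show "z \<in> mball y (real (Suc (Suc (I x))) * \<rho>)" using xy z by simp
    qed
    \<comment> \<open>The move raises the index by one, stability at y takes this back, and equal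
      cardinality turns the inclusion into an equality.\<close>
    have "\<tau> x \<subseteq> K (Suc (I x)) y" using sub unfolding \<tau>_def K_def by blast
    also have "\<dots> \<subseteq> K (Suc (I y)) y" using K_mono xy(5) by simp
    finally have "\<tau> x \<subseteq> \<tau> y" using I[OF xy(2)] by (simp add: \<tau>_def)
    moreover have "finite (\<tau> y)" using I[OF xy(2)] fin[of "I y" y] xy(2) by (simp add: \<tau>_def)
    ultimately show ?thesis using xy(4) card_subset_eq by blast
  qed
  define \<kappa> where "\<kappa> x = card (\<tau> x) - 1" for x
  have card_pos: "card (\<tau> x) > 0" "card (\<tau> x) \<le> n + 1" if "x \<in> M" for x
    using that K_ne[of x "I x"] fin[of "I x" x] I[of x] card_le[of "I x" x] by (auto simp: \<tau>_def card_gt_0_iff)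
  have "chain_bounded r (D + 2 * R) {x\<in>M. \<kappa> x = i}" for i
  proof (rule chain_bounded_invariant[where P = \<tau>])
    fix x y assume "(x, y) \<in> near r {x\<in>M. \<kappa> x = i}"
    then have xy: "x \<in> M" "y \<in> M" "d x y \<le> r" "\<kappa> x = \<kappa> y" by (auto simp: near_def)
    then have "card (\<tau> x) = card (\<tau> y)" using card_pos(1)[of x] card_pos(1)[of y] by (simp add: \<kappa>_def)
    then show "\<tau> x = \<tau> y" using step[of x y] step[of y x] xy commute[of x y] by (metis nle_le)
  next
    fix p
    have "d x y \<le> D + 2 * R" if xy: "x \<in> M" "\<tau> x = p" "y \<in> M" "\<tau> y = p" for x y
    proof -
      obtain U where U': "U \<in> p" using K_ne[OF xy(1)] xy(2) unfolding \<tau>_def by blast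
      have "\<tau> x \<subseteq> K (Suc n) x" "\<tau> y \<subseteq> K (Suc n) y" using I[OF xy(1)] I[OF xy(3)] K_mono by (auto simp: \<tau>_def)
      then have "U \<in> K (Suc n) x" "U \<in> K (Suc n) y" using U' xy by auto
      then obtain x' y' where *: "U \<in> \<U>" "x' \<in> U" "d x x' < R" "x' \<in> M" "y' \<in> U" "d y y' < R" "y' \<in> M"
        unfolding K_top by auto
      have "d x' y' \<le> D" using U(2) * by blast
      moreover have "d x y \<le> d x x' + (d x' y' + d y' y)"
        using triangle[of x x' y] triangle[of x' y' y] xy * by simp
      ultimately show ?thesis using * commute[of y y'] by simp
    qed
    then show "chain_bounded r (D + 2 * R) {x \<in> {x \<in> M. \<kappa> x = i}. \<tau> x = p}"
      unfolding chain_bounded_def using near_rtrancl_mem by blast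
  qed
  moreover have "\<forall>x\<in>M. \<kappa> x < Suc n" using card_pos by (fastforce simp: \<kappa>_def)
  ultimately show "\<exists>D. \<forall>Y\<in>{M}. colorable (Suc n) r D Y" unfolding colorable_def by blast
qed

text \<open>Cover by the components of the colour classes at scale \<open>2 * R\<close>. Two points
  of one R-ball are within this scale, so a ball meets at most one component of each colour.\<close>

lemma unif_colorable_imp_asdim_at_most:
  assumes "unif_colorable (Suc n) {M}"
  shows "asdim_at_most n"
  unfolding asdim_at_most_def
proof (intro allI impI)
  fix R :: real assume R: "R > 0"
  obtain D where "colorable (Suc n) (2 * R) D M" using assms by (rule unif_colorableE) blast
  then obtain \<kappa> where \<kappa>: "\<forall>x\<in>M. \<kappa> x < Suc n" "\<forall>i. chain_bounded (2 * R) D {x\<in>M. \<kappa> x = i}"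
    by (elim colorableE)
  define Z where "Z i = {x\<in>M. \<kappa> x = i}" for i
  define comp where "comp x = {y. (x, y) \<in> (near (2 * R) (Z (\<kappa> x)))\<^sup>*}" for x
  define \<U> where "\<U> = comp ` M"
  have in_comp: "y \<in> Z (\<kappa> x)" if "x \<in> M" "y \<in> comp x" for x y
    using that near_rtrancl_mem[of x y "2 * R" "Z (\<kappa> x)"] by (auto simp: comp_def Z_def)
  have comp_eq: "comp x = comp y" if "x \<in> M" "y \<in> comp x" for x y
  proof -
    have \<kappa>: "\<kappa> y = \<kappa> x" using in_comp[OF that] by (simp add: Z_def)
    have xy: "(x, y) \<in> (near (2 * R) (Z (\<kappa> x)))\<^sup>*" using that by (simp add: comp_def)
    show ?thesis unfolding comp_def \<kappa>
      using rtrancl_trans[OF xy] rtrancl_trans[OF near_rtrancl_sym[OF xy]] by blast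
  qed
  have "x \<in> comp x" for x by (simp add: comp_def)
  moreover have "comp x \<subseteq> M" if "x \<in> M" for x using in_comp[OF that] unfolding Z_def by blast
  ultimately have "\<Union>\<U> = M" unfolding \<U>_def by blast
  moreover have "\<forall>U\<in>\<U>. \<forall>x\<in>U. \<forall>y\<in>U. d x y \<le> D"
  proof (intro ballI)
    fix U x y assume "U \<in> \<U>" "x \<in> U" "y \<in> U"
    then obtain z where z: "z \<in> M" "x \<in> comp z" "y \<in> comp z" by (auto simp: \<U>_def)
    then have "y \<in> comp x" "x \<in> M" using comp_eq[OF z(1,2)] in_comp[OF z(1,2)] by (simp_all add: Z_def)
    then show "d x y \<le> D"
      using \<kappa>(2) chain_boundedD[of "2 * R" D "Z (\<kappa> x)" x y] by (auto simp: comp_def Z_def)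
  qed
  moreover have "finite {U\<in>\<U>. U \<inter> mball x R \<noteq> {}} \<and> card {U\<in>\<U>. U \<inter> mball x R \<noteq> {}} \<le> n + 1"
    (is "finite ?F \<and> _") if x: "x \<in> M" for x
  proof -
    have "\<exists>f. \<forall>U\<in>?F. f U \<in> U \<inter> mball x R" by (rule bchoice) auto
    then obtain f where f: "\<And>U. U \<in> ?F \<Longrightarrow> f U \<in> U \<inter> mball x R" by blast
    have fM: "f U \<in> M" "U = comp (f U)" if U: "U \<in> ?F" for U
    proof -
      obtain z where z: "z \<in> M" "U = comp z" using U by (auto simp: \<U>_def)
      have "f U \<in> U \<inter> mball x R" using f[OF U] .
      then show "f U \<in> M" "U = comp (f U)" using comp_eq[OF z(1), of "f U"] z(2) by auto
    qed
    have inj: "inj_on (\<lambda>U. \<kappa> (f U)) ?F"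
    proof (rule inj_onI)
      fix U V assume UV: "U \<in> ?F" "V \<in> ?F" "\<kappa> (f U) = \<kappa> (f V)"
      have "d (f U) (f V) \<le> d x (f U) + d x (f V)"
        using triangle[of "f U" x "f V"] fM UV x commute[of x "f U"] by auto
      also have "\<dots> \<le> 2 * R" using f[OF UV(1)] f[OF UV(2)] by auto
      finally have "(f U, f V) \<in> near (2 * R) (Z (\<kappa> (f U)))"
        using fM(1) UV by (simp add: near_def Z_def)
      then have "f V \<in> comp (f U)" by (simp add: comp_def r_into_rtrancl)
      then show "U = V" using comp_eq fM UV by metis
    qed
    have "(\<lambda>U. \<kappa> (f U)) ` ?F \<subseteq> {..<Suc n}" using \<kappa>(1) fM(1) by blast
    then have "finite ?F" "card ?F \<le> card {..<Suc n}"
      using inj_on_finite[OF inj] card_inj_on_le[OF inj] by blast+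
    then show ?thesis by simp
  qed
  ultimately show "\<exists>\<U>. \<Union>\<U> = M \<and> (\<exists>D. \<forall>U\<in>\<U>. \<forall>x\<in>U. \<forall>y\<in>U. d x y \<le> D)
      \<and> (\<forall>x\<in>M. finite {U\<in>\<U>. U \<inter> mball x R \<noteq> {}} \<and> card {U\<in>\<U>. U \<inter> mball x R \<noteq> {}} \<le> n + 1)"
    by blast
qed

lemma asdim_at_most_iff_unif_colorable: "asdim_at_most n \<longleftrightarrow> unif_colorable (Suc n) {M}"
  using asdim_at_most_imp_unif_colorable unif_colorable_imp_asdim_at_most by blast

end

section \<open>Tree-like decompositions\<close>

lemma suffix_same_length: "suffix p zs \<Longrightarrow> suffix q zs \<Longrightarrow> length p = length q \<Longrightarrow> p = q"
  by (metis suffix_length_suffix suffix_order.antisym order_refl)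

lemma (in Metric_space) unif_colorable_family:
  assumes "unif_colorable N (range Y)"
  shows "\<exists>D \<kappa>. D \<ge> 0 \<and> (\<forall>p. \<forall>x\<in>Y p. \<kappa> p x < N) \<and> (\<forall>p i. chain_bounded s D {x\<in>Y p. \<kappa> p x = i})"
proof -
  obtain D where D: "D \<ge> 0" "\<And>X. X \<in> range Y \<Longrightarrow> colorable N s D X"
    using assms by (rule unif_colorableE) blast
  have "\<exists>\<kappa>. (\<forall>x\<in>Y p. \<kappa> x < N) \<and> (\<forall>i. chain_bounded s D {x\<in>Y p. \<kappa> x = i})" for p
    using D(2)[of "Y p"] by (auto elim!: colorableE)
  then have "\<forall>p. \<exists>\<kappa>. (\<forall>x\<in>Y p. \<kappa> x < N) \<and> (\<forall>i. chain_bounded s D {x\<in>Y p. \<kappa> x = i})" by blast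
  from choice[OF this] show ?thesis using D(1) by blast
qed

text \<open>A stack is a path to the root of a tree, deepest edge first, so ancestors are suffixes.
  By \<open>separation\<close> the only exit from a branch is its cut edge space, and going there is
  no longer than leaving; \<open>length_le\<close> bounds depth by distance.\<close>

locale stack_space = Metric_space M d for M :: "'a set" and d +
  fixes \<sigma> :: "'a \<Rightarrow> 'b list"
  assumes separation: "x \<in> M \<Longrightarrow> y \<in> M \<Longrightarrow> strict_suffix p (\<sigma> x) \<Longrightarrow> \<not> strict_suffix p (\<sigma> y) \<Longrightarrow>
      \<exists>z\<in>M. \<sigma> z = p \<and> d x z \<le> d x y"
    and length_le: "x \<in> M \<Longrightarrow> y \<in> M \<Longrightarrow> real (length (\<sigma> x)) \<le> real (length (\<sigma> y)) + d x y"
begin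

text \<open>For an amalgam this set lies in a single coset of the amalgamated subgroup.\<close>

definition edge :: "'b list \<Rightarrow> 'a set" where
  "edge p = {x\<in>M. \<sigma> x = p}"

text \<open>The vertex space below an edge, up to the edge space itself; for an amalgam it lies in
  one translate of the union of the two factors.\<close>

definition children :: "'b list \<Rightarrow> 'a set" where
  "children p = {x\<in>M. \<exists>y. \<sigma> x = y # p}"

definition beyond :: "'b list \<Rightarrow> 'a set" where
  "beyond p = {x\<in>M. strict_suffix p (\<sigma> x)}"

definition collar :: "'b list \<Rightarrow> real \<Rightarrow> 'a set" where
  "collar p t = {x\<in>beyond p. \<exists>z\<in>edge p. d x z \<le> t}"

definition subtree :: "'b list \<Rightarrow> nat \<Rightarrow> 'a set" where
  "subtree p m = {x\<in>M. suffix p (\<sigma> x) \<and> length (\<sigma> x) \<le> length p + m}"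

lemma exit_beyond:
  assumes "x \<in> beyond p" "y \<in> M" "y \<notin> beyond p"
  shows "\<exists>z\<in>edge p. d x z \<le> d x y"
  using separation[of x y p] assms by (auto simp: beyond_def edge_def)

lemma collar_length:
  assumes "x \<in> collar p t" shows "length p < length (\<sigma> x)" "real (length (\<sigma> x)) \<le> real (length p) + t"
proof -
  obtain z where z: "x \<in> M" "strict_suffix p (\<sigma> x)" "z \<in> M" "\<sigma> z = p" "d x z \<le> t"
    using assms by (auto simp: collar_def beyond_def edge_def)
  then show "length p < length (\<sigma> x)" by (simp add: suffix_length_less)
  show "real (length (\<sigma> x)) \<le> real (length p) + t" using length_le[OF z(1,3)] z by simp
qed

text \<open>Each further level costs one use of \<open>colorable_Un\<close>. Points of the new level
  away from the old ones can be r-close only if they have the same parent edge: by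
  \<open>separation\<close>, a step between different families passes within r of an old
  level.\<close>

lemma unif_colorable_subtrees:
  assumes edges: "unif_colorable N (range edge)" and children: "unif_colorable N (range children)"
  shows "unif_colorable N (range (\<lambda>p. subtree p m))"
proof (induction m)
  case 0
  show ?case
  proof (rule unif_colorable_mono[OF edges order_refl])
    fix Y assume "Y \<in> range (\<lambda>p. subtree p 0)"
    then obtain p where "Y = subtree p 0" by blast
    moreover have "subtree p 0 \<subseteq> edge p"
      using suffix_same_length[OF _ suffix_order.refl]
      by (fastforce simp: subtree_def edge_def dest: suffix_length_le)
    ultimately show "\<exists>Y'\<in>range edge. Y \<subseteq> Y'" by blast
  qed
next
  case (Suc m)
  show ?case
    unfolding unif_colorable_def
  proof (intro allI impI)
    fix r :: real assume r: "r > 0"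
    obtain D1 \<kappa> where D1: "D1 \<ge> 0" and \<kappa>: "\<And>q x. x \<in> children q \<Longrightarrow> \<kappa> q x < N"
      "\<And>q i. chain_bounded r D1 {x\<in>children q. \<kappa> q x = i}"
      using unif_colorable_family[OF children, of r] by blast
    have "unif_colorable N (nbhd r ` range (\<lambda>p. subtree p m))"
      using Suc by (rule unif_colorable_nbhd) (auto simp: subtree_def)
    then obtain D2 where D2: "D2 \<ge> 0"
      "\<And>Y. Y \<in> nbhd r ` range (\<lambda>p. subtree p m) \<Longrightarrow> colorable N (D1 + 2 * r) D2 Y"
      by (rule unif_colorableE) blast
    have "colorable N r (D2 + 2 * (D1 + r)) (subtree p (Suc m))" for p
    proof -
      define Y2 where "Y2 = nbhd r (subtree p m)"
      \<comment> \<open>Removing an r-neighbourhood of the old levels, not only these levels, is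
        what keeps different families of siblings more than r apart.\<close>
      define Y1 where "Y1 = subtree p (Suc m) - Y2"
      have deep: "\<exists>y q. \<sigma> x = y # q \<and> suffix p q \<and> length q = length p + m" if "x \<in> Y1" for x
      proof -
        have x: "x \<in> M" "suffix p (\<sigma> x)" "length (\<sigma> x) \<le> length p + Suc m"
          using that by (auto simp: Y1_def subtree_def)
        moreover have "x \<notin> subtree p m" using that x(1) r by (auto simp: Y1_def Y2_def nbhd_def)
        ultimately have len: "length (\<sigma> x) = length p + Suc m" by (auto simp: subtree_def)
        then obtain y q where yq: "\<sigma> x = y # q" by (cases "\<sigma> x") auto
        moreover have "suffix p q" using x(2) len yq by (auto simp: suffix_Cons)
        ultimately show ?thesis using len by auto
      qed
      have tl_in: "x \<in> children (tl (\<sigma> x))" if "x \<in> Y1" for x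
        using deep[OF that] that by (auto simp: children_def Y1_def subtree_def)
      have "colorable N r D1 Y1"
        unfolding colorable_def
      proof (intro exI conjI allI impI ballI)
        show "\<kappa> (tl (\<sigma> x)) x < N" if "x \<in> Y1" for x using \<kappa>(1) tl_in[OF that] .
        fix i
        show "chain_bounded r D1 {x\<in>Y1. \<kappa> (tl (\<sigma> x)) x = i}"
        proof (rule chain_bounded_invariant[where P = "\<lambda>x. tl (\<sigma> x)"])
          fix x y assume "(x, y) \<in> near r {x\<in>Y1. \<kappa> (tl (\<sigma> x)) x = i}"
          then have xy: "x \<in> Y1" "y \<in> Y1" "d x y \<le> r" by (auto simp: near_def)
          obtain a q where x: "\<sigma> x = a # q" "suffix p q" "length q = length p + m" using deep xy by blast
          obtain b q' where y: "\<sigma> y = b # q'" "suffix p q'" "length q' = length p + m" using deep xy by blast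
          show "tl (\<sigma> x) = tl (\<sigma> y)"
          proof (rule ccontr)
            assume ne: "tl (\<sigma> x) \<noteq> tl (\<sigma> y)"
            have M: "x \<in> M" "y \<in> M" using xy by (auto simp: Y1_def subtree_def)
            have "suffix q (\<sigma> y) \<Longrightarrow> q = q'"
              by (rule suffix_same_length[of _ "\<sigma> y"]) (use x y in \<open>auto simp: suffix_Cons\<close>)
            then have "\<not> strict_suffix q (\<sigma> y)"
              using ne x y by (auto simp: strict_suffix_def)
            moreover have "strict_suffix q (\<sigma> x)" using x by (auto simp: strict_suffix_def suffix_Cons)
            ultimately obtain z where z: "z \<in> M" "\<sigma> z = q" "d x z \<le> d x y" using separation M by blast
            then have "z \<in> subtree p m" using x by (auto simp: subtree_def)
            moreover have "d x z \<le> r" using z(3) xy(3) by simp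
            ultimately have "x \<in> Y2" using M unfolding Y2_def nbhd_def by blast
            then show False using xy by (simp add: Y1_def)
          qed
        next
          fix q
          show "chain_bounded r D1 {x \<in> {x \<in> Y1. \<kappa> (tl (\<sigma> x)) x = i}. tl (\<sigma> x) = q}"
            by (rule chain_bounded_mono[OF \<kappa>(2)[of q i]]) (use tl_in in auto)
        qed
      qed
      moreover have "colorable N (D1 + 2 * r) D2 Y2" using D2(2) by (simp add: Y2_def)
      ultimately have "colorable N r (D2 + 2 * (D1 + r)) (Y1 \<union> Y2)"
        by (intro colorable_Un) (use r D1 D2 in \<open>auto simp: Y1_def Y2_def subtree_def nbhd_def\<close>)
      then show ?thesis by (rule colorable_mono) (auto simp: Y1_def)
    qed
    then show "\<exists>D. \<forall>Y\<in>range (\<lambda>p. subtree p (Suc m)). colorable N r D Y" by blast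
  qed
qed

text \<open>For a fixed colour i, an r-chain of that colour stays on one side of shell i of every
  cut. Hence the deepest cut beyond whose shell i it lies, \<open>owner i\<close>, is an invariant
  of the chain. The points with a given owner lie in a subtree of bounded depth or in collars of
  cuts, where colourings with bounded components are at hand.\<close>

theorem unif_colorable_stack_space:
  assumes edges: "unif_colorable n (range edge)" and children: "unif_colorable (Suc n) (range children)"
  shows "unif_colorable (Suc n) {M}"
  unfolding unif_colorable_def
proof (intro allI impI)
  fix r :: real assume r: "r > 0"
  \<comment> \<open>The width of a shell: more than one step of a chain.\<close>
  define w where "w = r + 1"
  have w: "w > r" "w > 0" using r by (auto simp: w_def)
  \<comment> \<open>The outer radius of shell n. The strip of width w next to the cut belongs to
    none of its shells and keeps them away from the other side of the cut.\<close>
  define \<rho> where "\<rho> = real (n + 2) * w"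
  define L where "L = nat \<lceil>\<rho> + r\<rceil> + 1"
  have "\<rho> > 0" using w by (simp add: \<rho>_def)
  then have L: "L \<ge> 1" "real L > \<rho> + r" unfolding L_def by linarith+
  define m where "m = 2 * L"
  \<comment> \<open>The root is no cut, so \<open>[]\<close> is free to mark the points that are
    beyond no cut.\<close>
  define cut where "cut p \<longleftrightarrow> p \<noteq> [] \<and> L dvd length p" for p :: "'b list"
  define shell where "shell p j = collar p (real (j + 2) * w) - collar p (real (j + 1) * w)" for p j
  define outside where "outside p j = beyond p - collar p (real (j + 2) * w)" for p j

  have collar_mono: "collar p s \<subseteq> collar p t" if "s \<le> t" for p s t
    using that by (force simp: collar_def)
  have scale: "real i * w \<le> real j * w" if "i \<le> j" for i j using that w by (simp add: mult_right_mono)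
  have shell_collar: "shell p j \<subseteq> collar p \<rho>" if "j \<le> n" for p j
    using collar_mono[OF scale[of "j + 2" "n + 2"]] that by (auto simp: shell_def \<rho>_def)
  have collar_M: "collar p t \<subseteq> M" for p t by (auto simp: collar_def beyond_def)
  have shell_M: "shell p j \<subseteq> M" for p j using collar_M by (auto simp: shell_def)
  have shell_disj: "j = j'" if "x \<in> shell p j" "x \<in> shell p j'" for x p j j'
  proof (rule ccontr)
    have *: False if "x \<in> shell p j" "x \<in> shell p j'" "j < j'" for j j'
      using that collar_mono[OF scale[of "j + 2" "j' + 1"], of p] by (auto simp: shell_def)
    assume "j \<noteq> j'"
    then show False using *[of j j'] *[of j' j] that by linarith
  qed
  have outside_iff: "x \<in> outside p i \<longleftrightarrow> i < j" if "x \<in> shell p j" for x p i j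
  proof (cases "i < j")
    case True
    then show ?thesis using that collar_mono[OF scale[of "i + 2" "j + 1"], of p]
      by (auto simp: shell_def outside_def collar_def)
  next
    case False
    then show ?thesis using that collar_mono[OF scale[of "j + 2" "i + 2"], of p]
      by (auto simp: shell_def outside_def collar_def)
  qed
  \<comment> \<open>A collar of radius \<rho> is less than L deep, so it ends before the next cut
    level.\<close>
  have cut_collar: "length q \<le> length p"
    if "cut p" "cut q" "x \<in> collar p \<rho>" "x \<in> beyond q" for p q x
  proof -
    have "real (length (\<sigma> x)) \<le> length p + \<rho>" using collar_length(2)[OF that(3)] .
    moreover have "length q < length (\<sigma> x)" using that(4) by (auto simp: beyond_def suffix_length_less)
    ultimately have "length q < length p + L" using L r by linarith
    moreover have "L dvd length p" "L dvd length q" using that by (auto simp: cut_def)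
    then obtain a b where "length p = L * a" "length q = L * b" by (auto elim!: dvdE)
    ultimately show ?thesis using L(1)
      by (metis add.commute less_Suc_eq_le mult_Suc_right mult_le_mono2 mult_less_cancel1)
  qed
  have same_suffix: "p = q" if "x \<in> beyond p" "x \<in> beyond q" "length p = length q" for p q x
    using that suffix_same_length[of p "\<sigma> x" q] by (auto simp: beyond_def strict_suffix_def)
  have collar_beyond: "collar p t \<subseteq> beyond p" for p t by (auto simp: collar_def)
  have shell_beyond: "shell p j \<subseteq> beyond p" for p j using collar_beyond by (auto simp: shell_def)
  \<comment> \<open>The strip next to p keeps a step of length at most r inside the branch of p, and
    likewise for q. The end points then lie beyond both cuts, and \<open>cut_collar\<close> in both
    directions equates their lengths.\<close>
  have shell_near: "p = q"
    if "cut p" "cut q" "j \<le> n" "j' \<le> n" "x \<in> shell p j" "y \<in> shell q j'" "d x y \<le> r" for p q j j' x y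
  proof -
    have *: "length p \<le> length q \<and> y \<in> beyond p"
      if *: "cut p" "cut q" "j \<le> n" "j' \<le> n" "x \<in> shell p j" "y \<in> shell q j'" "d x y \<le> r" for p q j j' x y
    proof -
      have "y \<in> beyond p"
      proof (rule ccontr)
        assume "y \<notin> beyond p"
        then obtain z where "z \<in> edge p" "d x z \<le> d x y"
          using exit_beyond[of x p y] * shell_beyond shell_M by blast
        then have "x \<in> collar p w" using that w shell_beyond by (force simp: collar_def)
        moreover have "collar p w \<subseteq> collar p (real (j + 1) * w)"
          using collar_mono scale[of 1 "j + 1"] by simp
        ultimately show False using that by (auto simp: shell_def)
      qed
      then show ?thesis using cut_collar[of q p y] that shell_collar by blast
    qed
    have "length p = length q" using *[of p q j j' x y] *[of q p j' j y x] that commute[of x y] by simp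
    then show ?thesis using same_suffix[of y p q] *[OF that] that shell_beyond by blast
  qed

  have collars: "unif_colorable n (range (\<lambda>p. collar p \<rho>))"
  proof (rule unif_colorable_mono[OF unif_colorable_nbhd[OF edges, of \<rho>] order_refl])
    show "Y \<subseteq> M" if "Y \<in> range edge" for Y using that by (auto simp: edge_def)
    show "\<exists>Y'\<in>nbhd \<rho> ` range edge. Y \<subseteq> Y'" if "Y \<in> range (\<lambda>p. collar p \<rho>)" for Y
      using that collar_M by (fastforce simp: nbhd_def collar_def beyond_def)
  qed
  have subtrees: "unif_colorable (Suc n) (range (\<lambda>p. subtree p m))"
    by (intro unif_colorable_subtrees children unif_colorable_mono[OF edges]) auto
  \<comment> \<open>Three colourings at growing scales, prepared for two uses of
    \<open>chain_bounded_Un\<close>: f at scale r, u at a scale that dominates the bound of f, and g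
    at a scale that dominates the bound of the union of the two.\<close>
  obtain Df f where f: "Df \<ge> 0" "\<And>p x. x \<in> collar p \<rho> \<Longrightarrow> f p x < n"
    "\<And>p i. chain_bounded r Df {x\<in>collar p \<rho>. f p x = i}"
    using unif_colorable_family[OF collars, of r] by blast
  obtain Dc u where u: "Dc \<ge> 0" "\<And>p x. x \<in> subtree p m \<Longrightarrow> u p x < Suc n"
    "\<And>p i. chain_bounded (Df + 2 * r) Dc {x\<in>subtree p m. u p x = i}"
    using unif_colorable_family[OF subtrees, of "Df + 2 * r"] by blast
  define D1 where "D1 = Dc + 2 * (Df + r)"
  obtain Dg g where g: "Dg \<ge> 0" "\<And>p x. x \<in> collar p \<rho> \<Longrightarrow> g p x < n"
    "\<And>p i. chain_bounded (D1 + 2 * r) Dg {x\<in>collar p \<rho>. g p x = i}"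
    using unif_colorable_family[OF collars, of "D1 + 2 * r"] by blast
  define D where "D = Dg + 2 * (D1 + r)"

  define in_shell where "in_shell x p j \<longleftrightarrow> cut p \<and> j \<le> n \<and> x \<in> shell p j" for x p j
  have in_shell_unique: "p = q \<and> i = j" if "in_shell x p i" "in_shell x q j" for x p q i j
  proof -
    have "x \<in> M" using that shell_M by (auto simp: in_shell_def)
    then have "p = q" using shell_near[of p q i j x x] that r by (auto simp: in_shell_def)
    then show ?thesis using shell_disj that by (auto simp: in_shell_def)
  qed
  \<comment> \<open>All cuts that x is beyond are suffixes of one stack, so the longest is
    unique.\<close>
  define owner where "owner j x =
    (if \<exists>q. cut q \<and> x \<in> outside q j then ARG_MAX length q. cut q \<and> x \<in> outside q j else [])" for j x
  have owner: "cut (owner j x) \<and> x \<in> outside (owner j x) j \<and> length q \<le> length (owner j x)"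
    if "cut q" "x \<in> outside q j" for q j x
  proof -
    have bound: "\<forall>q. cut q \<and> x \<in> outside q j \<longrightarrow> length q < length (\<sigma> x)"
      by (auto simp: outside_def beyond_def suffix_length_less)
    show ?thesis
      using arg_max_nat_lemma[of "\<lambda>q. cut q \<and> x \<in> outside q j" q length, OF conjI[OF that] bound] that
      unfolding owner_def by auto
  qed
  have owner_unique: "owner j x = p"
    if "cut p" "x \<in> outside p j" "\<And>q. cut q \<Longrightarrow> x \<in> outside q j \<Longrightarrow> length q \<le> length p" for p j x
  proof -
    have "length (owner j x) = length p" using owner[OF that(1,2)] that(3) by (meson le_antisym)
    then show ?thesis using same_suffix[of x] owner[OF that(1,2)] that(2) by (auto simp: outside_def)
  qed
  \<comment> \<open>In shell j of p a point is outside p exactly for the indices below j, and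
    \<open>cut_collar\<close> rules out deeper cuts.\<close>
  have owner_shell: "owner i x = p" if "in_shell x p j" "i < j" for x p i j
  proof (rule owner_unique)
    show "cut p" "x \<in> outside p i" using that outside_iff by (auto simp: in_shell_def)
    show "length q \<le> length p" if "cut q" "x \<in> outside q i" for q
      using cut_collar[of p q x] that \<open>in_shell x p j\<close> shell_collar by (auto simp: in_shell_def outside_def)
  qed
  have owner_shell': "owner i x \<noteq> p" if "in_shell x p j" "j \<le> i" for x p i j
  proof
    assume *: "owner i x = p"
    have "p \<noteq> []" using that by (auto simp: in_shell_def cut_def)
    then have "\<exists>q. cut q \<and> x \<in> outside q i" using * by (auto simp: owner_def split: if_splits)
    then have "x \<in> outside p i" using * owner by blast
    then show False using outside_iff that by (auto simp: in_shell_def)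
  qed
  \<comment> \<open>The outside regions of consecutive indices differ by one shell, so a point in no
    shell cannot tell the indices apart.\<close>
  have outside_core: "x \<in> outside q i \<longleftrightarrow> x \<in> outside q n"
    if core: "\<And>p j. \<not> in_shell x p j" and "cut q" "i \<le> n" for x q i
    using \<open>i \<le> n\<close>
  proof (induction "n - i" arbitrary: i)
    case (Suc k)
    have "x \<in> outside q i \<longleftrightarrow> x \<in> outside q (Suc i)"
    proof -
      have "x \<notin> shell q (Suc i)" using core[of q "Suc i"] Suc \<open>cut q\<close> by (simp add: in_shell_def)
      then show ?thesis using collar_mono[OF scale[of "i + 2" "Suc i + 2"], of q]
        by (auto simp: shell_def outside_def)
    qed
    also have "\<dots> \<longleftrightarrow> x \<in> outside q n" using Suc by (intro Suc(1)) auto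
    finally show ?case .
  qed auto
  have owner_core: "owner i x = owner n x" if "\<And>p j. \<not> in_shell x p j" "i \<le> n" for x i
    using outside_core[OF that(1) _ that(2)] by (simp add: owner_def cong: conj_cong)
  have core_subtree: "x \<in> subtree (owner n x) m" if core: "\<And>p j. \<not> in_shell x p j" and x: "x \<in> M" for x
  proof -
    let ?p = "owner n x"
    have p: "suffix ?p (\<sigma> x) \<and> L dvd length ?p"
    proof (cases "\<exists>q. cut q \<and> x \<in> outside q n")
      case True
      then show ?thesis using owner by (auto simp: outside_def beyond_def cut_def strict_suffix_def)
    next
      case False
      then have "owner n x = []" unfolding owner_def by (rule if_not_P)
      then show ?thesis by simp
    qed
    have "length (\<sigma> x) \<le> length ?p + m"
    proof (rule ccontr)
      assume long: "\<not> ?thesis"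
      \<comment> \<open>The cut on the stack of x one level below its owner. As the owner is
        deepest, x is still in the collar of q, which is less than L deep; this is why depth
        \<open>2 * L\<close> was chosen for m.\<close>
      define q where "q = drop (length (\<sigma> x) - (length ?p + L)) (\<sigma> x)"
      have len: "length q = length ?p + L" using long by (simp add: q_def m_def)
      then have cut: "cut q" using p L(1) by (auto simp: cut_def)
      have "suffix q (\<sigma> x)" by (simp add: q_def suffix_drop)
      moreover have "q \<noteq> \<sigma> x" using long len L(1) by (auto simp: m_def)
      ultimately have "x \<in> beyond q" using x by (simp add: beyond_def strict_suffix_def)
      moreover have "x \<notin> outside q n" using owner[OF cut, of x n] len L(1) by auto
      ultimately have "x \<in> collar q \<rho>" by (auto simp: outside_def \<rho>_def)
      then have "real (length (\<sigma> x)) \<le> length q + \<rho>" by (rule collar_length)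
      then show False using long len L r by (simp add: m_def)
    qed
    then show ?thesis using p x by (simp add: subtree_def)
  qed

  \<comment> \<open>In shell \<open>j\<close> the palette omits the colour \<open>j\<close>; this is what keeps a chain of that colour
    from running through the shell.\<close>
  define \<kappa> where "\<kappa> x =
    (if \<exists>p j. in_shell x p j then
       (case (SOME (p, j). in_shell x p j) of (p, j) \<Rightarrow>
          if j = n then g p x else if f p x < j then f p x else Suc (f p x))
     else u (owner n x) x)" for x
  have \<kappa>_shell: "\<kappa> x = (if j = n then g p x else if f p x < j then f p x else Suc (f p x))"
    if "in_shell x p j" for x p j
  proof -
    have "(SOME (p, j). in_shell x p j) = (p, j)"
      by (rule some_equality) (use that in_shell_unique in auto)
    then show ?thesis unfolding \<kappa>_def using that by auto
  qed
  have \<kappa>_core: "\<kappa> x = u (owner n x) x" if "\<And>p j. \<not> in_shell x p j" for x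
    unfolding \<kappa>_def by (rule if_not_P) (use that in blast)
  have in_collar: "x \<in> collar p \<rho>" if "in_shell x p j" for x p j
    using that shell_collar by (auto simp: in_shell_def)
  have \<kappa>_less: "\<kappa> x < Suc n" if x: "x \<in> M" for x
  proof (cases "\<exists>p j. in_shell x p j")
    case True
    then obtain p j where "in_shell x p j" by blast
    then show ?thesis using \<kappa>_shell f(2)[OF in_collar] g(2)[OF in_collar] by (simp add: less_SucI)
  next
    case False
    then show ?thesis using \<kappa>_core u(2)[OF core_subtree] x by simp
  qed
  have \<kappa>_ne: "\<kappa> x \<noteq> j" if "in_shell x p j" for x p j
    using \<kappa>_shell[OF that] g(2)[OF in_collar[OF that]] by auto

  have outside_step: "y \<in> outside q i"
    if that': "cut q" "i \<le> n" "x \<in> outside q i" "y \<in> M" "\<kappa> y = i" "d x y \<le> r" for q i x y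
  proof -
    have x: "x \<in> M" "x \<in> beyond q" using that by (auto simp: outside_def beyond_def)
    have "y \<in> beyond q"
    proof (rule ccontr)
      assume "y \<notin> beyond q"
      then obtain z where z: "z \<in> edge q" "d x z \<le> d x y" using exit_beyond x that'(4) by blast
      then have "d x z \<le> real 1 * w" using that w by simp
      also have "\<dots> \<le> real (i + 2) * w" by (rule scale) simp
      finally show False using z x that(3) by (auto simp: outside_def collar_def)
    qed
    moreover have "y \<notin> collar q (real (i + 1) * w)"
    proof
      assume "y \<in> collar q (real (i + 1) * w)"
      then obtain z where z: "z \<in> edge q" "d y z \<le> real (i + 1) * w" by (auto simp: collar_def)
      have "d x z \<le> d x y + d y z" using triangle x z that by (auto simp: edge_def)
      also have "\<dots> \<le> real (i + 2) * w" using z(2) that w by (simp add: algebra_simps)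
      finally show False using z x that(3) by (auto simp: outside_def collar_def)
    qed
    moreover have "y \<notin> shell q i" using \<kappa>_ne[of y q i] that by (auto simp: in_shell_def)
    ultimately show ?thesis by (auto simp: outside_def shell_def)
  qed

  have "chain_bounded r D {x\<in>M. \<kappa> x = i}" if i: "i \<le> n" for i
  proof (rule chain_bounded_invariant[where P = "owner i"])
    fix x y assume "(x, y) \<in> near r {x\<in>M. \<kappa> x = i}"
    then have xy: "x \<in> M" "y \<in> M" "\<kappa> x = i" "\<kappa> y = i" "d x y \<le> r" by (auto simp: near_def)
    have "x \<in> outside q i \<longleftrightarrow> y \<in> outside q i" if "cut q" for q
      using outside_step[of q i x y] outside_step[of q i y x] that xy i commute[of x y] by auto
    then show "owner i x = owner i y" by (simp add: owner_def cong: conj_cong)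
  next
    fix p
    \<comment> \<open>With owner p and colour i fixed, the chain meets the shells with index below
      n, the points in no shell, and the outermost shell; each of the three sets is controlled by
      one of the colourings f, u, g.\<close>
    define Fine where "Fine = {x\<in>M. owner i x = p \<and> \<kappa> x = i \<and> (\<exists>q j. j < n \<and> in_shell x q j)}"
    define Core where "Core = {x\<in>subtree p m. u p x = i}"
    define Coarse where "Coarse = {x\<in>collar p \<rho>. g p x = i}"
    have "chain_bounded r Df Fine"
    proof -
      define sh where "sh x = (THE q. \<exists>j. in_shell x q j)" for x
      have sh: "sh x = q" if "in_shell x q j" for x q j
        unfolding sh_def using that in_shell_unique by blast
      show ?thesis
      proof (rule chain_bounded_invariant[where P = sh])
        fix x y assume "(x, y) \<in> near r Fine"
        then obtain q j q' j' where "in_shell x q j" "in_shell y q' j'" "d x y \<le> r"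
          by (auto simp: near_def Fine_def)
        then show "sh x = sh y" using shell_near[of q q' j j' x y] sh by (auto simp: in_shell_def)
      next
        fix q
        \<comment> \<open>The colour of shell j is f with the value j skipped. In a shell of p
          itself i < j, so i is not shifted; in a shell of another cut j < i, so i is the shifted i
          - 1. Either way all shells of q contribute the same class of f, and
          \<open>chain_bounded\<close> applies across them.\<close>
        have "f q x = (if q = p then i else i - 1) \<and> x \<in> collar q \<rho>" if x: "x \<in> Fine" "sh x = q" for x
        proof -
          obtain j where j: "j < n" "in_shell x q j" using x sh by (auto simp: Fine_def)
          have \<kappa>: "\<kappa> x = i" "owner i x = p" using that by (auto simp: Fine_def)
          have "j \<noteq> i" using \<kappa>_ne[OF j(2)] \<kappa> by auto
          moreover have "q = p \<longleftrightarrow> i < j"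
            using owner_shell[OF j(2), of i] owner_shell'[OF j(2), of i] \<kappa>(2)
            by (metis leI)
          ultimately show ?thesis
            using \<kappa>_shell[OF j(2)] \<kappa> j in_collar[OF j(2)] by (auto split: if_splits)
        qed
        then have "{x\<in>Fine. sh x = q} \<subseteq> {x\<in>collar q \<rho>. f q x = (if q = p then i else i - 1)}" by blast
        then show "chain_bounded r Df {x\<in>Fine. sh x = q}"
          by (rule chain_bounded_mono[OF f(3) _ order_refl order_refl])
      qed
    qed
    moreover have "chain_bounded (Df + 2 * r) Dc Core" unfolding Core_def by (rule u(3))
    ultimately have "chain_bounded r D1 (Fine \<union> Core)"
      unfolding D1_def by (rule chain_bounded_Un[rotated 2]) (use r f u in \<open>auto simp: Fine_def Core_def subtree_def\<close>)
    moreover have "chain_bounded (D1 + 2 * r) Dg Coarse" unfolding Coarse_def by (rule g(3))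
    moreover have "Fine \<union> Core \<subseteq> M" "Coarse \<subseteq> M"
      using collar_M by (auto simp: Fine_def Core_def Coarse_def subtree_def)
    moreover have "D1 \<ge> 0" using r f(1) u(1) by (simp add: D1_def)
    ultimately have "chain_bounded r D (Fine \<union> Core \<union> Coarse)"
      unfolding D_def using r g(1) by (intro chain_bounded_Un) auto
    moreover have "x \<in> Fine \<union> Core \<union> Coarse" if x: "x \<in> M" "\<kappa> x = i" "owner i x = p" for x
    proof (cases "\<exists>q j. in_shell x q j")
      case True
      then obtain q j where j: "in_shell x q j" by blast
      show ?thesis
      proof (cases "j = n")
        case True
        then have "g q x = i" using \<kappa>_shell[OF j] x by simp
        \<comment> \<open>The outermost shell omits the colour n, so here i is below the index of
          the shell and the owner is the cut of that shell.\<close>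
        then have "i < n" using g(2)[OF in_collar[OF j]] by simp
        then have "q = p" using owner_shell[OF j] x True by simp
        then show ?thesis using \<open>g q x = i\<close> in_collar[OF j] by (simp add: Coarse_def)
      next
        case False
        then have "j < n" using j by (simp add: in_shell_def)
        then show ?thesis using j x by (auto simp: Fine_def)
      qed
    next
      case False
      then have "owner n x = p" using owner_core[of x i] x i by simp
      then show ?thesis using False core_subtree[of x] \<kappa>_core[of x] x by (simp add: Core_def)
    qed
    then have "{x \<in> {x \<in> M. \<kappa> x = i}. owner i x = p} \<subseteq> Fine \<union> Core \<union> Coarse" by blast
    ultimately show "chain_bounded r D {x \<in> {x \<in> M. \<kappa> x = i}. owner i x = p}"
      by (rule chain_bounded_mono) auto
  qed
  then have "colorable (Suc n) r D M"
    unfolding colorable_def using \<kappa>_less by (intro exI[of _ \<kappa>]) simp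
  then show "\<exists>D. \<forall>Y\<in>{M}. colorable (Suc n) r D Y" by blast
qed

end

section \<open>Amalgams\<close>

lemma colorable_isometry:
  assumes M: "Metric_space M d" and M': "Metric_space M' d'"
    and f: "\<And>x y. x \<in> Y \<Longrightarrow> y \<in> Y \<Longrightarrow> d' (f x) (f y) = d x y"
    and Y: "Metric_space.colorable d N r D Y"
  shows "Metric_space.colorable d' N r D (f ` Y)"
proof -
  interpret A: Metric_space M d by fact
  interpret B: Metric_space M' d' by fact
  obtain \<kappa> where \<kappa>: "\<forall>x\<in>Y. \<kappa> x < N" "\<forall>i. A.chain_bounded r D {x\<in>Y. \<kappa> x = i}"
    using Y by (rule A.colorableE)
  define g where "g = inv_into Y f"
  have g: "g y \<in> Y" "f (g y) = y" if "y \<in> f ` Y" for y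
    using that by (auto simp: g_def inv_into_into f_inv_into_f)
  have d: "d' x y = d (g x) (g y)" if "x \<in> f ` Y" "y \<in> f ` Y" for x y
    using f[of "g x" "g y"] g that by simp
  have "B.chain_bounded r D {y\<in>f ` Y. \<kappa> (g y) = i}" (is "B.chain_bounded r D ?Z") for i
    unfolding B.chain_bounded_def
  proof (intro ballI allI impI)
    fix x y assume x: "x \<in> ?Z" and xy: "(x, y) \<in> (B.near r ?Z)\<^sup>*"
    have y: "y \<in> ?Z" using B.near_rtrancl_mem[OF xy x] .
    have "(g x, g y) \<in> (A.near r {x\<in>Y. \<kappa> x = i})\<^sup>*" using xy
    proof (induction rule: rtrancl_induct)
      case (step y z)
      then have "(g y, g z) \<in> A.near r {x\<in>Y. \<kappa> x = i}"
        using g d[of y z] by (auto simp: A.near_def B.near_def simp del: imageE)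
      then show ?case using step by (rule_tac rtrancl_into_rtrancl)
    qed simp
    then have "d (g x) (g y) \<le> D" using A.chain_boundedD \<kappa>(2) g x by blast
    then show "d' x y \<le> D" using d x y by simp
  qed
  moreover have "\<forall>y\<in>f ` Y. \<kappa> (g y) < N" using \<kappa>(1) g by blast
  ultimately show ?thesis unfolding B.colorable_def by (intro exI[of _ "\<lambda>y. \<kappa> (g y)"]) blast
qed

section \<open>Normal forms over two subgroups with a common subgroup\<close>

type_synonym 'a stack_state = "(bool \<times> 'a) list \<times> 'a"

text \<open>Van der Waerden's method. Each factor acts on the set of formal normal forms, and C acts
  in the same way through both. Relations that lie inside the factors will merge the two actions
  into one action of the whole group.\<close>

locale amalgam_stacks = group G for G (structure) +
  fixes F :: "bool \<Rightarrow> 'a set" and C :: "'a set"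
  assumes F: "subgroup (F i) G" and C: "subgroup C G" and C_F: "C \<subseteq> F i"
begin

definition rep :: "'a \<Rightarrow> 'a" where
  "rep g = (if g \<in> C then \<one> else SOME x. x \<in> g <# C)"

primrec valid_stack :: "(bool \<times> 'a) list \<Rightarrow> bool" where
  "valid_stack [] \<longleftrightarrow> True"
| "valid_stack (p # ps) \<longleftrightarrow> snd p \<in> F (fst p) \<and> snd p \<notin> C \<and> rep (snd p) = snd p
     \<and> (ps = [] \<or> fst (hd ps) \<noteq> fst p) \<and> valid_stack ps"

text \<open>A state stands for the element \<open>stack_prod ys \<otimes> c\<close>. The head of the
  list is the last syllable, the one that right multiplication reaches first.\<close>

definition states :: "'a stack_state set" where
  "states = {(ys, c). valid_stack ys \<and> c \<in> C}"

fun pop :: "bool \<Rightarrow> 'a stack_state \<Rightarrow> 'a stack_state" where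
  "pop i ((j, y) # ys, c) = (if j = i then (ys, y \<otimes> c) else ((j, y) # ys, c))"
| "pop i ([], c) = ([], c)"

fun push :: "bool \<Rightarrow> 'a stack_state \<Rightarrow> 'a stack_state" where
  "push i (ys, b) = (if b \<in> C then (ys, b) else ((i, rep b) # ys, inv (rep b) \<otimes> b))"

text \<open>Normal forms whose last syllable from factor i has not been split into a representative
  and an element of C.\<close>

definition open_states :: "bool \<Rightarrow> 'a stack_state set" where
  "open_states i = {(ys, b). valid_stack ys \<and> b \<in> F i \<and> (ys = [] \<or> fst (hd ys) \<noteq> i)}"

definition mul :: "bool \<Rightarrow> 'a \<Rightarrow> 'a stack_state \<Rightarrow> 'a stack_state" where
  "mul i g st = push i (fst (pop i st), snd (pop i st) \<otimes> g)"

lemma F_carrier: "g \<in> F i \<Longrightarrow> g \<in> carrier G"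
  using F subgroup.mem_carrier by metis

lemma C_carrier: "g \<in> C \<Longrightarrow> g \<in> carrier G"
  using C subgroup.mem_carrier by metis

lemma F_mult: "g \<in> F i \<Longrightarrow> g' \<in> F i \<Longrightarrow> g \<otimes> g' \<in> F i"
  using F subgroup.m_closed by metis

lemma C_mult: "g \<in> C \<Longrightarrow> g' \<in> C \<Longrightarrow> g \<otimes> g' \<in> C"
  using C subgroup.m_closed by metis

lemma C_inv: "g \<in> C \<Longrightarrow> inv g \<in> C"
  using C subgroup.m_inv_closed by metis

lemma C_mult_iff: "g \<in> carrier G \<Longrightarrow> c \<in> C \<Longrightarrow> g \<otimes> c \<in> C \<longleftrightarrow> g \<in> C"
proof
  assume g: "g \<in> carrier G" and c: "c \<in> C" and gc: "g \<otimes> c \<in> C"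
  then have "g \<otimes> c \<otimes> inv c \<in> C" using C_mult C_inv by blast
  then show "g \<in> C" using g C_carrier[OF c] by (simp add: m_assoc)
qed (use C_mult in blast)

lemma rep_coset: assumes "g \<in> carrier G" shows "\<exists>c\<in>C. rep g = g \<otimes> c"
proof (cases "g \<in> C")
  case True
  then show ?thesis using assms C_inv[OF True] by (intro bexI[of _ "inv g"]) (auto simp: rep_def)
next
  case False
  have "\<one> \<in> C" using C subgroup.one_closed by metis
  then have "g \<otimes> \<one> \<in> g <# C" by (auto simp: l_coset_def)
  then have "(SOME x. x \<in> g <# C) \<in> g <# C" by (rule someI)
  then show ?thesis using False by (auto simp: rep_def l_coset_def)
qed

lemma rep_mult: assumes "g \<in> carrier G" "c \<in> C" shows "rep (g \<otimes> c) = rep g"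
proof -
  have "(g \<otimes> c) <# C = g <# C"
  proof (intro equalityI subsetI)
    fix x assume "x \<in> (g \<otimes> c) <# C"
    then obtain c' where "c' \<in> C" "x = g \<otimes> c \<otimes> c'" by (auto simp: l_coset_def)
    then have "c \<otimes> c' \<in> C" "x = g \<otimes> (c \<otimes> c')" using assms C_mult C_carrier by (auto simp: m_assoc)
    then show "x \<in> g <# C" unfolding l_coset_def by blast
  next
    fix x assume "x \<in> g <# C"
    then obtain c' where c': "c' \<in> C" "x = g \<otimes> c'" by (auto simp: l_coset_def)
    have "x = g \<otimes> c \<otimes> (inv c \<otimes> c')" using c' assms C_carrier by (simp add: m_assoc[symmetric]) (simp add: m_assoc)
    moreover have "inv c \<otimes> c' \<in> C" using c' assms C_mult C_inv by blast
    ultimately show "x \<in> (g \<otimes> c) <# C" unfolding l_coset_def by blast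
  qed
  then show ?thesis using C_mult_iff[OF assms] by (simp add: rep_def)
qed

lemma rep_in_F: "g \<in> F i \<Longrightarrow> rep g \<in> F i"
  by (metis F_carrier F_mult C_F rep_coset subsetD)

lemma rep_in_C: "g \<in> carrier G \<Longrightarrow> rep g \<in> C \<longleftrightarrow> g \<in> C"
  using rep_coset[of g] C_mult_iff by auto

lemma rep_rep: "g \<in> carrier G \<Longrightarrow> rep (rep g) = rep g"
  by (metis rep_coset rep_mult)

lemma rep_rest: assumes "g \<in> carrier G" shows "inv (rep g) \<otimes> g \<in> C" "rep g \<otimes> (inv (rep g) \<otimes> g) = g"
proof -
  obtain c where c: "c \<in> C" "rep g = g \<otimes> c" using rep_coset[OF assms] by blast
  have "inv (rep g) \<otimes> g = inv c" using c assms C_carrier[of c] by (simp add: inv_mult_group m_assoc)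
  then show "inv (rep g) \<otimes> g \<in> C" "rep g \<otimes> (inv (rep g) \<otimes> g) = g"
    using c C_inv assms C_carrier[of c] by (simp_all add: m_assoc)
qed

lemma push_open: "st \<in> open_states i \<Longrightarrow> push i st \<in> states"
  using F_carrier rep_in_F rep_in_C rep_rep rep_rest(1) by (cases st) (auto simp: open_states_def states_def)

lemma pop_states: "st \<in> states \<Longrightarrow> pop i st \<in> open_states i"
  using F_mult[OF _ subsetD[OF C_F]] subsetD[OF C_F]
  by (cases "(i, st)" rule: pop.cases) (auto simp: states_def open_states_def)

text \<open>Splitting off a syllable and absorbing it again lose nothing, so multiplication in
  \<open>F i\<close> carries over to an action on states in \<open>mul_mul\<close>.\<close>

lemma pop_push: assumes "st \<in> open_states i" shows "pop i (push i st) = st"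
proof -
  obtain ys b where st: "st = (ys, b)" by (cases st)
  then have b: "valid_stack ys" "b \<in> carrier G" "ys = [] \<or> fst (hd ys) \<noteq> i"
    using assms F_carrier by (auto simp: open_states_def)
  show ?thesis
  proof (cases "b \<in> C")
    case True
    then show ?thesis using st b by (cases ys) auto
  next
    case False
    then show ?thesis using st b rep_rest(2) by simp
  qed
qed

lemma mul_open: "st \<in> states \<Longrightarrow> g \<in> F i \<Longrightarrow> (fst (pop i st), snd (pop i st) \<otimes> g) \<in> open_states i"
  using pop_states[of st i] F_mult by (auto simp: open_states_def)

lemma mul_states: "st \<in> states \<Longrightarrow> g \<in> F i \<Longrightarrow> mul i g st \<in> states"
  unfolding mul_def using push_open mul_open by blast

lemma mul_mul:
  assumes "st \<in> states" "g \<in> F i" "g' \<in> F i"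
  shows "mul i g' (mul i g st) = mul i (g \<otimes> g') st"
proof -
  have "snd (pop i st) \<in> F i" using pop_states[OF assms(1), of i] by (auto simp: open_states_def)
  then show ?thesis
    using pop_push[OF mul_open[OF assms(1,2)]] assms F_carrier by (simp add: mul_def m_assoc)
qed

text \<open>The right-hand side does not mention i: the two actions agree on C, so a letter common
  to both parts may be read in either.\<close>

lemma mul_C:
  assumes "st \<in> states" "g \<in> C" shows "mul i g st = (fst st, snd st \<otimes> g)"
proof (cases "(i, st)" rule: pop.cases)
  case (1 i' j y ys c)
  then have *: "y \<in> F j" "y \<in> carrier G" "y \<notin> C" "rep y = y" "c \<in> C" "c \<in> carrier G" "g \<in> carrier G"
    using assms F_carrier C_carrier by (auto simp: states_def)
  have "y \<otimes> c \<otimes> g = y \<otimes> (c \<otimes> g)" "c \<otimes> g \<in> C" using * assms C_mult by (auto simp: m_assoc)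
  then show ?thesis using 1 * rep_mult[of y "c \<otimes> g"] C_mult_iff[of y "c \<otimes> g"] C_mult
    by (auto simp: mul_def m_assoc[symmetric])
next
  case (2 i' c)
  then show ?thesis using assms C_mult by (auto simp: states_def mul_def)
qed

lemma mul_one: "st \<in> states \<Longrightarrow> mul i \<one> st = st"
  using mul_C[of st \<one>] subgroup.one_closed[OF C] C_carrier by (cases st) (auto simp: states_def)

lemma mul_stack:
  "fst (mul i g st) = r \<or> (\<exists>z. fst (mul i g st) = z # r)" if "r = fst (pop i st)"
  using that by (simp add: mul_def)

lemma pop_stack: "fst (pop i st) = fst st \<or> fst st \<noteq> [] \<and> fst (pop i st) = tl (fst st)"
  by (cases "(i, st)" rule: pop.cases) auto

lemma length_mul:
  "length (fst (mul i g st)) \<le> Suc (length (fst st))" "length (fst st) \<le> Suc (length (fst (mul i g st)))"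
  using mul_stack[OF HOL.refl, of i g st] pop_stack[of i st] by auto

text \<open>A multiplication removes at most one syllable and then adds at most one, so a stack that
  leaves the branch of p cannot jump over p. This is the source of
  \<open>separation\<close>.\<close>

lemma strict_suffix_mul:
  assumes "strict_suffix p (fst st)"
  shows "strict_suffix p (fst (mul i g st)) \<or> fst (mul i g st) = p"
proof -
  let ?r = "fst (pop i st)"
  have "suffix p (tl (fst st))" using assms by (cases "fst st") (auto simp: strict_suffix_def suffix_Cons)
  then have "suffix p ?r" using pop_stack[of i st] assms by (auto simp: strict_suffix_def)
  then show ?thesis using mul_stack[OF HOL.refl, of i g st] by (auto simp: strict_suffix_def suffix_Cons dest: suffix_length_le)
qed

primrec stack_prod :: "(bool \<times> 'a) list \<Rightarrow> 'a" where
  "stack_prod [] = \<one>"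
| "stack_prod (p # ps) = stack_prod ps \<otimes> snd p"

lemma stack_prod_closed: "valid_stack ys \<Longrightarrow> stack_prod ys \<in> carrier G"
  by (induction ys) (auto intro: F_carrier)

lemma stack_prod_push: "(ys, b) \<in> open_states i \<Longrightarrow> stack_prod (fst (push i (ys, b))) \<otimes> snd (push i (ys, b)) = stack_prod ys \<otimes> b"
  using rep_rest[of b] rep_coset[of b] C_carrier F_carrier stack_prod_closed[of ys] rep_in_F[of b i]
  by (auto simp: open_states_def m_assoc)

lemma stack_prod_pop: "st \<in> states \<Longrightarrow> stack_prod (fst (pop i st)) \<otimes> snd (pop i st) = stack_prod (fst st) \<otimes> snd st"
  using C_carrier F_carrier stack_prod_closed
  by (cases "(i, st)" rule: pop.cases) (auto simp: states_def m_assoc)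

lemma stack_prod_mul:
  assumes "st \<in> states" "g \<in> F i"
  shows "stack_prod (fst (mul i g st)) \<otimes> snd (mul i g st) = stack_prod (fst st) \<otimes> snd st \<otimes> g"
proof -
  have "pop i st \<in> open_states i" by (rule pop_states[OF assms(1)])
  then have "stack_prod (fst (pop i st)) \<in> carrier G" "snd (pop i st) \<in> carrier G"
    using stack_prod_closed F_carrier by (auto simp: open_states_def)
  then show ?thesis
    using stack_prod_push[OF mul_open[OF assms]] stack_prod_pop[OF assms(1), of i] F_carrier[OF assms(2)]
    by (simp add: mul_def m_assoc[symmetric] del: push.simps)
qed

end

section \<open>Actions of words and the word metric of a presented group\<close>

abbreviation words :: "'v set \<Rightarrow> 'v word set" where
  "words S \<equiv> lists (S \<times> UNIV)"

lemma fold_closed: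
  assumes "\<And>l st. st \<in> T \<Longrightarrow> l \<in> S \<times> UNIV \<Longrightarrow> step l st \<in> T"
  shows "u \<in> words S \<Longrightarrow> st \<in> T \<Longrightarrow> fold step u st \<in> T"
  by (induction u arbitrary: st) (simp_all add: assms)

text \<open>The universal property of a presentation, for actions. It serves both the action on
  normal forms and the action on cosets with a record.\<close>

lemma fold_pres_eq:
  assumes closed: "\<And>l st. st \<in> T \<Longrightarrow> l \<in> S \<times> UNIV \<Longrightarrow> step l st \<in> T"
    and cancel: "\<And>a e st. a \<in> S \<Longrightarrow> st \<in> T \<Longrightarrow> step (a, \<not> e) (step (a, e) st) = st"
    and rel: "\<And>u v st. (u, v) \<in> R \<Longrightarrow> u \<in> words S \<Longrightarrow> v \<in> words S \<Longrightarrow> st \<in> T \<Longrightarrow>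
      fold step u st = fold step v st"
    and "pres_eq S R u v"
  shows "st \<in> T \<Longrightarrow> fold step u st = fold step v st"
  using assms(4)
proof (induction arbitrary: st rule: pres_eq.induct)
  case (append u u' v v')
  have "u' \<in> words S" using pres_eq_lists[OF append.hyps(1)] by auto
  then have "fold step u' st \<in> T" using fold_closed[of T S step] closed append.prems by blast
  then have "fold step v (fold step u' st) = fold step v' (fold step u' st)" by (rule append.IH(2))
  then show ?case using append.IH(1)[OF append.prems] by simp
next
  case (cancel a e)
  then show ?case using assms(2) by simp
next
  case (rel u v)
  then show ?case by (rule assms(3))
next
  case (trans u v w)
  then show ?case by simp
qed simp_all

definition pres_gens :: "'v set \<Rightarrow> ('v word \<times> 'v word) set \<Rightarrow> 'v word set set" where
  "pres_gens S R = (\<lambda>a. pres_class S R [(a, True)]) ` S"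

definition pres_dist :: "'v set \<Rightarrow> ('v word \<times> 'v word) set \<Rightarrow> 'v word set \<Rightarrow> 'v word set \<Rightarrow> real" where
  "pres_dist S R = word_dist (presented_group S R) (pres_gens S R)"

definition word_image :: "'v set \<Rightarrow> ('v word \<times> 'v word) set \<Rightarrow> 'v set \<Rightarrow> 'v word set set" where
  "word_image S R A = pres_class S R ` words A"

definition inv_word :: "'v word \<Rightarrow> 'v word" where
  "inv_word u = rev (map (\<lambda>(a, e). (a, \<not> e)) u)"

lemma inv_word_lists: "u \<in> words A \<Longrightarrow> inv_word u \<in> words A"
  by (induction u) (auto simp: inv_word_def)

lemma length_inv_word [simp]: "length (inv_word u) = length u"
  by (simp add: inv_word_def)

context
  fixes S :: "'v set" and R :: "('v word \<times> 'v word) set"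
begin

abbreviation (input) PG where "PG \<equiv> presented_group S R"
abbreviation (input) cls where "cls \<equiv> pres_class S R"

lemma pres_class_closed: "u \<in> words S \<Longrightarrow> cls u \<in> carrier PG"
  unfolding carrier_presented_group by (rule imageI)

lemma pres_class_cases:
  assumes "g \<in> carrier PG"
  obtains u where "u \<in> words S" "g = cls u"
  using assms unfolding carrier_presented_group by blast

lemma pres_eq_inv_word: "u \<in> words S \<Longrightarrow> pres_eq S R (inv_word u @ u) []"
proof (induction u)
  case Nil
  show ?case by (simp add: inv_word_def pres_eq.refl)
next
  case (Cons l u)
  obtain a e where l: "l = (a, e)" "a \<in> S" using Cons by auto
  have u: "u \<in> words S" "inv_word u \<in> words S" using Cons inv_word_lists by auto
  have "pres_eq S R (inv_word u @ [(a, \<not> e), (a, \<not> \<not> e)] @ u) (inv_word u @ [] @ u)"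
    using u l by (intro pres_eq.append pres_eq.refl pres_eq.cancel)
  then have "pres_eq S R (inv_word (l # u) @ l # u) (inv_word u @ u)" using l by (simp add: inv_word_def)
  then show ?case using Cons.IH[OF u(1)] by (rule pres_eq.trans)
qed

lemma inv_pres_class:
  assumes "u \<in> words S"
  shows "inv\<^bsub>PG\<^esub> cls u = cls (inv_word u)"
proof -
  interpret group "PG" by (rule group_presented_group)
  have "cls (inv_word u) \<otimes>\<^bsub>PG\<^esub> cls u = \<one>\<^bsub>PG\<^esub>"
    using assms inv_word_lists[OF assms] pres_eq_inv_word[OF assms]
    by (simp add: mult_presented_group one_presented_group pres_class_eq_iff)
  then show ?thesis using assms inv_word_lists by (intro inv_equality pres_class_closed)
qed

lemma subgroup_word_image:
  assumes "A \<subseteq> S" shows "subgroup (word_image S R A) PG"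
proof -
  interpret group "PG" by (rule group_presented_group)
  have lists: "words A \<subseteq> lists (S \<times> (UNIV::bool set))" using assms by (intro lists_mono) auto
  show ?thesis
  proof (rule subgroupI)
    show "word_image S R A \<subseteq> carrier PG"
      unfolding word_image_def carrier_presented_group using lists by (rule image_mono)
    have "[] \<in> words A" by simp
    then show "word_image S R A \<noteq> {}" unfolding word_image_def by blast
    show "inv\<^bsub>PG\<^esub> g \<in> word_image S R A" if g: "g \<in> word_image S R A" for g
    proof -
      obtain u where u: "u \<in> words A" "g = cls u" using g unfolding word_image_def by blast
      then have "inv\<^bsub>PG\<^esub> g = cls (inv_word u)"
        using inv_pres_class lists by blast
      then show ?thesis using inv_word_lists[OF u(1)] unfolding word_image_def by blast
    qed
    show "g \<otimes>\<^bsub>PG\<^esub> g' \<in> word_image S R A"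
      if gg: "g \<in> word_image S R A" "g' \<in> word_image S R A" for g g'
    proof -
      obtain u u' where u: "u \<in> words A" "g = cls u" "u' \<in> words A" "g' = cls u'"
        using gg unfolding word_image_def by blast
      have "g \<otimes>\<^bsub>PG\<^esub> g' = cls (u @ u')"
        unfolding u(2,4) by (rule mult_presented_group) (use u lists in blast)+
      moreover have "u @ u' \<in> words A" using u by simp
      ultimately show ?thesis unfolding word_image_def by blast
    qed
  qed
qed

lemma finite_generating_set_pres_gens: "finite S \<Longrightarrow> finite_generating_set PG (pres_gens S R)"
  unfolding pres_gens_def by (rule finite_generating_set_presented_group)

lemma generate_pres_gens:
  "pres_gens S R \<subseteq> carrier PG"
  "generate PG (pres_gens S R) = carrier PG"
proof -
  let ?G = "PG"
  interpret group ?G by (rule group_presented_group)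
  show sub: "pres_gens S R \<subseteq> carrier ?G"
    unfolding pres_gens_def using pres_class_closed[of "[_]"] by auto
  have "cls u \<in> generate ?G (pres_gens S R)" if "u \<in> words S" for u
    using that
  proof (induction u)
    case Nil
    show ?case using generate.one[of ?G "pres_gens S R"] by (simp add: one_presented_group)
  next
    case (Cons l u)
    obtain a e where l: "l = (a, e)" "a \<in> S" using Cons by auto
    have "cls [(a, True)] \<in> pres_gens S R" using l by (auto simp: pres_gens_def)
    then have "cls [(a, True)] \<in> generate ?G (pres_gens S R)"
      "inv\<^bsub>?G\<^esub> cls [(a, True)] \<in> generate ?G (pres_gens S R)"
      by (auto intro: generate.incl generate.inv)
    moreover have "inv\<^bsub>?G\<^esub> cls [(a, True)] = cls [(a, False)]"
      using inv_pres_class[of "[(a, True)]"] l by (simp add: inv_word_def)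
    ultimately have "cls [l] \<in> generate ?G (pres_gens S R)"
      using l by (cases e) simp_all
    moreover have "cls (l # u) = cls [l] \<otimes>\<^bsub>?G\<^esub> cls u"
      using mult_presented_group[of "[l]" S u R] Cons l by simp
    ultimately show ?case using Cons by (auto intro: generate.eng)
  qed
  then show "generate ?G (pres_gens S R) = carrier ?G"
    using generate_incl[OF sub] unfolding carrier_presented_group by blast
qed

lemma Metric_space_pres_dist: "Metric_space (carrier PG) (pres_dist S R)"
  unfolding pres_dist_def using generate_pres_gens by (intro group.Metric_space_word_dist group_presented_group)

lemma word_prod_pres_class:
  "u \<in> words S \<Longrightarrow> word_prod PG (map (\<lambda>l. cls [l]) u) = cls u"
proof (induction u)
  case Nil
  show ?case by (simp add: word_prod_def one_presented_group)
next
  case (Cons l u)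
  then show ?case using mult_presented_group[of "[l]" S u R] by (simp add: word_prod_def)
qed

lemma pres_letter:
  assumes "a \<in> S"
  shows "cls [(a, e)] \<in> pres_gens S R \<union> m_inv PG ` pres_gens S R"
proof (cases e)
  case False
  have "cls [(a, False)] = inv\<^bsub>PG\<^esub> cls [(a, True)]"
    using inv_pres_class[of "[(a, True)]"] assms by (simp add: inv_word_def)
  then show ?thesis using False assms by (auto simp: pres_gens_def)
qed (use assms in \<open>auto simp: pres_gens_def\<close>)

lemma pres_word_length_le:
  assumes "u \<in> words S"
  shows "word_length PG (pres_gens S R) (cls u) \<le> length u"
proof -
  interpret group "PG" by (rule group_presented_group)
  have "set (map (\<lambda>l. cls [l]) u) \<subseteq> pres_gens S R \<union> m_inv PG ` pres_gens S R"
    using assms pres_letter by (fastforce simp: in_lists_conv_set)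
  from word_length_le[OF this word_prod_pres_class[OF assms]] show ?thesis by simp
qed

text \<open>Word length is defined through lists of group elements; this lifts a shortest such list
  to letters, on which the actions are defined.\<close>

lemma pres_word_length_word:
  assumes "g \<in> carrier PG"
  obtains u where "u \<in> words S" "g = cls u"
    "length u = word_length PG (pres_gens S R) g"
proof -
  let ?G = "PG"
  interpret group ?G by (rule group_presented_group)
  obtain ws where ws: "length ws = word_length ?G (pres_gens S R) g"
    "set ws \<subseteq> pres_gens S R \<union> m_inv ?G ` pres_gens S R" "word_prod ?G ws = g"
    using word_length_word[OF generate_pres_gens assms] .
  have "\<exists>u\<in>words S. ws = map (\<lambda>l. cls [l]) u" using ws(2)
  proof (induction ws)
    case Nil
    show ?case by (intro bexI[of _ "[]"]) auto
  next
    case (Cons x ws)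
    then obtain u where u: "u \<in> words S" "ws = map (\<lambda>l. cls [l]) u" by auto
    have "\<exists>a\<in>S. \<exists>e. x = cls [(a, e)]"
    proof -
      from Cons.prems obtain a where a: "a \<in> S"
        "x = cls [(a, True)] \<or> x = inv\<^bsub>?G\<^esub> cls [(a, True)]"
        by (auto simp: pres_gens_def)
      then show ?thesis using inv_pres_class[of "[(a, True)]"] by (auto simp: inv_word_def)
    qed
    then obtain a e where "a \<in> S" "x = cls [(a, e)]" by blast
    then show ?case using u by (intro bexI[of _ "(a, e) # u"]) auto
  qed
  then obtain u where "u \<in> words S" "ws = map (\<lambda>l. cls [l]) u" by blast
  then show ?thesis using that ws word_prod_pres_class by fastforce
qed

lemma pres_dist_le:
  assumes "x \<in> carrier PG" "u \<in> words S"
  shows "pres_dist S R x (x \<otimes>\<^bsub>PG\<^esub> cls u) \<le> length u"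
proof -
  interpret group "PG" by (rule group_presented_group)
  have "inv\<^bsub>PG\<^esub> x \<otimes>\<^bsub>PG\<^esub> (x \<otimes>\<^bsub>PG\<^esub> cls u) = cls u"
    using assms(1) pres_class_closed[OF assms(2)] by (simp add: m_assoc[symmetric])
  then show ?thesis
    using assms pres_class_closed[OF assms(2)] pres_word_length_le[OF assms(2)] by (simp add: pres_dist_def word_dist_def)
qed

lemma pres_dist_word:
  assumes "x \<in> carrier PG" "y \<in> carrier PG"
  obtains u where "u \<in> words S" "y = x \<otimes>\<^bsub>PG\<^esub> cls u"
    "pres_dist S R x y = length u"
proof -
  let ?G = "PG"
  interpret group ?G by (rule group_presented_group)
  have "inv\<^bsub>?G\<^esub> x \<otimes>\<^bsub>?G\<^esub> y \<in> carrier ?G" using assms by simp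
  then obtain u where u: "u \<in> words S" "inv\<^bsub>?G\<^esub> x \<otimes>\<^bsub>?G\<^esub> y = cls u"
    "length u = word_length ?G (pres_gens S R) (inv\<^bsub>?G\<^esub> x \<otimes>\<^bsub>?G\<^esub> y)"
    by (rule pres_word_length_word)
  have "y = x \<otimes>\<^bsub>?G\<^esub> cls u" using u(2) assms by (metis inv_solve_left m_closed inv_closed)
  then show ?thesis using that[OF u(1)] u(3) assms by (simp add: pres_dist_def word_dist_def)
qed

lemma pres_dist_left_invariant:
  assumes "g \<in> carrier PG" "x \<in> carrier PG" "y \<in> carrier PG"
  shows "pres_dist S R (g \<otimes>\<^bsub>PG\<^esub> x) (g \<otimes>\<^bsub>PG\<^esub> y) = pres_dist S R x y"
proof -
  let ?G = "PG"
  interpret group ?G by (rule group_presented_group)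
  have "inv\<^bsub>?G\<^esub> (g \<otimes>\<^bsub>?G\<^esub> x) \<otimes>\<^bsub>?G\<^esub> (g \<otimes>\<^bsub>?G\<^esub> y) = inv\<^bsub>?G\<^esub> x \<otimes>\<^bsub>?G\<^esub> (inv\<^bsub>?G\<^esub> g \<otimes>\<^bsub>?G\<^esub> (g \<otimes>\<^bsub>?G\<^esub> y))"
    using assms by (simp add: inv_mult_group m_assoc)
  also have "inv\<^bsub>?G\<^esub> g \<otimes>\<^bsub>?G\<^esub> (g \<otimes>\<^bsub>?G\<^esub> y) = y" using assms by (simp add: m_assoc[symmetric])
  finally show ?thesis using assms by (simp add: pres_dist_def word_dist_def)
qed

text \<open>Left translations are isometries, so one bound serves all cosets at once.\<close>

lemma unif_colorable_translates:
  assumes "Metric_space.unif_colorable (pres_dist S R) N {Y}" "Y \<subseteq> carrier PG"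
  shows "Metric_space.unif_colorable (pres_dist S R) N ((\<lambda>g. (\<lambda>y. g \<otimes>\<^bsub>PG\<^esub> y) ` Y) ` carrier PG)"
proof -
  interpret Metric_space "carrier PG" "pres_dist S R" by (rule Metric_space_pres_dist)
  show ?thesis
    unfolding unif_colorable_def
  proof (intro allI impI)
    fix r :: real
    obtain D where "\<And>X. X \<in> {Y} \<Longrightarrow> colorable N r D X" using assms(1) by (rule unif_colorableE) blast
    then have D: "colorable N r D Y" by blast
    have "colorable N r D ((\<lambda>y. g \<otimes>\<^bsub>PG\<^esub> y) ` Y)" if "g \<in> carrier PG" for g
      by (rule colorable_isometry[OF Metric_space_pres_dist Metric_space_pres_dist _ D])
        (use assms(2) that pres_dist_left_invariant in blast)
    then show "\<exists>D. \<forall>Y\<in>(\<lambda>g. (\<lambda>y. g \<otimes>\<^bsub>PG\<^esub> y) ` Y) ` carrier PG. colorable N r D Y"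
      by blast
  qed
qed

end

section \<open>The presented group acting on its normal forms\<close>

locale amalgam_presentation =
  fixes S1 S2 :: "'v set" and R :: "('v word \<times> 'v word) set"
  assumes split: "(u, v) \<in> R \<Longrightarrow> u \<in> words (S1 \<union> S2) \<Longrightarrow> v \<in> words (S1 \<union> S2) \<Longrightarrow>
    \<exists>A\<in>{S1, S2}. u \<in> words A \<and> v \<in> words A"
begin

abbreviation S where "S \<equiv> S1 \<union> S2"
abbreviation G where "G \<equiv> presented_group S R"
abbreviation cl where "cl u \<equiv> pres_class S R u"

definition part :: "bool \<Rightarrow> 'v set" where
  "part i = (if i then S1 else S2)"

sublocale amalgam_stacks G "\<lambda>i. word_image S R (part i)" "word_image S R (S1 \<inter> S2)"
proof -
  interpret group G by (rule group_presented_group)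
  show "amalgam_stacks G (\<lambda>i. word_image S R (part i)) (word_image S R (S1 \<inter> S2))"
  proof (intro amalgam_stacks.intro amalgam_stacks_axioms.intro group_presented_group)
    show "subgroup (word_image S R (part i)) G" for i by (rule subgroup_word_image) (auto simp: part_def)
    show "subgroup (word_image S R (S1 \<inter> S2)) G" by (rule subgroup_word_image) auto
    show "word_image S R (S1 \<inter> S2) \<subseteq> word_image S R (part i)" for i
      unfolding word_image_def by (intro image_mono lists_mono) (auto simp: part_def)
  qed
qed

sublocale Metric_space "carrier G" "pres_dist S R"
  by (rule Metric_space_pres_dist)

text \<open>A letter in both parts is read in S1; \<open>mul_C\<close> makes the choice
  harmless.\<close>

definition letter_step :: "'v \<times> bool \<Rightarrow> 'v word set stack_state \<Rightarrow> 'v word set stack_state" where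
  "letter_step l = mul (fst l \<in> S1) (cl [l])"

lemma cl_in_word_image: "u \<in> words A \<Longrightarrow> cl u \<in> word_image S R A"
  by (simp add: word_image_def)

lemma letter_step_states: "st \<in> states \<Longrightarrow> l \<in> S \<times> UNIV \<Longrightarrow> letter_step l st \<in> states"
  unfolding letter_step_def by (rule mul_states) (auto simp: part_def intro!: cl_in_word_image)

lemma letter_step_part:
  assumes "st \<in> states" "l \<in> part i \<times> UNIV"
  shows "letter_step l st = mul i (cl [l]) st"
proof (cases "fst l \<in> S1 \<longleftrightarrow> i")
  case False
  then have "l \<in> (S1 \<inter> S2) \<times> UNIV" using assms(2) by (auto simp: part_def split: if_splits)
  then have "cl [l] \<in> word_image S R (S1 \<inter> S2)" by (auto intro!: cl_in_word_image)
  then show ?thesis using mul_C[OF assms(1)] by (simp add: letter_step_def)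
qed (simp add: letter_step_def)

lemma fold_letter_step_part:
  assumes "u \<in> words (part i)" "st \<in> states"
  shows "fold letter_step u st = mul i (cl u) st"
  using assms
proof (induction u arbitrary: st)
  case Nil
  then show ?case using mul_one[of st i] by (simp add: one_presented_group)
next
  case (Cons l u)
  have sub: "part i \<subseteq> S" by (auto simp: part_def)
  have l: "l \<in> part i \<times> UNIV" "[l] \<in> words (part i)" "u \<in> words (part i)" using Cons by auto
  then have l': "l \<in> S \<times> UNIV" "[l] \<in> words S" "u \<in> words S"
    using sub by (auto simp: subset_iff)
  have "fold letter_step (l # u) st = mul i (cl u) (mul i (cl [l]) st)"
    using Cons.IH[OF letter_step_states[OF Cons.prems l'(1)]] letter_step_part[OF Cons.prems l(1)] by simp
  also have "\<dots> = mul i (cl [l] \<otimes>\<^bsub>G\<^esub> cl u) st"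
    using l by (intro mul_mul[OF Cons.prems] cl_in_word_image)
  finally show ?case using mult_presented_group[OF l'(2,3), of R] by simp
qed

text \<open>A relation lies within one part, and a word of one part acts through its class in G; so
  both sides of the relation act alike.\<close>

lemma fold_letter_step_pres_eq:
  assumes "pres_eq S R u v" "st \<in> states"
  shows "fold letter_step u st = fold letter_step v st"
  using letter_step_states _ _ assms
proof (rule fold_pres_eq)
  fix a e st assume a: "a \<in> S" and st: "st \<in> states"
  have "a \<in> part (a \<in> S1)" using a by (auto simp: part_def)
  then have "fold letter_step [(a, e), (a, \<not> e)] st = mul (a \<in> S1) (cl [(a, e), (a, \<not> e)]) st"
    using st by (intro fold_letter_step_part) auto
  also have "cl [(a, e), (a, \<not> e)] = cl []"
    using a pres_eq.cancel[of a S R e] by (subst pres_class_eq_iff) auto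
  finally show "letter_step (a, \<not> e) (letter_step (a, e) st) = st"
    using mul_one[OF st] by (simp add: one_presented_group)
next
  fix u v st assume uv: "(u, v) \<in> R" "u \<in> words S" "v \<in> words S" and st: "st \<in> states"
  then obtain A where "A \<in> {S1, S2}" "u \<in> words A" "v \<in> words A" using split[OF uv] by blast
  moreover from this have "A = part (A = S1)" by (auto simp: part_def)
  ultimately obtain i where "u \<in> words (part i)" "v \<in> words (part i)" by metis
  moreover have "cl u = cl v" using pres_eq.rel[OF uv] uv by (subst pres_class_eq_iff) auto
  ultimately show "fold letter_step u st = fold letter_step v st" using fold_letter_step_part st by simp
qed

text \<open>The orbit of the empty normal form; it is independent of the chosen word by
  \<open>fold_letter_step_pres_eq\<close>.\<close>

definition state :: "'v word set \<Rightarrow> 'v word set stack_state" where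
  "state g = fold letter_step (SOME u. u \<in> words S \<and> cl u = g) ([], cl [])"

definition stack :: "'v word set \<Rightarrow> (bool \<times> 'v word set) list" where
  "stack g = fst (state g)"

lemma init_state: "([], cl []) \<in> states"
  using subgroup.one_closed[OF C] by (simp add: states_def one_presented_group)

lemma state_cl:
  assumes "u \<in> words S" shows "state (cl u) = fold letter_step u ([], cl [])"
proof -
  let ?v = "SOME v. v \<in> words S \<and> cl v = cl u"
  have v: "?v \<in> words S \<and> cl ?v = cl u" by (rule someI[of _ u]) (use assms in simp)
  then have "pres_eq S R ?v u" using assms pres_class_eq_iff by blast
  then show ?thesis unfolding state_def by (rule fold_letter_step_pres_eq[OF _ init_state])
qed

lemma state_mult:
  assumes "g \<in> carrier G" "l \<in> S \<times> UNIV"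
  shows "state (g \<otimes>\<^bsub>G\<^esub> cl [l]) = letter_step l (state g)"
proof -
  obtain u where u: "u \<in> words S" "g = cl u" using assms(1) by (rule pres_class_cases)
  have l: "[l] \<in> words S" using assms(2) by simp
  have "g \<otimes>\<^bsub>G\<^esub> cl [l] = cl (u @ [l])" unfolding u(2) by (rule mult_presented_group[OF u(1) l])
  then show ?thesis using state_cl[of "u @ [l]"] state_cl[OF u(1)] u l by simp
qed

lemma state_states: assumes "g \<in> carrier G" shows "state g \<in> states"
proof -
  obtain u where "u \<in> words S" "g = cl u" using assms by (rule pres_class_cases)
  then show ?thesis using state_cl fold_closed[OF letter_step_states] init_state by simp
qed

text \<open>Multiplying out a normal form gives back the element, so elements with equal stacks
  differ by a right factor in C.\<close>

lemma stack_prod_state: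
  assumes "g \<in> carrier G" shows "stack_prod (fst (state g)) \<otimes>\<^bsub>G\<^esub> snd (state g) = g"
proof -
  have "\<forall>st\<in>states. stack_prod (fst (fold letter_step u st)) \<otimes>\<^bsub>G\<^esub> snd (fold letter_step u st) = stack_prod (fst st) \<otimes>\<^bsub>G\<^esub> snd st \<otimes>\<^bsub>G\<^esub> cl u"
    if "u \<in> words S" for u using that
  proof (induction u)
    case Nil
    then show ?case using C_carrier stack_prod_closed by (auto simp: states_def simp flip: one_presented_group)
  next
    case (Cons l u)
    have l: "l \<in> S \<times> UNIV" "[l] \<in> words S" "u \<in> words S" using Cons by auto
    show ?case
    proof
      fix st assume st: "st \<in> states"
      have "cl [l] \<in> word_image S R (part (fst l \<in> S1))" using l by (auto simp: part_def intro!: cl_in_word_image)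
      then have "stack_prod (fst (letter_step l st)) \<otimes>\<^bsub>G\<^esub> snd (letter_step l st) = stack_prod (fst st) \<otimes>\<^bsub>G\<^esub> snd st \<otimes>\<^bsub>G\<^esub> cl [l]"
        unfolding letter_step_def by (rule stack_prod_mul[OF st])
      moreover have "cl (l # u) = cl [l] \<otimes>\<^bsub>G\<^esub> cl u" using mult_presented_group[OF l(2,3), of R] by simp
      moreover have "stack_prod (fst st) \<in> carrier G" "snd st \<in> carrier G"
        using st stack_prod_closed C_carrier by (auto simp: states_def)
      moreover have "cl [l] \<in> carrier G" "cl u \<in> carrier G" using l by (simp_all only: pres_class_closed)
      ultimately show "stack_prod (fst (fold letter_step (l # u) st)) \<otimes>\<^bsub>G\<^esub> snd (fold letter_step (l # u) st)
          = stack_prod (fst st) \<otimes>\<^bsub>G\<^esub> snd st \<otimes>\<^bsub>G\<^esub> cl (l # u)"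
        using Cons.IH letter_step_states[OF st l(1)] by (simp add: m_assoc)
    qed
  qed
  note prod_fold = this
  obtain u where u: "u \<in> words S" "g = cl u" using assms by (rule pres_class_cases)
  have "stack_prod (fst (state g)) \<otimes>\<^bsub>G\<^esub> snd (state g) = \<one>\<^bsub>G\<^esub> \<otimes>\<^bsub>G\<^esub> cl [] \<otimes>\<^bsub>G\<^esub> g"
    using bspec[OF prod_fold[OF u(1)] init_state] state_cl[OF u(1)] u(2) by simp
  then show ?thesis using assms by (simp flip: one_presented_group)
qed

lemma mult_cl_Cons:
  assumes "x \<in> carrier G" "l \<in> S \<times> UNIV" "u \<in> words S"
  shows "x \<otimes>\<^bsub>G\<^esub> cl (l # u) = x \<otimes>\<^bsub>G\<^esub> cl [l] \<otimes>\<^bsub>G\<^esub> cl u" "x \<otimes>\<^bsub>G\<^esub> cl [l] \<in> carrier G"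
proof -
  have l: "[l] \<in> words S" using assms(2) by simp
  show "x \<otimes>\<^bsub>G\<^esub> cl [l] \<in> carrier G" using assms(1) pres_class_closed[OF l] by simp
  have "cl (l # u) = cl [l] \<otimes>\<^bsub>G\<^esub> cl u" using mult_presented_group[OF l assms(3), of R] by simp
  then show "x \<otimes>\<^bsub>G\<^esub> cl (l # u) = x \<otimes>\<^bsub>G\<^esub> cl [l] \<otimes>\<^bsub>G\<^esub> cl u"
    using assms pres_class_closed[OF l] pres_class_closed[OF assms(3)] by (simp add: m_assoc)
qed

lemma stack_word_exit:
  assumes "u \<in> words S" "x \<in> carrier G" "strict_suffix p (stack x)" "\<not> strict_suffix p (stack (x \<otimes>\<^bsub>G\<^esub> cl u))"
  shows "\<exists>u'\<in>words S. length u' \<le> length u \<and> stack (x \<otimes>\<^bsub>G\<^esub> cl u') = p"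
  using assms
proof (induction u arbitrary: x)
  case Nil
  then show ?case by (simp flip: one_presented_group)
next
  case (Cons l u)
  have l: "l \<in> S \<times> UNIV" "u \<in> words S" using Cons.hyps by auto
  note mult = mult_cl_Cons[OF Cons.prems(1) l(1)]
  have "strict_suffix p (stack (x \<otimes>\<^bsub>G\<^esub> cl [l])) \<or> stack (x \<otimes>\<^bsub>G\<^esub> cl [l]) = p"
    using strict_suffix_mul[of p "state x"] Cons.prems(2)
    by (simp add: stack_def state_mult[OF Cons.prems(1) l(1)] letter_step_def)
  then show ?case
  proof
    assume "strict_suffix p (stack (x \<otimes>\<^bsub>G\<^esub> cl [l]))"
    then obtain u' where u': "u' \<in> words S" "length u' \<le> length u" "stack (x \<otimes>\<^bsub>G\<^esub> cl [l] \<otimes>\<^bsub>G\<^esub> cl u') = p"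
      using Cons.IH[OF mult(2)[OF l(2)]] Cons.prems(3) mult(1)[OF l(2)] by auto
    then show ?thesis using mult(1)[OF u'(1)] l by (intro bexI[of _ "l # u'"]) auto
  next
    assume "stack (x \<otimes>\<^bsub>G\<^esub> cl [l]) = p"
    then show ?thesis using l by (intro bexI[of _ "[l]"]) auto
  qed
qed

lemma length_stack_word:
  assumes "u \<in> words S" "y \<in> carrier G"
  shows "length (stack y) \<le> length (stack (y \<otimes>\<^bsub>G\<^esub> cl u)) + length u"
  using assms
proof (induction u arbitrary: y)
  case Nil
  then show ?case by (simp flip: one_presented_group)
next
  case (Cons l u)
  have l: "l \<in> S \<times> UNIV" "u \<in> words S" using Cons.hyps by auto
  note mult = mult_cl_Cons[OF Cons.prems l]
  have "length (stack y) \<le> Suc (length (stack (y \<otimes>\<^bsub>G\<^esub> cl [l])))"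
    using length_mul(2)[of "state y"] by (simp add: stack_def state_mult[OF Cons.prems l(1)] letter_step_def)
  then show ?case using Cons.IH[OF mult(2)] mult(1) by simp
qed

sublocale stack_space "carrier G" "pres_dist S R" stack
proof
  fix x y p
  assume xy: "x \<in> carrier G" "y \<in> carrier G" "strict_suffix p (stack x)" "\<not> strict_suffix p (stack y)"
  obtain u where u: "u \<in> words S" "y = x \<otimes>\<^bsub>G\<^esub> cl u" "pres_dist S R x y = length u"
    using xy(1,2) by (rule pres_dist_word)
  then obtain u' where u': "u' \<in> words S" "length u' \<le> length u" "stack (x \<otimes>\<^bsub>G\<^esub> cl u') = p"
    using stack_word_exit xy by blast
  have "pres_dist S R x (x \<otimes>\<^bsub>G\<^esub> cl u') \<le> length u'" by (rule pres_dist_le[OF xy(1) u'(1)])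
  then show "\<exists>z\<in>carrier G. stack z = p \<and> pres_dist S R x z \<le> pres_dist S R x y"
    using u u' xy pres_class_closed[OF u'(1)] by (intro bexI[of _ "x \<otimes>\<^bsub>G\<^esub> cl u'"]) auto
next
  fix x y assume xy: "x \<in> carrier G" "y \<in> carrier G"
  obtain u where u: "u \<in> words S" "y = x \<otimes>\<^bsub>G\<^esub> cl u" "pres_dist S R x y = length u"
    using xy by (rule pres_dist_word)
  then show "real (length (stack x)) \<le> real (length (stack y)) + pres_dist S R x y"
    using length_stack_word[OF u(1) xy(1)] by simp
qed

text \<open>Points with stack p lie in the translate of C by \<open>stack_prod p\<close>, and points
  with one syllable more in the same translate of a factor. The union of the factors is used because
  at the root the next syllable may come from either.\<close>

theorem unif_colorable_amalgam:
  assumes C: "unif_colorable n {word_image S R (S1 \<inter> S2)}"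
    and F: "unif_colorable (Suc n) {word_image S R S1}" "unif_colorable (Suc n) {word_image S R S2}"
  shows "unif_colorable (Suc n) {carrier G}"
proof (rule unif_colorable_stack_space)
  have sub: "word_image S R A \<subseteq> carrier G" if "A \<subseteq> S" for A
    using subgroup.subset[OF subgroup_word_image[OF that]] .
  show "unif_colorable n (range edge)"
  proof (rule unif_colorable_mono[OF unif_colorable_translates[OF C sub]])
    fix Y assume "Y \<in> range edge"
    then obtain p where Y: "Y = edge p" by blast
    show "\<exists>Y'\<in>(\<lambda>g. (\<otimes>\<^bsub>G\<^esub>) g ` word_image S R (S1 \<inter> S2)) ` carrier G. Y \<subseteq> Y'"
    proof (cases "Y = {}")
      case False
      then obtain x where x: "x \<in> carrier G" "stack x = p" by (auto simp: Y edge_def)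
      then have "stack_prod p \<in> carrier G"
        using stack_prod_closed state_states[OF x(1)] by (auto simp: states_def stack_def)
      moreover have "y \<in> (\<otimes>\<^bsub>G\<^esub>) (stack_prod p) ` word_image S R (S1 \<inter> S2)" if "y \<in> edge p" for y
      proof -
        have y: "y \<in> carrier G" "fst (state y) = p" using that by (auto simp: edge_def stack_def)
        then show ?thesis using stack_prod_state[OF y(1)] state_states[OF y(1)] by (force simp: states_def)
      qed
      ultimately show ?thesis using Y by blast
    qed (use one_closed in blast)
  qed auto
  have "unif_colorable (Suc n) {word_image S R S1 \<union> word_image S R S2}"
    unfolding unif_colorable_def
  proof (intro allI impI)
    fix r :: real assume r: "r > 0"
    obtain D1 where D1: "D1 \<ge> 0" "\<And>Y. Y \<in> {word_image S R S1} \<Longrightarrow> colorable (Suc n) r D1 Y"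
      using F(1) by (rule unif_colorableE) blast
    obtain D2 where D2: "D2 \<ge> 0" "\<And>Y. Y \<in> {word_image S R S2} \<Longrightarrow> colorable (Suc n) (D1 + 2 * r) D2 Y"
      using F(2) by (rule unif_colorableE) blast
    have "colorable (Suc n) r (D2 + 2 * (D1 + r)) (word_image S R S1 \<union> word_image S R S2)"
      by (rule colorable_Un) (use sub D1 D2 r in auto)
    then show "\<exists>D. \<forall>Y\<in>{word_image S R S1 \<union> word_image S R S2}. colorable (Suc n) r D Y" by blast
  qed
  then have U: "unif_colorable (Suc n) ((\<lambda>g. (\<otimes>\<^bsub>G\<^esub>) g ` (word_image S R S1 \<union> word_image S R S2)) ` carrier G)"
    by (rule unif_colorable_translates) (use sub in auto)
  show "unif_colorable (Suc n) (range children)"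
  proof (rule unif_colorable_mono[OF U])
    fix Y assume "Y \<in> range children"
    then obtain p where Y: "Y = children p" by blast
    show "\<exists>Y'\<in>(\<lambda>g. (\<otimes>\<^bsub>G\<^esub>) g ` (word_image S R S1 \<union> word_image S R S2)) ` carrier G. Y \<subseteq> Y'"
    proof (cases "Y = {}")
      case False
      then obtain x z where x: "x \<in> carrier G" "stack x = z # p" by (auto simp: Y children_def)
      then have "stack_prod p \<in> carrier G"
        using stack_prod_closed state_states[OF x(1)] by (auto simp: states_def stack_def)
      moreover have "y \<in> (\<otimes>\<^bsub>G\<^esub>) (stack_prod p) ` (word_image S R S1 \<union> word_image S R S2)" if py: "y \<in> children p" for y
      proof -
        obtain i a where y: "y \<in> carrier G" "fst (state y) = (i, a) # p" using py by (auto simp: children_def stack_def)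
        have st: "a \<in> word_image S R (part i)" "snd (state y) \<in> word_image S R (S1 \<inter> S2)"
          using state_states[OF y(1)] y(2) by (auto simp: states_def)
        then have "a \<otimes>\<^bsub>G\<^esub> snd (state y) \<in> word_image S R (part i)" using F_mult C_F by blast
        moreover have "y = stack_prod p \<otimes>\<^bsub>G\<^esub> (a \<otimes>\<^bsub>G\<^esub> snd (state y))"
          using stack_prod_state[OF y(1)] y(2) st \<open>stack_prod p \<in> carrier G\<close> F_carrier C_carrier by (simp add: m_assoc)
        ultimately show ?thesis by (cases i) (auto simp: part_def)
      qed
      ultimately show ?thesis using Y by blast
    qed (use one_closed in blast)
  qed auto
qed

end

section \<open>Roots of the geometric representation\<close>

primrec alt :: "'v \<Rightarrow> 'v \<Rightarrow> nat \<Rightarrow> 'v list" where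
  "alt a b 0 = []"
| "alt a b (Suc k) = a # alt b a k"

lemma alt_snoc: "alt a b (Suc k) = alt a b k @ [if even k then a else b]"
  by (induction k arbitrary: a b) auto

lemma length_alt [simp]: "length (alt a b k) = k"
  by (induction k arbitrary: a b) auto

lemma set_alt: "set (alt a b k) \<subseteq> {a, b}"
  by (induction k arbitrary: a b) auto

lemma rev_alt: "rev (alt a b k) = (if even k then alt b a k else alt a b k)"
proof (induction k arbitrary: a b)
  case (Suc k)
  have "rev (alt a b (Suc k)) = (if even k then a else b) # rev (alt a b k)" by (simp add: alt_snoc del: alt.simps)
  then show ?case using Suc by simp
qed simp

text \<open>Chebyshev polynomials of the second kind: at \<open>2 * cos \<theta>\<close> the value
  is sin (k \<theta>) / sin \<theta> when sin \<theta> is nonzero. They will be the coordinates of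
  roots in a dihedral plane, with x = 2 for the label \<infinity>.\<close>

fun cheb :: "real \<Rightarrow> nat \<Rightarrow> real" where
  "cheb x 0 = 0"
| "cheb x (Suc 0) = 1"
| "cheb x (Suc (Suc k)) = x * cheb x (Suc k) - cheb x k"

lemma cheb_2: "cheb 2 k = real k"
  by (induction "2::real" k rule: cheb.induct) auto

lemma sin_cheb: "sin \<theta> * cheb (2 * cos \<theta>) k = sin (real k * \<theta>)"
proof (induction "2 * cos \<theta>" k rule: cheb.induct)
  case (3 k)
  have "sin (real (Suc (Suc k)) * \<theta>) + sin (real k * \<theta>) = 2 * cos \<theta> * sin (real (Suc k) * \<theta>)"
  proof -
    have "real (Suc (Suc k)) * \<theta> = real (Suc k) * \<theta> + \<theta>" "real k * \<theta> = real (Suc k) * \<theta> - \<theta>"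
      by (simp_all add: algebra_simps)
    then show ?thesis by (simp only: sin_add sin_diff) simp
  qed
  then show ?case using 3 by (simp add: algebra_simps)
qed auto

lemma cheb_cos_pi:
  assumes "m \<ge> 2"
  shows "k \<le> m \<Longrightarrow> cheb (2 * cos (pi / real m)) k \<ge> 0"
    and "cheb (2 * cos (pi / real m)) m = 0"
    and "cheb (2 * cos (pi / real m)) (m - 1) = 1"
    and "cheb (2 * cos (pi / real m)) (Suc m) = -1"
proof -
  let ?\<theta> = "pi / real m"
  have "?\<theta> < pi" using assms by (simp add: field_simps)
  then have pos: "sin ?\<theta> > 0" using assms by (intro sin_gt_zero) auto
  have *: "cheb (2 * cos ?\<theta>) k = sin (real k * ?\<theta>) / sin ?\<theta>" for k
    using sin_cheb[of ?\<theta> k] pos by (simp add: field_simps)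
  show "cheb (2 * cos ?\<theta>) k \<ge> 0" if "k \<le> m"
  proof -
    have "real k * ?\<theta> \<le> pi" using that assms by (simp add: field_simps)
    then have "sin (real k * ?\<theta>) \<ge> 0" by (intro sin_ge_zero) auto
    then show ?thesis using pos by (simp add: *)
  qed
  have m: "real m * ?\<theta> = pi" using assms by simp
  show "cheb (2 * cos ?\<theta>) m = 0" unfolding * m by simp
  have "real (m - 1) * ?\<theta> = pi - ?\<theta>" using assms by (simp add: of_nat_diff field_simps)
  then show "cheb (2 * cos ?\<theta>) (m - 1) = 1" using pos unfolding * by simp
  have "real (Suc m) * ?\<theta> = pi + ?\<theta>" using assms by (simp add: field_simps)
  then show "cheb (2 * cos ?\<theta>) (Suc m) = -1" using pos unfolding * by simp
qed

lemma cheb_cos_pi_pos: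
  assumes "0 < k" "k < m"
  shows "cheb (2 * cos (pi / real m)) k > 0"
proof -
  have *: "sin (real j * (pi / real m)) > 0" if "0 < j" "j < m" for j
    using that by (intro sin_gt_zero) (auto simp: field_simps)
  show ?thesis using sin_cheb[of "pi / real m" k] *[of 1] *[of k] assms
    by (metis One_nat_def Suc_lessI less_trans_Suc mult_1 of_nat_1 zero_less_mult_pos zero_less_one)
qed

lemma alternating_conv_alt: "alternating a b k = map (\<lambda>s. (s, True)) (alt a b k)"
  by (induction k arbitrary: a b) auto

lemma alt_or_repeat:
  assumes "us \<in> lists {a, b}"
  shows "(\<exists>xs c ys. us = xs @ c # c # ys) \<or> (\<exists>z z'. {z, z'} = {a, b} \<and> us = alt z z' (length us))"
  using assms
proof (induction us)
  case Nil
  show ?case by (intro disjI2 exI[of _ a] exI[of _ b]) simp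
next
  case (Cons c us)
  from Cons.IH have "(\<exists>xs c ys. us = xs @ c # c # ys) \<or> (\<exists>z z'. {z, z'} = {a, b} \<and> us = alt z z' (length us))"
    by simp
  then show ?case
  proof
    assume "\<exists>xs c ys. us = xs @ c # c # ys"
    then obtain xs e ys where "us = xs @ e # e # ys" by blast
    then have "c # us = (c # xs) @ e # e # ys" by simp
    then show ?thesis by blast
  next
    assume "\<exists>z z'. {z, z'} = {a, b} \<and> us = alt z z' (length us)"
    then obtain z z' where z: "{z, z'} = {a, b}" "us = alt z z' (length us)" by blast
    have c: "c \<in> {a, b}" using Cons.hyps by simp
    show ?thesis
    proof (cases us)
      case Nil
      have "\<exists>z'. {c, z'} = {a, b}" using c by blast
      then show ?thesis using Nil by auto
    next
      case (Cons e es)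
      then have "e = z" using z(2) by (cases "length us") auto
      show ?thesis
      proof (cases "c = e")
        case True
        then have "c # us = [] @ c # c # es" using Cons by simp
        then show ?thesis by blast
      next
        case False
        then have "c = z'" using \<open>e = z\<close> c z(1) by auto
        then have "c # us = alt z' z (length (c # us))" using z(2) by simp
        moreover have "{z', z} = {a, b}" using z(1) by auto
        ultimately show ?thesis by blast
      qed
    qed
  qed
qed

section \<open>The geometric representation and its braid relations\<close>

type_synonym 'v operator = "('v \<Rightarrow> real) \<Rightarrow> 'v \<Rightarrow> real"

definition lincomb :: "real \<Rightarrow> ('v \<Rightarrow> real) \<Rightarrow> real \<Rightarrow> ('v \<Rightarrow> real) \<Rightarrow> 'v \<Rightarrow> real" where
  "lincomb p f q g = (\<lambda>t. p * f t + q * g t)"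

definition unit :: "'v \<Rightarrow> 'v \<Rightarrow> real" where
  "unit s = (\<lambda>t. if t = s then 1 else 0)"

definition nonneg :: "('v \<Rightarrow> real) \<Rightarrow> bool" where
  "nonneg f \<longleftrightarrow> (\<forall>t. f t \<ge> 0)"

lemma unit_inject [simp]: "unit a = unit b \<longleftrightarrow> a = b"
  by (metis unit_def zero_neq_one)

lemma nonneg_unit: "nonneg (unit s)"
  by (simp add: nonneg_def unit_def)

lemma nonneg_lincomb: "nonneg f \<Longrightarrow> nonneg g \<Longrightarrow> p \<ge> 0 \<Longrightarrow> q \<ge> 0 \<Longrightarrow> nonneg (lincomb p f q g)"
  by (simp add: nonneg_def lincomb_def)

text \<open>The value \<open>m s t = 0\<close> encodes the label \<open>\<infinity>\<close>.\<close>

locale coxeter_matrix =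
  fixes S :: "'v set" and m :: "'v \<Rightarrow> 'v \<Rightarrow> nat"
  assumes finite_S: "finite S"
    and m_sym: "m s t = m t s"
    and m_ne_1: "m s t \<noteq> 1"
begin

definition gram :: "'v \<Rightarrow> 'v \<Rightarrow> real" where
  "gram s t = (if s = t then 1 else if m s t = 0 then - 1 else - cos (pi / real (m s t)))"

definition pairing :: "'v \<Rightarrow> ('v \<Rightarrow> real) \<Rightarrow> real" where
  "pairing s f = (\<Sum>t\<in>S. gram s t * f t)"

definition form :: "('v \<Rightarrow> real) \<Rightarrow> ('v \<Rightarrow> real) \<Rightarrow> real" where
  "form f g = (\<Sum>s\<in>S. f s * pairing s g)"

definition refl :: "'v \<Rightarrow> ('v \<Rightarrow> real) \<Rightarrow> 'v \<Rightarrow> real" where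
  "refl s f = f(s := f s - 2 * pairing s f)"

text \<open>The first letter of a list is applied last, so composing on the right with a generator
  appends a letter.\<close>

primrec act :: "'v list \<Rightarrow> ('v \<Rightarrow> real) \<Rightarrow> 'v \<Rightarrow> real" where
  "act [] = id"
| "act (s # ws) = refl s \<circ> act ws"

lemma gram_sym: "gram s t = gram t s"
  using m_sym by (auto simp: gram_def)

lemma gram_self [simp]: "gram s s = 1"
  by (simp add: gram_def)

lemma pairing_lincomb: "pairing s (lincomb p f q g) = p * pairing s f + q * pairing s g"
  by (simp add: pairing_def lincomb_def algebra_simps sum.distrib sum_distrib_left)

lemma pairing_unit: "t \<in> S \<Longrightarrow> pairing s (unit t) = gram s t"
  by (simp add: pairing_def unit_def finite_S if_distrib sum.delta cong: if_cong)

lemma fun_upd_lincomb: "f(s := f s + a) = lincomb 1 f a (unit s)"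
  by (auto simp: lincomb_def unit_def)

lemma refl_lincomb_unit: "refl s f = lincomb 1 f (- 2 * pairing s f) (unit s)"
  unfolding refl_def by (simp flip: fun_upd_lincomb)

lemma form_lincomb_left: "form (lincomb p f q g) h = p * form f h + q * form g h"
  by (simp add: form_def lincomb_def algebra_simps sum.distrib sum_distrib_left)

lemma form_lincomb_right: "form h (lincomb p f q g) = p * form h f + q * form h g"
  by (simp add: form_def pairing_lincomb algebra_simps sum.distrib sum_distrib_left)

lemma form_unit_left: "s \<in> S \<Longrightarrow> form (unit s) f = pairing s f"
  by (simp add: form_def unit_def finite_S if_distrib[of "\<lambda>x. x * _"] sum.delta cong: if_cong)

lemma form_unit_right: "s \<in> S \<Longrightarrow> form f (unit s) = pairing s f"
  by (simp add: form_def pairing_unit) (simp add: pairing_def gram_sym mult.commute)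

lemma pairing_refl: "s \<in> S \<Longrightarrow> pairing s (refl s f) = - pairing s f"
  by (simp add: refl_lincomb_unit pairing_lincomb pairing_unit)

lemma form_refl: "s \<in> S \<Longrightarrow> form (refl s f) (refl s g) = form f g"
  by (simp add: refl_lincomb_unit form_lincomb_left form_lincomb_right form_unit_left
      form_unit_right pairing_lincomb pairing_unit algebra_simps)

lemma refl_refl: "s \<in> S \<Longrightarrow> refl s (refl s f) = f"
  using pairing_refl[of s f] by (auto simp: refl_def)

lemma refl_lincomb: "refl s (lincomb p f q g) = lincomb p (refl s f) q (refl s g)"
  by (rule ext) (simp add: refl_def pairing_lincomb, simp add: lincomb_def algebra_simps)

lemma act_append: "act (us @ vs) = act us \<circ> act vs"
  by (induction us) (simp_all add: comp_assoc)

lemma act_lincomb: "act ws (lincomb p f q g) = lincomb p (act ws f) q (act ws g)"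
  by (induction ws) (auto simp: refl_lincomb)

lemma form_act: "ws \<in> lists S \<Longrightarrow> form (act ws f) (act ws g) = form f g"
  by (induction ws) (auto simp: form_refl)

lemma act_rev_cancel: "ws \<in> lists S \<Longrightarrow> act ws (act (rev ws) f) = f"
proof (induction ws arbitrary: f)
  case (Cons s ws)
  then show ?case by (simp add: act_append refl_refl)
qed simp

lemma act_rev_cancel': "ws \<in> lists S \<Longrightarrow> act (rev ws) (act ws f) = f"
  using act_rev_cancel[of "rev ws" f] by (simp add: in_lists_conv_set)

lemma refl_plane:
  assumes "s \<in> S" "t \<in> S"
  shows "refl t (lincomb p (unit s) q (unit t)) = lincomb p (unit s) (- q - 2 * gram s t * p) (unit t)"
proof (cases "s = t")
  case True
  then show ?thesis
    using assms by (auto simp: fun_eq_iff refl_lincomb_unit pairing_lincomb pairing_unit)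
      (auto simp: lincomb_def unit_def algebra_simps)
next
  case False
  then show ?thesis
    using assms by (auto simp: fun_eq_iff refl_lincomb_unit pairing_lincomb pairing_unit gram_sym[of t s])
      (auto simp: lincomb_def unit_def algebra_simps)
qed

text \<open>Both reflections preserve the plane of the two simple roots, and the coordinate that
  changes obeys the recursion of \<open>cheb\<close>.\<close>

lemma act_rev_alt:
  assumes "s \<in> S" "t \<in> S"
  shows "act (rev (alt t s k)) (unit s) =
    (if even k then lincomb (cheb (- 2 * gram s t) (Suc k)) (unit s) (cheb (- 2 * gram s t) k) (unit t)
     else lincomb (cheb (- 2 * gram s t) k) (unit s) (cheb (- 2 * gram s t) (Suc k)) (unit t))"
proof (induction k)
  case 0
  show ?case by (simp add: lincomb_def)
next
  case (Suc k)
  have refl_s: "refl s (lincomb p (unit s) q (unit t)) = lincomb (- p - 2 * gram s t * q) (unit s) q (unit t)" for p q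
    using refl_plane[OF assms(2,1), of q p] gram_sym[of s t] by (simp add: lincomb_def add.commute)
  have "cheb (- 2 * gram s t) (Suc (Suc k)) = - cheb (- 2 * gram s t) k - 2 * gram s t * cheb (- 2 * gram s t) (Suc k)"
    by simp
  moreover have "act (rev (alt t s (Suc k))) (unit s) = refl (if even k then t else s) (act (rev (alt t s k)) (unit s))"
    by (simp add: alt_snoc del: alt.simps)
  ultimately show ?case
    using Suc refl_plane[OF assms] refl_s by (cases "even k") (simp_all del: cheb.simps)
qed

lemma gram_cheb:
  assumes "s \<noteq> t"
  shows "- 2 * gram s t = (if m s t = 0 then 2 else 2 * cos (pi / real (m s t)))"
  using assms by (simp add: gram_def)

lemma cheb_gram_nonneg:
  assumes "s \<noteq> t" "m s t = 0 \<or> k \<le> m s t"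
  shows "cheb (- 2 * gram s t) k \<ge> 0"
proof (cases "m s t = 0")
  case True
  then show ?thesis using assms by (simp add: gram_def cheb_2)
next
  case False
  then have "m s t \<ge> 2" using m_ne_1[of s t] by linarith
  then show ?thesis unfolding gram_cheb[OF assms(1)] using cheb_cos_pi(1) assms False by auto
qed

lemma act_fixed: "(\<And>s. s \<in> set ws \<Longrightarrow> pairing s f = 0) \<Longrightarrow> act ws f = f"
  by (induction ws) (auto simp: refl_def)

text \<open>At the label the Chebyshev value is 0, one before it 1 and one after it -1, so either
  alternating word of full length negates the root, up to exchanging s and t.\<close>

lemma act_braid_aux:
  assumes "s \<in> S" "t \<in> S" "s \<noteq> t" "m s t \<noteq> 0"
  shows "act (rev (alt t s (m s t))) (unit s) = (if even (m s t) then lincomb (- 1) (unit s) 0 (unit t) else lincomb 0 (unit s) (- 1) (unit t))"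
    and "act (rev (alt s t (m s t))) (unit s) = (if even (m s t) then lincomb (- 1) (unit s) 0 (unit t) else lincomb 0 (unit s) (- 1) (unit t))"
proof -
  have 2: "m s t \<ge> 2" using m_ne_1[of s t] assms by linarith
  define k where "k = m s t - 1"
  have k: "m s t = Suc k" using 2 by (simp add: k_def)
  note c = cheb_cos_pi(2-4)[OF 2] gram_cheb[OF assms(3)]
  have x: "- 2 * gram s t = 2 * cos (pi / real (m s t))" using c assms by simp
  have c': "cheb (- 2 * gram s t) (m s t) = 0" "cheb (- 2 * gram s t) k = 1" "cheb (- 2 * gram s t) (Suc (m s t)) = - 1"
    unfolding x using c(1-3) by (simp_all add: k_def)
  show "act (rev (alt t s (m s t))) (unit s) = (if even (m s t) then lincomb (- 1) (unit s) 0 (unit t) else lincomb 0 (unit s) (- 1) (unit t))"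
    unfolding act_rev_alt[OF assms(1,2)] c' by simp
  have "refl s (unit s) = lincomb (- 1) (unit s) 0 (unit s)"
    using assms by (auto simp: refl_lincomb_unit pairing_unit) (simp add: lincomb_def)
  then have "act (rev (alt s t (m s t))) (unit s) = lincomb (- 1) (act (rev (alt t s k)) (unit s)) 0 (act (rev (alt t s k)) (unit s))"
    by (simp add: k act_append act_lincomb)
  then show "act (rev (alt s t (m s t))) (unit s) = (if even (m s t) then lincomb (- 1) (unit s) 0 (unit t) else lincomb 0 (unit s) (- 1) (unit t))"
    unfolding act_rev_alt[OF assms(1,2)] c'(2) using c'(1) unfolding k by (simp add: lincomb_def)
qed

text \<open>For a finite label the form is nondegenerate on the plane of s and t. So f splits into a
  vector of the plane, where \<open>act_braid_aux\<close> applies, and a vector fixed by both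
  reflections.\<close>

lemma act_braid_rev:
  assumes "s \<in> S" "t \<in> S" "s \<noteq> t" "m s t \<noteq> 0"
  shows "act (rev (alt t s (m s t))) = act (rev (alt s t (m s t)))"
proof (rule ext)
  fix f
  have 2: "m s t \<ge> 2" using m_ne_1[of s t] assms by linarith
  define c where "c = gram s t"
  have "pi / real (m s t) < pi" using 2 by (simp add: field_simps)
  then have "sin (pi / real (m s t)) > 0" using 2 by (intro sin_gt_zero) auto
  then have "(cos (pi / real (m s t)))\<^sup>2 \<noteq> 1"
    using sin_cos_squared_add[of "pi / real (m s t)"] by (auto simp: power2_eq_square)
  then have det: "1 - c * c \<noteq> 0" using assms by (simp add: c_def gram_def power2_eq_square)
  \<comment> \<open>Cramer's rule for the vector of the plane that has the same pairings with s and
    t as f.\<close>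
  define p where "p = (pairing s f - c * pairing t f) / (1 - c * c)"
  define q where "q = (pairing t f - c * pairing s f) / (1 - c * c)"
  define f0 where "f0 = lincomb 1 f (- 1) (lincomb p (unit s) q (unit t))"
  have "p + q * c = pairing s f"
  proof -
    have "p + q * c = pairing s f * (1 - c * c) / (1 - c * c)"
      unfolding p_def q_def by (simp add: algebra_simps flip: add_divide_distrib diff_divide_distrib)
    then show ?thesis using det by simp
  qed
  moreover have "p * c + q = pairing t f"
  proof -
    have "p * c + q = pairing t f * (1 - c * c) / (1 - c * c)"
      unfolding p_def q_def by (simp add: algebra_simps flip: add_divide_distrib diff_divide_distrib)
    then show ?thesis using det by simp
  qed
  ultimately have "pairing s f0 = 0" "pairing t f0 = 0"
    using assms by (auto simp: f0_def pairing_lincomb pairing_unit gram_sym[of t s] c_def)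
  then have f0: "act (rev (alt t s k)) f0 = f0" "act (rev (alt s t k)) f0 = f0" for k
    using set_alt[of t s k] set_alt[of s t k] by (auto intro!: act_fixed)
  have f: "f = lincomb 1 f0 1 (lincomb p (unit s) q (unit t))"
    by (simp add: f0_def lincomb_def)
  note st = act_braid_aux[OF assms] act_braid_aux[OF assms(2,1) assms(3)[symmetric], unfolded m_sym[of t s], OF assms(4)]
  show "act (rev (alt t s (m s t))) f = act (rev (alt s t (m s t))) f"
    by (subst (1 2) f) (simp add: act_lincomb f0 st)
qed

lemma act_braid:
  assumes "s \<in> S" "t \<in> S" "s \<noteq> t" "m s t \<noteq> 0"
  shows "act (alt s t (m s t)) = act (alt t s (m s t))"
  using act_braid_rev[OF assms] by (simp add: rev_alt split: if_splits)

definition W :: "'v operator set" where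
  "W = act ` lists S"

definition len :: "'v operator \<Rightarrow> nat" where
  "len w = (LEAST n. \<exists>ws\<in>lists S. act ws = w \<and> length ws = n)"

lemma len_act_le: "ws \<in> lists S \<Longrightarrow> len (act ws) \<le> length ws"
  unfolding len_def by (rule Least_le) auto

lemma reduced_word:
  assumes "w \<in> W" obtains ws where "ws \<in> lists S" "act ws = w" "length ws = len w"
proof -
  have "\<exists>n. \<exists>ws\<in>lists S. act ws = w \<and> length ws = n" using assms by (auto simp: W_def)
  from LeastI_ex[OF this] show ?thesis using that unfolding len_def by blast
qed

lemma W_comp: "w \<in> W \<Longrightarrow> ws \<in> lists S \<Longrightarrow> w \<circ> act ws \<in> W"
  unfolding W_def by (metis (no_types, lifting) act_append append_in_lists_conv image_iff)

lemma W_refl: "w \<in> W \<Longrightarrow> s \<in> S \<Longrightarrow> w \<circ> refl s \<in> W"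
  using W_comp[of w "[s]"] by simp

lemma len_comp_le:
  assumes "w \<in> W" "ws \<in> lists S" shows "len (w \<circ> act ws) \<le> len w + length ws"
proof -
  obtain us where "us \<in> lists S" "act us = w" "length us = len w" using assms(1) by (rule reduced_word)
  then show ?thesis using len_act_le[of "us @ ws"] assms(2) by (simp add: act_append)
qed

lemma comp_refl_refl: "s \<in> S \<Longrightarrow> w \<circ> refl s \<circ> refl s = w"
  by (simp add: fun_eq_iff refl_refl)

text \<open>Humphreys, Reflection Groups and Coxeter Groups, Theorem 5.4: split off the longest alternating
  word in \<open>s\<close> and the last letter \<open>t\<close> of a reduced word.\<close>

theorem nonneg_root:
  assumes "w \<in> W" "s \<in> S" "len w \<le> len (w \<circ> refl s)"
  shows "nonneg (w (unit s))"
  using assms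
proof (induction "len w" arbitrary: w s rule: less_induct)
  case less
  obtain ws where ws: "ws \<in> lists S" "act ws = w" "length ws = len w" using less.prems(1) by (rule reduced_word)
  show ?case
  proof (cases ws rule: rev_cases)
    case Nil
    then show ?thesis using ws nonneg_unit by auto
  next
    case (snoc vs t)
    then have vs: "vs \<in> lists S" "t \<in> S" "w = act vs \<circ> refl t" "len w = Suc (length vs)"
      using ws by (auto simp: act_append)
    \<comment> \<open>Maximality of k will show that the letter extending the alternating word is no
      descent of v; additivity of lengths shows the same for the first letter of that word.\<close>
    define P where "P k v \<longleftrightarrow> v \<in> W \<and> w = v \<circ> act (rev (alt t s k)) \<and> len v + k = len w" for k v
    have "act vs \<in> W" using vs by (simp add: W_def)
    have P1: "P 1 (act vs)"
    proof -
      have "len w \<le> len (act vs) + 1" using len_comp_le[OF \<open>act vs \<in> W\<close>, of "[t]"] vs by simp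
      then show ?thesis using vs len_act_le[of vs] \<open>act vs \<in> W\<close> by (simp add: P_def)
    qed
    have ts: "t \<noteq> s"
    proof
      assume "t = s"
      then have "w \<circ> refl s = act vs" using vs comp_refl_refl by simp
      then show False using less.prems(3) len_act_le[OF vs(1)] vs by simp
    qed
    have bound: "\<forall>k. (\<exists>v. P k v) \<longrightarrow> k \<le> len w" by (auto simp: P_def)
    define k where "k = (GREATEST k. \<exists>v. P k v)"
    have "\<exists>v. P k v" unfolding k_def by (rule GreatestI_nat[of "\<lambda>k. \<exists>v. P k v" 1]) (use P1 bound in auto)
    then obtain v where v: "v \<in> W" "w = v \<circ> act (rev (alt t s k))" "len v + k = len w" by (auto simp: P_def)
    have max: "j \<le> k" if "P j v'" for j v'
      unfolding k_def by (rule Greatest_le_nat[of "\<lambda>k. \<exists>v. P k v"]) (use that bound in auto)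
    have k1: "k \<ge> 1" using max[OF P1] .
    let ?z = "if even k then t else s" and ?z' = "if even k then s else t"
    have lists: "rev (alt x y j) \<in> lists S" if "{x, y} \<subseteq> S" for x y j using set_alt[of x y j] that by auto
    have len_z: "len v \<le> len (v \<circ> refl ?z)"
    proof (rule ccontr)
      assume "\<not> ?thesis"
      then have lt: "len (v \<circ> refl ?z) < len v" by simp
      have vz: "v \<circ> refl ?z \<in> W" using v vs less.prems by (auto intro: W_refl)
      have w: "w = v \<circ> refl ?z \<circ> act (rev (alt t s (Suc k)))"
        using comp_refl_refl[of ?z v] vs less.prems v(2) by (simp add: alt_snoc comp_assoc[symmetric] del: alt.simps)
      have "len w \<le> len (v \<circ> refl ?z) + Suc k"
        unfolding w using len_comp_le[OF vz lists[of t s "Suc k"]] less.prems vs by simp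
      then have "P (Suc k) (v \<circ> refl ?z)" unfolding P_def using vz w lt v(3) by auto
      then show False using max by fastforce
    qed
    have len_z': "len v \<le> len (v \<circ> refl ?z')"
    proof (rule ccontr)
      assume "\<not> ?thesis"
      then have lt: "len (v \<circ> refl ?z') < len v" by simp
      have vz: "v \<circ> refl ?z' \<in> W" using v vs less.prems by (auto intro: W_refl)
      obtain j where j: "k = Suc j" using k1 by (cases k) auto
      have "w = v \<circ> refl ?z' \<circ> act (rev (alt t s j))"
        using v(2) unfolding j by (simp add: alt_snoc comp_assoc del: alt.simps)
      then have "len w \<le> len (v \<circ> refl ?z') + j"
        using len_comp_le[OF vz lists[of t s j]] less.prems vs by simp
      then show False using lt v(3) j by simp
    qed
    have "len v < len w" using v(3) k1 by simp
    moreover have "len v \<le> len (v \<circ> refl s)" "len v \<le> len (v \<circ> refl t)"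
      using len_z len_z' by (auto split: if_splits)
    ultimately have pos: "nonneg (v (unit s))" "nonneg (v (unit t))"
      using less.hyps v(1) less.prems(2) vs(2) by blast+
    \<comment> \<open>Otherwise a braid move makes w end in s without lengthening the word, and then
      s would shorten w.\<close>
    have k_less: "m s t = 0 \<or> Suc k \<le> m s t"
    proof (rule ccontr)
      assume "\<not> ?thesis"
      then have mk: "m s t \<noteq> 0" "m s t \<le> k" by auto
      then obtain j where j: "m s t = Suc j" by (cases "m s t") auto
      have split: "alt x y (i + l) = alt x y i @ (if even i then alt x y l else alt y x l)" for x y i l
        by (induction i arbitrary: x y) auto
      define us where "us = rev (if even (m s t) then alt t s (k - m s t) else alt s t (k - m s t))"
      have us: "us \<in> lists S" "length us = k - m s t" using lists[of s t] lists[of t s] less.prems vs by (auto simp: us_def)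
      have "rev (alt t s k) = us @ rev (alt t s (m s t))"
        using split[of t s "m s t" "k - m s t"] mk by (simp add: us_def)
      then have "w = v \<circ> act us \<circ> act (rev (alt s t (m s t)))"
        using v(2) act_braid_rev[of s t] less.prems vs ts mk by (simp add: act_append comp_assoc)
      also have "\<dots> = v \<circ> act us \<circ> act (rev (alt t s j)) \<circ> refl s"
        unfolding j by (simp add: act_append comp_assoc)
      finally have "w \<circ> refl s = v \<circ> act (us @ rev (alt t s j))"
        using comp_refl_refl[of s "v \<circ> act us \<circ> act (rev (alt t s j))"] less.prems(2)
        by (simp add: act_append comp_assoc)
      then have "len (w \<circ> refl s) \<le> len v + length (us @ rev (alt t s j))"
        using len_comp_le[OF v(1), of "us @ rev (alt t s j)"] us lists[of t s j] less.prems vs by simp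
      then show False using less.prems(3) us v(3) mk j by simp
    qed
    have "cheb (- 2 * gram s t) (Suc k) \<ge> 0" "cheb (- 2 * gram s t) k \<ge> 0"
      using cheb_gram_nonneg[of s t] ts k_less by (metis Suc_leD)+
    moreover obtain us where "us \<in> lists S" "act us = v" using v(1) by (auto simp: W_def)
    ultimately show ?thesis
      unfolding v(2) using pos less.prems vs
      by (auto simp: act_rev_alt act_lincomb intro!: nonneg_lincomb simp del: cheb.simps)
  qed
qed


section \<open>Signs of roots and inverse operators\<close>

lemma act_mem_W: "ws \<in> lists S \<Longrightarrow> act ws \<in> W"
  by (simp add: W_def)

lemma W_cases:
  assumes "w \<in> W" obtains ws where "ws \<in> lists S" "w = act ws"
  using assms unfolding W_def by blast

lemma refl_unit: "s \<in> S \<Longrightarrow> refl s (unit s) = (\<lambda>t. - unit s t)"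
  by (auto simp: refl_lincomb_unit pairing_unit) (simp add: lincomb_def)

lemma act_uminus: "act ws (\<lambda>t. - f t) = (\<lambda>t. - act ws f t)"
  using act_lincomb[of ws "-1" f 0 f] by (simp add: lincomb_def)

lemma W_uminus: "w \<in> W \<Longrightarrow> w (\<lambda>t. - f t) = (\<lambda>t. - w f t)"
  by (auto simp: W_def act_uminus)

lemma W_lincomb: "w \<in> W \<Longrightarrow> w (lincomb p f q g) = lincomb p (w f) q (w g)"
  by (auto simp: W_def act_lincomb)

lemma form_W: "w \<in> W \<Longrightarrow> form (w f) (w g) = form f g"
  by (metis W_cases form_act)

lemma form_unit_unit: "s \<in> S \<Longrightarrow> t \<in> S \<Longrightarrow> form (unit s) (unit t) = gram s t"
  by (simp add: form_unit_left pairing_unit)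

lemma bij_W: assumes "w \<in> W" shows "bij w"
proof -
  obtain ws where ws: "ws \<in> lists S" "w = act ws" using assms by (rule W_cases)
  show "bij w"
    unfolding ws(2) by (rule o_bij[of "act (rev ws)"]) (use ws(1) act_rev_cancel act_rev_cancel' in \<open>simp_all add: fun_eq_iff\<close>)
qed

definition winv :: "'v operator \<Rightarrow> ('v \<Rightarrow> real) \<Rightarrow> 'v \<Rightarrow> real" where
  "winv w = inv_into UNIV w"

lemma winv_act: "ws \<in> lists S \<Longrightarrow> winv (act ws) = act (rev ws)"
  unfolding winv_def by (rule inv_equality) (auto simp: act_rev_cancel act_rev_cancel')

lemma rev_in_lists: "ws \<in> lists S \<Longrightarrow> rev ws \<in> lists S"
  by auto

lemma winv_mem: "w \<in> W \<Longrightarrow> winv w \<in> W"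
  by (metis W_cases act_mem_W rev_in_lists winv_act)

lemma winv_comp:
  assumes "w \<in> W" "ws \<in> lists S" shows "winv (w \<circ> act ws) = act (rev ws) \<circ> winv w"
proof -
  obtain us where us: "us \<in> lists S" "w = act us" using assms(1) by (rule W_cases)
  then have "winv (w \<circ> act ws) = act (rev (us @ ws))" using assms(2) winv_act[of "us @ ws"] by (simp add: act_append)
  then show ?thesis using us by (simp add: winv_act act_append)
qed

lemma winv_eq_iff: "w \<in> W \<Longrightarrow> winv w f = g \<longleftrightarrow> f = w g"
  unfolding winv_def using bij_W by (metis bij_inv_eq_iff)

text \<open>One of w and w s satisfies the length condition of \<open>nonneg_root\<close>, and s
  negates its own root.\<close>

lemma root_sign:
  assumes "w \<in> W" "s \<in> S"
  shows "nonneg (w (unit s)) \<or> nonneg (\<lambda>t. - w (unit s) t)"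
proof (cases "len w \<le> len (w \<circ> refl s)")
  case True
  then show ?thesis using nonneg_root assms by blast
next
  case False
  have *: "w \<circ> refl s \<circ> refl s = w" by (rule comp_refl_refl[OF assms(2)])
  have "nonneg ((w \<circ> refl s) (unit s))"
    by (rule nonneg_root) (use False assms W_refl in \<open>simp_all only: *\<close>)
  then show ?thesis using assms by (simp add: refl_unit W_uminus)
qed

lemma root_nonneg_unique:
  assumes "w \<in> W" "s \<in> S" "nonneg (w (unit s))" "nonneg (\<lambda>t. - w (unit s) t)"
  shows False
proof -
  have "w (unit s) = (\<lambda>t. 0)" using assms(3,4) by (auto simp: nonneg_def fun_eq_iff intro: antisym)
  then have "form (w (unit s)) (w (unit s)) = 0" by (simp add: form_def)
  then show False using assms by (simp add: form_W form_unit_unit)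
qed

text \<open>Roots have norm 1, which determines the remaining scalar up to sign.\<close>

lemma root_multiple:
  assumes "w \<in> W" "s \<in> S" "x \<in> S" "nonneg (w (unit s))" "\<And>t. t \<noteq> x \<Longrightarrow> w (unit s) t = 0"
  shows "w (unit s) = unit x"
proof -
  define c where "c = w (unit s) x"
  have w: "w (unit s) = lincomb c (unit x) 0 (unit x)"
    using assms(5) by (auto simp: lincomb_def unit_def c_def fun_eq_iff)
  have "form (w (unit s)) (w (unit s)) = c * c" unfolding w
    using assms by (simp add: form_lincomb_left form_lincomb_right form_unit_unit)
  then have "c * c = 1" using assms by (simp add: form_W form_unit_unit)
  moreover have "c \<ge> 0" using assms(4) by (simp add: c_def nonneg_def)
  ultimately have "c = 1" by (metis abs_of_nonneg abs_one square_eq_1_iff abs_minus_cancel)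
  then show ?thesis using w by (simp add: lincomb_def)
qed

text \<open>A positive root other than \<open>unit s\<close> has a positive coordinate away from s.
  The reflection in s leaves this coordinate alone, and one positive coordinate decides the sign of
  a root.\<close>

lemma refl_root_nonneg:
  assumes "w \<in> W" "t \<in> S" "s \<in> S" "nonneg (w (unit t))" "w (unit t) \<noteq> unit s"
  shows "nonneg (refl s (w (unit t)))"
proof -
  obtain r where r: "r \<noteq> s" "w (unit t) r \<noteq> 0" using root_multiple[OF assms(1-3,4)] assms(5) by blast
  then have "refl s (w (unit t)) r > 0" using assms(4) by (auto simp: refl_def nonneg_def less_le)
  moreover obtain ws where "ws \<in> lists S" "w = act ws" using assms(1) by (auto simp: W_def)
  then have "refl s \<circ> w \<in> W" using assms(3) act_mem_W[of "s # ws"] by simp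
  then have "nonneg ((refl s \<circ> w) (unit t)) \<or> nonneg (\<lambda>r. - (refl s \<circ> w) (unit t) r)"
    using root_sign assms(2) by blast
  ultimately show ?thesis unfolding nonneg_def by (metis comp_apply neg_0_le_iff_le not_le)
qed

lemma act_plane:
  assumes "a \<in> S" "b \<in> S" "vs \<in> lists {a, b}" "c \<in> {a, b}"
  shows "\<exists>p q. act vs (unit c) = lincomb p (unit a) q (unit b)"
  using assms(3)
proof (induction vs)
  case Nil
  have "unit a = lincomb 1 (unit a) 0 (unit b)" "unit b = lincomb 0 (unit a) 1 (unit b)" by (simp_all add: lincomb_def)
  then show ?case using assms(4) by (metis act.simps(1) empty_iff id_apply insert_iff)
next
  case (Cons s vs)
  then obtain p q where pq: "act vs (unit c) = lincomb p (unit a) q (unit b)" by auto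
  have "refl a (lincomb p (unit a) q (unit b)) = lincomb (- p - 2 * gram b a * q) (unit a) q (unit b)"
    using refl_plane[OF assms(2,1), of q p] by (simp add: lincomb_def add.commute)
  moreover have "refl b (lincomb p (unit a) q (unit b)) = lincomb p (unit a) (- q - 2 * gram a b * p) (unit b)"
    by (rule refl_plane[OF assms(1,2)])
  moreover have "s = a \<or> s = b" using Cons.hyps by auto
  ultimately show ?case using pq by (metis act.simps(2) comp_apply)
qed

text \<open>The root in the plane has two coordinates of the same sign, and v is positive on both
  simple roots. If both coordinates were positive, v would send both simple roots to multiples of
  \<open>unit x\<close>, hence to \<open>unit x\<close> itself, against injectivity.\<close>

lemma plane_root_unit:
  assumes v: "v \<in> W" "nonneg (v (unit a))" "nonneg (v (unit b))"
    and ab: "a \<in> S" "b \<in> S" "a \<noteq> b" and vs: "vs \<in> lists {a, b}" "c \<in> {a, b}"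
    and x: "x \<in> S" "v (act vs (unit c)) = unit x"
  shows "act vs (unit c) = unit a \<and> v (unit a) = unit x \<or> act vs (unit c) = unit b \<and> v (unit b) = unit x"
proof -
  have vs': "vs \<in> lists S" "c \<in> S" using vs ab by auto
  obtain p q where pq: "act vs (unit c) = lincomb p (unit a) q (unit b)" using act_plane ab vs by metis
  have eq: "lincomb p (v (unit a)) q (v (unit b)) = unit x" using x(2) pq v(1) by (simp add: W_lincomb)
  have val: "act vs (unit c) a = p" "act vs (unit c) b = q" using pq ab by (simp_all add: lincomb_def unit_def)
  have norm: "form (act vs (unit c)) (act vs (unit c)) = 1" using form_act[OF vs'(1)] vs' by (simp add: form_unit_unit)
  have "p \<ge> 0 \<and> q \<ge> 0"
  proof (rule ccontr)
    assume "\<not> ?thesis"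
    then have "p \<le> 0" "q \<le> 0"
      using root_sign[OF act_mem_W[OF vs'(1)] vs'(2)] val unfolding nonneg_def by (metis neg_0_le_iff_le)+
    then have "lincomb p (v (unit a)) q (v (unit b)) x \<le> 0"
      using v by (simp add: lincomb_def nonneg_def add_nonpos_nonpos mult_nonpos_nonneg)
    then show False unfolding eq by (simp add: unit_def)
  qed
  then consider "p = 0" | "q = 0" | "p > 0" "q > 0" by force
  then show ?thesis
  proof cases
    case 1
    have "act vs (unit c) = lincomb q (unit b) 0 (unit b)" using pq 1 by (simp add: lincomb_def)
    moreover from this have "q * q = 1" using norm ab by (simp add: form_lincomb_left form_lincomb_right form_unit_unit)
    then have "q = 1" using \<open>p \<ge> 0 \<and> q \<ge> 0\<close> by (metis square_eq_1_iff neg_0_le_iff_le not_one_le_zero)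
    ultimately have "act vs (unit c) = unit b" by (simp add: lincomb_def)
    then show ?thesis using x by simp
  next
    case 2
    have "act vs (unit c) = lincomb p (unit a) 0 (unit a)" using pq 2 by (simp add: lincomb_def)
    moreover from this have "p * p = 1" using norm ab by (simp add: form_lincomb_left form_lincomb_right form_unit_unit)
    then have "p = 1" using \<open>p \<ge> 0 \<and> q \<ge> 0\<close> by (metis square_eq_1_iff neg_0_le_iff_le not_one_le_zero)
    ultimately have "act vs (unit c) = unit a" by (simp add: lincomb_def)
    then show ?thesis using x by simp
  next
    case 3
    have "v (unit a) t = 0 \<and> v (unit b) t = 0" if "t \<noteq> x" for t
    proof -
      have "p * v (unit a) t + q * v (unit b) t = 0" using fun_cong[OF eq, of t] that by (simp add: lincomb_def unit_def)
      moreover have "p * v (unit a) t \<ge> 0" "q * v (unit b) t \<ge> 0" using 3 v by (auto simp: nonneg_def)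
      ultimately have "p * v (unit a) t = 0" "q * v (unit b) t = 0" by linarith+
      then show ?thesis using 3 by simp
    qed
    then have "v (unit a) = unit x" "v (unit b) = unit x" using root_multiple[OF v(1)] v ab x(1) by blast+
    then have "unit a = unit b" using bij_W[OF v(1)] by (metis bij_def injD)
    then show ?thesis using ab by simp
  qed
qed

text \<open>After a braid move on the first letters the last two letters are equal and
  cancel.\<close>

lemma act_alt_Suc_cancel:
  assumes "a \<in> S" "b \<in> S" "a \<noteq> b" "m a b \<noteq> 0"
  shows "act (alt a b (Suc (m a b))) = act (alt b a (m a b - 1))"
proof -
  obtain k where k: "m a b = Suc k" using assms(4) by (cases "m a b") auto
  let ?l = "if even k then b else a"
  have "act (alt a b (Suc (m a b))) = act (alt a b (m a b)) \<circ> refl ?l"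
    unfolding alt_snoc[of a b "m a b"] by (simp add: act_append k comp_assoc)
  also have "\<dots> = act (alt b a (m a b)) \<circ> refl ?l" using act_braid[OF assms] by simp
  also have "\<dots> = act (alt b a k) \<circ> refl ?l \<circ> refl ?l" unfolding k alt_snoc[of b a k] by (simp add: act_append comp_assoc)
  also have "\<dots> = act (alt b a k)" by (rule comp_refl_refl) (use assms in auto)
  finally show ?thesis by (simp add: k)
qed

text \<open>Shortest representative of the coset of the dihedral subgroup generated by \<open>a\<close> and \<open>b\<close>.\<close>

lemma dihedral_coset:
  assumes w: "w \<in> W" and ab: "a \<in> S" "b \<in> S" "a \<noteq> b" "m a b \<noteq> 0"
  obtains v z z' k where "v \<in> W" "{z, z'} = {a, b}" "k \<le> m a b" "w = v \<circ> act (alt z z' k)"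
    "nonneg (v (unit a))" "nonneg (v (unit b))"
proof -
  \<comment> \<open>Minimise the length of v first, then that of the remaining word. The first
    choice makes v positive on both roots, the second makes the word alternating and no longer than
    the label.\<close>
  define P where "P n l \<longleftrightarrow> (\<exists>v us. v \<in> W \<and> us \<in> lists {a, b} \<and> w = v \<circ> act us \<and> len v = n \<and> length us = l)" for n l
  have "P (len w) 0" unfolding P_def using w by (intro exI[of _ w] exI[of _ "[]"]) auto
  then have ex: "\<exists>n l. P n l" by blast
  define n where "n = (LEAST n. \<exists>l. P n l)"
  have "\<exists>l. P n l" unfolding n_def by (rule LeastI_ex[OF ex])
  then have Pl: "P n (LEAST l. P n l)" by (rule LeastI_ex)
  define l where "l = (LEAST l. P n l)"
  obtain v us where v: "v \<in> W" "us \<in> lists {a, b}" "w = v \<circ> act us" "len v = n" "length us = l"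
    using Pl unfolding P_def l_def by blast
  have us_S: "us \<in> lists S" using v ab by auto
  have min_n: "n \<le> n'" if "P n' l'" for n' l' unfolding n_def using that by (auto intro: Least_le)
  have min_l: "l \<le> l'" if "P n l'" for l' unfolding l_def using that by (auto intro: Least_le)
  have pos: "nonneg (v (unit z))" if z: "z \<in> {a, b}" for z
  proof (rule nonneg_root[OF v(1)])
    show zS: "z \<in> S" using z ab by auto
    have "w = v \<circ> refl z \<circ> act (z # us)" using comp_refl_refl[OF zS, of v] v(3) by (simp add: comp_assoc[symmetric])
    then have "P (len (v \<circ> refl z)) (Suc (length us))"
      unfolding P_def using W_refl[OF v(1) zS] v z by (intro exI[of _ "v \<circ> refl z"] exI[of _ "z # us"]) auto
    then show "len v \<le> len (v \<circ> refl z)" using min_n v(4) by blast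
  qed
  have no_repeat: "us \<noteq> xs @ c # c # ys" for xs c ys
  proof
    assume us: "us = xs @ c # c # ys"
    then have "act us = act (xs @ ys)" using comp_refl_refl[of c "act xs"] us_S by (simp add: act_append comp_assoc[symmetric])
    then have "P n (length (xs @ ys))" unfolding P_def using v us by (intro exI[of _ v] exI[of _ "xs @ ys"]) auto
    then show False using min_l[of "length (xs @ ys)"] v us by simp
  qed
  then obtain z z' where z: "{z, z'} = {a, b}" "us = alt z z' (length us)" using alt_or_repeat[OF v(2)] by blast
  have mz: "m z z' = m a b" "z \<noteq> z'" "z \<in> S" "z' \<in> S" using z(1) ab m_sym[of a b] by (auto simp: doubleton_eq_iff)
  have "length us \<le> m a b"
  proof (rule ccontr)
    assume "\<not> ?thesis"
    then obtain j where j: "length us = Suc (m a b) + j" by (metis add_Suc less_iff_Suc_add not_le)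
    have "\<exists>rs. alt x y (i + j) = alt x y i @ rs \<and> set rs \<subseteq> {x, y} \<and> length rs = j" for x y :: 'v and i
    proof (induction i arbitrary: x y)
      case 0
      show ?case using set_alt[of x y j] by simp
    next
      case (Suc i)
      show ?case using Suc[of y x] by auto
    qed
    then obtain rs where rs: "us = alt z z' (Suc (m a b)) @ rs" "set rs \<subseteq> {a, b}" "length rs = j" using z j by metis
    have "act us = act (alt z' z (m a b - 1) @ rs)"
      using act_alt_Suc_cancel[OF mz(3,4,2)] mz(1) ab(4) unfolding rs(1) by (simp add: act_append del: alt.simps)
    moreover have "alt z' z (m a b - 1) @ rs \<in> lists {a, b}" using set_alt[of z' z "m a b - 1"] rs z(1) by auto
    ultimately have "P n (length (alt z' z (m a b - 1) @ rs))" unfolding P_def using v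
      by (intro exI[of _ v] exI[of _ "alt z' z (m a b - 1) @ rs"]) auto
    then show False using min_l[of "length (alt z' z (m a b - 1) @ rs)"] v j rs by simp
  qed
  then show ?thesis using that[of v z z' "length us"] v z pos by auto
qed

text \<open>The angles lie in (0, \<pi>], where cosine is injective and never 1; so no finite label
  produces the entry -1 that stands for \<infinity>.\<close>

lemma gram_inject:
  assumes "a \<noteq> b" "x \<noteq> y" "gram a b = gram x y"
  shows "m a b = m x y"
proof -
  have ang: "0 < pi / real k \<and> pi / real k \<le> pi" if "k \<noteq> 0" for k using that by (simp add: field_simps)
  have ne: "cos (pi / real k) \<noteq> 1" if "k \<noteq> 0" for k
    using cos_inj_pi[of "pi / real k" 0] ang[OF that] by auto
  have inj: "k = l" if "cos (pi / real k) = cos (pi / real l)" "k \<noteq> 0" "l \<noteq> 0" for k l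
    using cos_inj_pi[of "pi / real k" "pi / real l"] ang[of k] ang[of l] that by (simp add: field_simps)
  show ?thesis using assms ne[of "m a b"] ne[of "m x y"] inj[of "m a b" "m x y"] by (auto simp: gram_def split: if_splits)
qed

end

section \<open>Retraction onto parabolic subgroups\<close>

text \<open>H will be the Artin or Coxeter group of a subgraph. It enters only through the braid
  relations between the elements h x, which ties it to the Coxeter operators.\<close>

locale coxeter_retraction = coxeter_matrix S m + H: group H
  for S :: "'v set" and m and H :: "'h monoid" +
  fixes X :: "'v set" and h :: "'v \<Rightarrow> 'h"
  assumes X_S: "X \<subseteq> S"
    and h_closed: "x \<in> X \<Longrightarrow> h x \<in> carrier H"
    and h_braid: "x \<in> X \<Longrightarrow> y \<in> X \<Longrightarrow> x \<noteq> y \<Longrightarrow> m x y \<noteq> 0 \<Longrightarrow>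
      word_prod H (map h (alt x y (m x y))) = word_prod H (map h (alt y x (m x y)))"
begin

text \<open>The operators in \<open>D\<close> are the shortest representatives of the right cosets of the parabolic
  subgroup generated by \<open>X\<close>. Right multiplication by a generator \<open>s\<close> either permutes these cosets freely
  or fixes the coset of \<open>w\<close>, in which case \<open>w s = x w\<close> with \<open>x \<in> X\<close>; the second component records these
  letters \<open>x\<close>.\<close>

definition D :: "'v operator set" where
  "D = {w\<in>W. \<forall>x\<in>X. nonneg (winv w (unit x))}"

definition hit :: "'v operator \<Rightarrow> 'v \<Rightarrow> bool" where
  "hit w s \<longleftrightarrow> (\<exists>x\<in>X. w (unit s) = unit x)"

definition hit_letter :: "'v operator \<Rightarrow> 'v \<Rightarrow> 'v" where
  "hit_letter w s = (THE x. w (unit s) = unit x)"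

definition val :: "'v \<times> bool \<Rightarrow> 'h" where
  "val = (\<lambda>(x, e). if e then h x else inv\<^bsub>H\<^esub> h x)"

definition step :: "'v \<times> bool \<Rightarrow> 'v operator \<times> 'h \<Rightarrow> 'v operator \<times> 'h" where
  "step = (\<lambda>(s, e) (w, g). if hit w s then (w, g \<otimes>\<^bsub>H\<^esub> val (hit_letter w s, e)) else (w \<circ> refl s, g))"

lemma hit_letter: "w (unit s) = unit x \<Longrightarrow> hit_letter w s = x"
  unfolding hit_letter_def by (rule the_equality) auto

lemma step_hit: "x \<in> X \<Longrightarrow> w (unit s) = unit x \<Longrightarrow> step (s, e) (w, g) = (w, g \<otimes>\<^bsub>H\<^esub> val (x, e))"
  using hit_letter[of w s x] by (auto simp: step_def hit_def)

lemma step_no_hit: "\<not> hit w s \<Longrightarrow> step (s, e) (w, g) = (w \<circ> refl s, g)"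
  by (simp add: step_def)

lemma val_closed: "x \<in> X \<Longrightarrow> val (x, e) \<in> carrier H"
  by (simp add: val_def h_closed)

lemma D_W: "w \<in> D \<Longrightarrow> w \<in> W"
  by (simp add: D_def)

lemma id_D: "id \<in> D"
  using winv_act[of "[]"] act_mem_W[of "[]"] by (simp add: D_def nonneg_unit)

lemma D_refl:
  assumes "w \<in> D" "s \<in> S" "\<not> hit w s"
  shows "w \<circ> refl s \<in> D"
proof -
  have w: "w \<in> W" using assms by (simp add: D_def)
  have "nonneg (winv (w \<circ> refl s) (unit x))" if x: "x \<in> X" for x
  proof -
    have "winv (w \<circ> refl s) (unit x) = refl s (winv w (unit x))"
      using winv_comp[OF w, of "[s]"] assms(2) by simp
    moreover have "winv w (unit x) \<noteq> unit s" using assms(3) x winv_eq_iff[OF w] by (auto simp: hit_def)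
    ultimately show ?thesis
      using refl_root_nonneg[OF winv_mem[OF w], of x s] assms x X_S by (auto simp: D_def)
  qed
  then show ?thesis using W_refl[OF w assms(2)] by (simp add: D_def)
qed

lemma step_closed:
  assumes "st \<in> D \<times> carrier H" "l \<in> S \<times> UNIV"
  shows "step l st \<in> D \<times> carrier H"
proof -
  obtain w g s e where [simp]: "st = (w, g)" "l = (s, e)" by (cases st, cases l) auto
  show ?thesis
  proof (cases "hit w s")
    case True
    then obtain x where "x \<in> X" "w (unit s) = unit x" by (auto simp: hit_def)
    then show ?thesis using assms val_closed by (auto simp: step_hit)
  next
    case False
    then show ?thesis using assms D_refl by (auto simp: step_no_hit)
  qed
qed

text \<open>Otherwise the inverse of w would send a simple root of X to a negative one, against w in
  D. So stepping to another coset and back records no letter.\<close>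

lemma no_hit_back:
  assumes "w \<in> D" "s \<in> S"
  shows "\<not> hit (w \<circ> refl s) s"
proof
  assume "hit (w \<circ> refl s) s"
  then obtain x where x: "x \<in> X" "(\<lambda>t. - w (unit s) t) = unit x"
    using assms by (auto simp: hit_def refl_unit D_W W_uminus)
  have w: "w \<in> W" using assms by (simp add: D_W)
  have "w (\<lambda>t. - unit s t) = unit x" using x w by (simp add: W_uminus)
  then have "winv w (unit x) = (\<lambda>t. - unit s t)" using winv_eq_iff[OF w] by metis
  then have "nonneg (\<lambda>t. - unit s t)" using assms x by (auto simp: D_def)
  then show False by (auto simp: nonneg_def unit_def dest: spec[of _ s])
qed

lemma step_cancel:
  assumes "st \<in> D \<times> carrier H" "s \<in> S"
  shows "step (s, \<not> e) (step (s, e) st) = st"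
proof -
  obtain w g where st: "st = (w, g)" "w \<in> D" "g \<in> carrier H" using assms by auto
  show ?thesis
  proof (cases "hit w s")
    case True
    then obtain x where x: "x \<in> X" "w (unit s) = unit x" by (auto simp: hit_def)
    have "g \<otimes>\<^bsub>H\<^esub> val (x, e) \<otimes>\<^bsub>H\<^esub> val (x, \<not> e) = g"
      using st h_closed[OF x(1)] by (auto simp: val_def H.m_assoc)
    then show ?thesis using x st by (simp add: step_hit)
  next
    case False
    then show ?thesis using no_hit_back[OF st(2) assms(2)] st comp_refl_refl[OF assms(2)] by (simp add: step_no_hit)
  qed
qed

lemma step_involution:
  assumes "st \<in> D \<times> carrier H" "s \<in> S" "\<And>x. x \<in> X \<Longrightarrow> h x \<otimes>\<^bsub>H\<^esub> h x = \<one>\<^bsub>H\<^esub>"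
  shows "step (s, True) (step (s, True) st) = st"
proof -
  obtain w g where st: "st = (w, g)" "w \<in> D" "g \<in> carrier H" using assms by auto
  show ?thesis
  proof (cases "hit w s")
    case True
    then obtain x where x: "x \<in> X" "w (unit s) = unit x" by (auto simp: hit_def)
    then show ?thesis using st h_closed[OF x(1)] assms(3) by (auto simp: step_hit val_def H.m_assoc)
  next
    case False
    then show ?thesis using no_hit_back[OF st(2) assms(2)] st comp_refl_refl[OF assms(2)] by (simp add: step_no_hit)
  qed
qed

section \<open>Walks on cosets and the braid relation\<close>

definition run :: "'v list \<Rightarrow> 'v operator \<times> 'h \<Rightarrow> 'v operator \<times> 'h" where
  "run us = fold step (map (\<lambda>s. (s, True)) us)"

lemma run_simps [simp]: "run [] st = st" "run (s # us) st = run us (step (s, True) st)"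
  by (simp_all add: run_def)

lemma run_append: "run (us @ vs) st = run vs (run us st)"
  by (simp add: run_def)

lemma run_no_hit:
  assumes "\<And>ws c. ws \<in> lists A \<Longrightarrow> c \<in> A \<Longrightarrow> \<not> hit (v \<circ> act ws) c" "us \<in> lists A"
  shows "ws \<in> lists A \<Longrightarrow> run us (v \<circ> act ws, g) = (v \<circ> act (ws @ us), g)"
  using assms(2)
proof (induction us arbitrary: ws)
  case (Cons c us)
  have "run (c # us) (v \<circ> act ws, g) = run us (v \<circ> act ws \<circ> refl c, g)"
    using step_no_hit[OF assms(1)[OF Cons.prems(1) Cons.hyps(1)]] by (simp only: run_simps)
  also have "v \<circ> act ws \<circ> refl c = v \<circ> act (ws @ [c])" by (simp add: act_append comp_assoc)
  also have "run us (v \<circ> act (ws @ [c]), g) = (v \<circ> act ((ws @ [c]) @ us), g)"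
    using Cons.hyps Cons.prems by (intro Cons.IH) simp
  finally show ?case by (simp add: comp_def)
qed simp

lemma run_two_hits:
  assumes "x \<in> X" "y \<in> X" "g \<in> carrier H" "w (unit a) = unit x" "w (unit b) = unit y"
  shows "run (alt a b k) (w, g) = (w, g \<otimes>\<^bsub>H\<^esub> word_prod H (map h (alt x y k)))"
  using assms
proof (induction k arbitrary: a b x y g)
  case (Suc k)
  have "set (map h (alt y x k)) \<subseteq> carrier H" using set_alt[of y x k] Suc.prems h_closed by auto
  then show ?case using Suc.prems Suc.IH[of y x "g \<otimes>\<^bsub>H\<^esub> h x" b a] h_closed
    by (auto simp: step_hit val_def H.m_assoc)
qed simp

text \<open>If \<open>v\<close> is shortest in its coset of the dihedral group and exactly the generator \<open>a\<close> fixes the coset of \<open>v\<close>,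
  then the orbit of \<open>v\<close> is a path with \<open>m a b\<close> vertices which is reflected at both ends. A walk of
  length \<open>m a b\<close> is reflected exactly once and ends at the opposite vertex, whichever direction it takes first.\<close>

lemma run_one_hit:
  assumes v: "v \<in> W" "nonneg (v (unit a))" "nonneg (v (unit b))" "g \<in> carrier H"
    and ab: "a \<in> S" "b \<in> S" "a \<noteq> b" "m a b \<noteq> 0" and x: "x \<in> X" "v (unit a) = unit x"
    and b: "\<not> hit v b" and k: "k < m a b"
  shows "run (alt a b (m a b)) (v \<circ> act (alt b a k), g) = run (alt b a (m a b)) (v \<circ> act (alt b a k), g)"
proof -
  define M where "M = m a b"
  have M: "M \<ge> 2" using ab(4) m_ne_1[of a b] unfolding M_def by linarith
  \<comment> \<open>The letter that joins position j of the path to position j + 1, in both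
    directions.\<close>
  define l where "l j = (if even j then b else a)" for j :: nat
  define pos where "pos j = v \<circ> act (alt b a j)" for j
  have l2: "l (Suc (Suc j)) = l j" for j by (simp add: l_def)
  have pos_Suc: "pos (Suc j) = pos j \<circ> refl (l j)" for j
    unfolding pos_def l_def alt_snoc by (simp add: act_append comp_assoc)
  have lS: "l j \<in> S" for j using ab by (simp add: l_def)
  have lists: "alt b a j \<in> lists {a, b}" for j using set_alt[of b a j] by auto
  \<comment> \<open>By \<open>plane_root_unit\<close> a hit on the path comes from the root of a or
    of b in the plane, and v rules out b.\<close>
  have hit_iff: "hit (pos j) c \<longleftrightarrow> act (alt b a j) (unit c) = unit a" if c: "c \<in> {a, b}" for j c
  proof
    assume "hit (pos j) c"
    then obtain y where y: "y \<in> X" "v (act (alt b a j) (unit c)) = unit y" by (auto simp: hit_def pos_def)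
    have "act (alt b a j) (unit c) = unit a \<or> v (unit b) = unit y"
      using plane_root_unit[OF v(1-3) ab(1-3) lists c _ y(2)] y(1) X_S by blast
    then show "act (alt b a j) (unit c) = unit a" using b y(1) by (auto simp: hit_def)
  next
    assume "act (alt b a j) (unit c) = unit a"
    then show "hit (pos j) c" using x by (auto simp: hit_def pos_def)
  qed
  let ?c = "cheb (- 2 * gram a b)"
  have fwd: "act (alt b a j) (unit (l j)) = lincomb (?c j) (unit a) (?c (Suc j)) (unit b)" for j
    using act_rev_alt[of a b j] act_rev_alt[of b a j] ab gram_sym[of b a] rev_alt[of b a j] rev_alt[of a b j]
    by (cases "even j") (auto simp: l_def lincomb_def add.commute simp del: cheb.simps)
  have c: "?c M = 0" "?c (M - 1) = 1" "\<And>j. 0 < j \<Longrightarrow> j < M \<Longrightarrow> ?c j > 0" "\<And>j. j \<le> M \<Longrightarrow> ?c j \<ge> 0"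
    unfolding gram_cheb[OF ab(3)] using ab(4) M cheb_cos_pi[of M] cheb_cos_pi_pos[of _ M] by (auto simp: M_def)
  have fwd_no_hit: "\<not> hit (pos j) (l j)" if "Suc j < M" for j
  proof
    assume "hit (pos j) (l j)"
    then have "lincomb (?c j) (unit a) (?c (Suc j)) (unit b) b = unit a b"
      using hit_iff[of "l j" j] fwd[of j] by (simp add: l_def split: if_splits)
    then show False using c(3)[of "Suc j"] that ab by (simp add: lincomb_def unit_def)
  qed
  have fwd_hit: "pos (M - 1) (unit (l (M - 1))) = unit x"
  proof -
    have "act (alt b a (M - 1)) (unit (l (M - 1))) = unit a"
      using fwd[of "M - 1"] c(1,2) M by (simp add: lincomb_def)
    then show ?thesis using x by (simp add: pos_def)
  qed
  have bwd_no_hit: "\<not> hit (pos (Suc j)) (l j)" if "j < M" for j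
  proof
    assume "hit (pos (Suc j)) (l j)"
    then have *: "act (alt b a (Suc j)) (unit (l j)) = unit a" using hit_iff[of "l j" "Suc j"] by (auto simp: l_def)
    have "act (alt b a (Suc j)) (unit (l j)) = act (alt b a j) (\<lambda>t. - unit (l j) t)"
      using lS[of j] unfolding alt_snoc by (simp add: act_append refl_unit flip: l_def)
    also have "\<dots> = (\<lambda>t. - lincomb (?c j) (unit a) (?c (Suc j)) (unit b) t)" by (simp add: act_uminus fwd)
    finally have "- lincomb (?c j) (unit a) (?c (Suc j)) (unit b) a = unit a a" using * by metis
    then show False using c(4)[of j] that ab by (simp add: lincomb_def unit_def)
  qed
  have forward: "run (alt (l j) (l (Suc j)) i) (pos j, g') = (pos (j + i), g')" if "j + i < M" for i j g'
    using that
  proof (induction i arbitrary: j)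
    case (Suc i)
    then show ?case using Suc.IH[of "Suc j"] fwd_no_hit[of j] by (simp add: step_no_hit l2 flip: pos_Suc)
  qed simp
  have backward: "run (alt (l (Suc j)) (l j) i) (pos j, g') = (pos (j - i), g')" if "i \<le> j" "j < M" for i j g'
    using that
  proof (induction i arbitrary: j)
    case (Suc i)
    then obtain j' where j: "j = Suc j'" by (cases j) auto
    have "pos (Suc j') \<circ> refl (l j') = pos j'" unfolding pos_Suc by (rule comp_refl_refl[OF lS])
    then show ?case using Suc bwd_no_hit[of j'] by (simp add: j step_no_hit l2)
  qed simp
  have split: "alt (l j) (l (Suc j)) (i + n) = alt (l j) (l (Suc j)) i @ alt (l (j + i)) (l (Suc (j + i))) n" for j i n
  proof (induction i arbitrary: j)
    case (Suc i)
    then show ?case using Suc[of "Suc j"] by (simp add: l2)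
  qed simp
  \<comment> \<open>\<open>M - 1 - k\<close> steps forward, one reflection at the far end, k steps
    back.\<close>
  have "run (alt (l k) (l (Suc k)) M) (pos k, g) = (pos (M - 1 - k), g \<otimes>\<^bsub>H\<^esub> h x)"
  proof -
    have "alt (l k) (l (Suc k)) M = alt (l k) (l (Suc k)) (M - 1 - k) @ alt (l (M - 1)) (l M) (Suc k)"
      using split[of k "M - 1 - k" "Suc k"] k M by (simp add: M_def)
    then have "run (alt (l k) (l (Suc k)) M) (pos k, g) = run (alt (l (Suc (M - 1))) (l (M - 1)) k) (step (l (M - 1), True) (pos (M - 1), g))"
      using forward[of k "M - 1 - k" g] k M by (simp add: run_append M_def)
    also have "step (l (M - 1), True) (pos (M - 1), g) = (pos (M - 1), g \<otimes>\<^bsub>H\<^esub> h x)"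
      using step_hit[where w = "pos (M - 1)" and s = "l (M - 1)", OF x(1) fwd_hit] by (simp add: val_def)
    finally show ?thesis using backward[of k "M - 1"] k M by (simp add: M_def)
  qed
  \<comment> \<open>k steps back, one reflection at the start, \<open>M - 1 - k\<close> steps
    forward: the same end point and the same recorded letter.\<close>
  moreover have "run (alt (l (Suc k)) (l k) M) (pos k, g) = (pos (M - 1 - k), g \<otimes>\<^bsub>H\<^esub> h x)"
  proof -
    have "l (Suc k + k) = a" "l (Suc (Suc k + k)) = b" by (simp_all add: l_def)
    then have "alt (l (Suc k)) (l k) M = alt (l (Suc k)) (l k) k @ alt a b (Suc (M - 1 - k))"
      using split[of "Suc k" k "Suc (M - 1 - k)"] k M l2[of k] by (simp add: M_def)
    moreover have "pos 0 (unit a) = unit x" using x by (simp add: pos_def)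
    ultimately have "run (alt (l (Suc k)) (l k) M) (pos k, g) = run (alt (l 0) (l (Suc 0)) (M - 1 - k)) (pos 0, g \<otimes>\<^bsub>H\<^esub> h x)"
      using backward[of k k g] k M step_hit[where w = "pos 0" and s = a, OF x(1)] by (simp add: run_append M_def val_def l_def)
    then show ?thesis using forward[of 0 "M - 1 - k"] M by simp
  qed
  ultimately show ?thesis unfolding M_def[symmetric] pos_def[symmetric] l_def by (cases "even k") simp_all
qed

text \<open>The shape of the dihedral orbit of cosets depends on how many of a and b fix the coset
  of v. If both do, the orbit is a point and the claim is a braid relation in H; if neither does,
  nothing is ever recorded and it is the braid relation of the operators; if one does, the orbit is
  the path of \<open>run_one_hit\<close>.\<close>

lemma run_braid:
  assumes w: "w \<in> D" "g \<in> carrier H" and ab: "a \<in> S" "b \<in> S" "a \<noteq> b" "m a b \<noteq> 0"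
  shows "run (alt a b (m a b)) (w, g) = run (alt b a (m a b)) (w, g)"
proof -
  obtain v z z' k where v: "v \<in> W" "{z, z'} = {a, b}" "k \<le> m a b" "w = v \<circ> act (alt z z' k)"
    "nonneg (v (unit a))" "nonneg (v (unit b))"
    using dihedral_coset[OF D_W[OF w(1)] ab] .
  \<comment> \<open>A word that leaves v through a letter fixing its coset would make the inverse
    image of \<open>unit y\<close> under w negative, but w is in D.\<close>
  have first_no_hit: False
    if c: "{c, c'} = {a, b}" "w = v \<circ> act (alt c c' (Suc j))" "Suc j \<le> m a b" and y: "y \<in> X" "v (unit c) = unit y" for c c' j y
  proof -
    have cS: "c \<in> S" "c' \<in> S" "c \<noteq> c'" "m c c' = m a b" using c(1) ab m_sym[of a b] by (auto simp: doubleton_eq_iff)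
    have lists: "alt p q i \<in> lists S" if "{p, q} \<subseteq> S" for p q i using set_alt[of p q i] that by auto
    have "winv w (unit y) = act (rev (alt c c' (Suc j))) (winv v (unit y))"
      using winv_comp[OF v(1) lists[of c c' "Suc j"]] c(2) cS by (simp del: alt.simps)
    also have "winv v (unit y) = unit c" using winv_eq_iff[OF v(1)] y by metis
    also have "act (rev (alt c c' (Suc j))) (unit c) = (\<lambda>t. - act (rev (alt c' c j)) (unit c) t)"
      using cS by (simp add: act_append refl_unit act_uminus)
    finally have neg: "winv w (unit y) = (\<lambda>t. - act (rev (alt c' c j)) (unit c) t)" .
    have "nonneg (act (rev (alt c' c j)) (unit c))"
      unfolding act_rev_alt[OF cS(1,2)]
      using cheb_gram_nonneg[OF cS(3), of j] cheb_gram_nonneg[OF cS(3), of "Suc j"] cS c(3)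
      by (auto intro!: nonneg_lincomb nonneg_unit simp del: cheb.simps)
    moreover have "nonneg (winv w (unit y))" using w(1) y(1) by (auto simp: D_def)
    ultimately show False
      using root_nonneg_unique[OF winv_mem[OF D_W[OF w(1)]], of y] y(1) X_S unfolding neg by auto
  qed
  have m_pos: "Suc (m a b - 1) = m a b" using ab(4) by simp
  have z: "z \<in> S" "z' \<in> S" "z \<noteq> z'" "m z z' = m a b" using v(2) ab m_sym[of a b] by (auto simp: doubleton_eq_iff)
  have z_no_hit: "k = 0 \<or> \<not> hit v z"
  proof (cases k)
    case (Suc j)
    then show ?thesis using first_no_hit[of z z' j] v(2-4) by (auto simp: hit_def)
  qed simp
  \<comment> \<open>At full length both alternating words reach w, so z' can be taken as the first
    letter as well.\<close>
  have z'_no_hit: "k < m a b \<or> \<not> hit v z'"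
  proof (cases "k = m a b")
    case True
    then have "w = v \<circ> act (alt z' z (Suc (m a b - 1)))" unfolding m_pos using act_braid[of z z'] z ab(4) v(4) by simp
    then show ?thesis using first_no_hit[of z' z "m a b - 1"] v(2) m_pos by (auto simp: hit_def insert_commute)
  qed (use v(3) in simp)
  have one_hit: "run (alt c c' (m a b)) (w, g) = run (alt c' c (m a b)) (w, g)"
    if c: "{c, c'} = {a, b}" and hits: "hit v c" "\<not> hit v c'" for c c'
  proof -
    have cS: "c \<in> S" "c' \<in> S" "c \<noteq> c'" "m c c' = m a b" using c ab m_sym[of a b] by (auto simp: doubleton_eq_iff)
    have "nonneg (v (unit c))" "nonneg (v (unit c'))" using c v by (auto simp: doubleton_eq_iff)
    moreover have "w = v \<circ> act (alt c' c k) \<and> k < m a b"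
    proof (cases "k = 0")
      case False
      then have "z = c'" "z' = c" using z_no_hit hits v(2) c by (auto simp: doubleton_eq_iff)
      then show ?thesis using v(4) z'_no_hit hits by auto
    qed (use v(4) ab in simp)
    moreover obtain x where "x \<in> X" "v (unit c) = unit x" using hits by (auto simp: hit_def)
    ultimately show ?thesis using run_one_hit[of v c c' g x k] v(1) w(2) cS ab(4) hits(2) by simp
  qed
  consider "hit v a" "hit v b" | "hit v a" "\<not> hit v b" | "hit v b" "\<not> hit v a" | "\<not> hit v a" "\<not> hit v b" by blast
  then show ?thesis
  proof cases
    case 1
    then have "hit v z" using v(2) by auto
    then have k: "k = 0" using z_no_hit by blast
    obtain x y where xy: "x \<in> X" "y \<in> X" "v (unit a) = unit x" "v (unit b) = unit y" using 1 by (auto simp: hit_def)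
    have "unit a \<noteq> unit b" using ab by simp
    then have "v (unit a) \<noteq> v (unit b)" using bij_W[OF v(1)] by (metis bij_def injD)
    then have "x \<noteq> y" using xy by auto
    \<comment> \<open>Since v preserves the form, the pairs a, b and x, y carry the same label, as
      \<open>h_braid\<close> demands.\<close>
    have "gram a b = gram x y"
      using form_W[OF v(1), of "unit a" "unit b"] xy ab X_S by (simp add: form_unit_unit subset_iff)
    then have mxy: "m a b = m x y" using gram_inject ab(3) \<open>x \<noteq> y\<close> by blast
    have "word_prod H (map h (alt x y (m x y))) = word_prod H (map h (alt y x (m x y)))"
      by (rule h_braid) (use xy \<open>x \<noteq> y\<close> mxy ab in auto)
    then show ?thesis
      using run_two_hits[OF xy(1,2) w(2) xy(3,4)] run_two_hits[OF xy(2,1) w(2) xy(4,3)] v(4) k mxy by simp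
  next
    case 2
    then show ?thesis using one_hit[of a b] by simp
  next
    case 3
    then show ?thesis using one_hit[of b a] by (simp add: insert_commute)
  next
    case 4
    have no_hit: "\<not> hit (v \<circ> act ws) c" if "ws \<in> lists {a, b}" "c \<in> {a, b}" for ws c
    proof
      assume "hit (v \<circ> act ws) c"
      then obtain y where y: "y \<in> X" "v (act ws (unit c)) = unit y" by (auto simp: hit_def)
      then have "v (unit a) = unit y \<or> v (unit b) = unit y"
        using plane_root_unit[OF v(1,5,6) ab(1-3) that _ y(2)] X_S by blast
      then show False using 4 y(1) by (auto simp: hit_def)
    qed
    have lists: "alt z z' k \<in> lists {a, b}" "alt a b (m a b) \<in> lists {a, b}" "alt b a (m a b) \<in> lists {a, b}"
      using set_alt v(2) by fastforce+
    show ?thesis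
      using run_no_hit[OF no_hit lists(2,1)] run_no_hit[OF no_hit lists(3,1)] act_braid[OF ab] v(4)
      by (simp add: act_append)
  qed
qed

lemma fold_step_pres_eq:
  assumes "pres_eq S R u v"
    and R: "\<And>u v st. (u, v) \<in> R \<Longrightarrow> u \<in> words S \<Longrightarrow> v \<in> words S \<Longrightarrow>
      st \<in> D \<times> carrier H \<Longrightarrow> fold step u st = fold step v st"
  shows "st \<in> D \<times> carrier H \<Longrightarrow> fold step u st = fold step v st"
  by (rule fold_pres_eq[OF step_closed step_cancel R assms(1)])

text \<open>At the identity every letter of X is a hit and is recorded as itself: on words over X
  the record is the word, which makes the map a retraction.\<close>

lemma fold_step_X:
  "u \<in> words X \<Longrightarrow> g \<in> carrier H \<Longrightarrow> fold step u (id, g) = (id, g \<otimes>\<^bsub>H\<^esub> word_prod H (map val u))"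
proof (induction u arbitrary: g)
  case (Cons l u)
  obtain x e where l: "l = (x, e)" "x \<in> X" using Cons by auto
  have "set (map val u) \<subseteq> carrier H" using Cons.prems val_closed by auto
  then show ?case using Cons l val_closed[of x e] by (simp add: step_hit H.m_assoc)
qed simp

text \<open>Each letter leaves at most one letter in the record. This bound on lengths yields an
  isometric embedding, beyond mere injectivity.\<close>

lemma fold_step_word:
  assumes "u \<in> words S" "w \<in> D" "g \<in> carrier H"
  shows "\<exists>u'\<in>words X. length u' \<le> length u \<and> snd (fold step u (w, g)) = g \<otimes>\<^bsub>H\<^esub> word_prod H (map val u')"
  using assms
proof (induction u arbitrary: w g)
  case Nil
  show ?case using Nil by (intro bexI[of _ "[]"]) auto
next
  case (Cons l u)
  obtain s e where l: "l = (s, e)" "s \<in> S" using Cons by auto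
  show ?case
  proof (cases "hit w s")
    case True
    then obtain x where x: "x \<in> X" "w (unit s) = unit x" by (auto simp: hit_def)
    have "g \<otimes>\<^bsub>H\<^esub> val (x, e) \<in> carrier H" using val_closed x Cons by simp
    then obtain u' where u': "u' \<in> words X" "length u' \<le> length u"
      "snd (fold step u (w, g \<otimes>\<^bsub>H\<^esub> val (x, e))) = g \<otimes>\<^bsub>H\<^esub> val (x, e) \<otimes>\<^bsub>H\<^esub> word_prod H (map val u')"
      using Cons.IH[OF Cons.prems(1)] by blast
    have "set (map val u') \<subseteq> carrier H" using u' val_closed by auto
    then show ?thesis using u' x l Cons.prems val_closed[of x e]
      by (intro bexI[of _ "(x, e) # u'"]) (auto simp: step_hit H.m_assoc)
  next
    case False
    then obtain u' where "u' \<in> words X" "length u' \<le> length u"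
      "snd (fold step u (w \<circ> refl s, g)) = g \<otimes>\<^bsub>H\<^esub> word_prod H (map val u')"
      using Cons.IH[OF D_refl[OF Cons.prems(1) l(2)] Cons.prems(2)] by blast
    then show ?thesis using False l by (intro bexI[of _ u']) (auto simp: step_no_hit)
  qed
qed

end

section \<open>Artin and Coxeter groups\<close>

definition graph_relations :: "bool \<Rightarrow> 'v labeled_graph \<Rightarrow> ('v word \<times> 'v word) set" where
  "graph_relations c \<Gamma> =
     (if c then {([(a, True), (a, True)], []) | a. a \<in> verts \<Gamma>} else {}) \<union> braid_relations \<Gamma>"

definition graph_group :: "bool \<Rightarrow> 'v labeled_graph \<Rightarrow> 'v word set monoid" where
  "graph_group c \<Gamma> = presented_group (verts \<Gamma>) (graph_relations c \<Gamma>)"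

abbreviation graph_dist :: "bool \<Rightarrow> 'v labeled_graph \<Rightarrow> 'v word set \<Rightarrow> 'v word set \<Rightarrow> real" where
  "graph_dist c \<Gamma> \<equiv> pres_dist (verts \<Gamma>) (graph_relations c \<Gamma>)"

abbreviation subgraph_image :: "bool \<Rightarrow> 'v labeled_graph \<Rightarrow> 'v set \<Rightarrow> 'v word set set" where
  "subgraph_image c \<Gamma> \<equiv> word_image (verts \<Gamma>) (graph_relations c \<Gamma>)"

lemma artin_group_eq: "artin_group \<Gamma> = graph_group False \<Gamma>"
  by (simp add: artin_group_def graph_group_def graph_relations_def)

lemma coxeter_group_eq: "coxeter_group \<Gamma> = graph_group True \<Gamma>"
  by (simp add: coxeter_group_def graph_group_def graph_relations_def)

lemma graph_relations_cases:
  assumes "(u, v) \<in> graph_relations c \<Gamma>"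
  obtains (square) a where "c" "a \<in> verts \<Gamma>" "u = [(a, True), (a, True)]" "v = []"
    | (braid) a b where "{a, b} \<in> edges \<Gamma>" "u = alternating a b (label \<Gamma> {a, b})" "v = alternating b a (label \<Gamma> {a, b})"
  using assms by (auto simp: graph_relations_def braid_relations_def split: if_splits)

lemma edge_ends:
  assumes "finite_simplicial_labeled_graph \<Gamma>" "{a, b} \<in> edges \<Gamma>"
  shows "a \<noteq> b" "a \<in> verts \<Gamma>" "b \<in> verts \<Gamma>" "label \<Gamma> {a, b} > 1"
proof -
  have e: "{a, b} \<subseteq> verts \<Gamma>" "card {a, b} = 2" "label \<Gamma> {a, b} > 1"
    using assms unfolding finite_simplicial_labeled_graph_def by blast+
  show "a \<noteq> b" using e(2) by auto
  show "a \<in> verts \<Gamma>" "b \<in> verts \<Gamma>" "label \<Gamma> {a, b} > 1" using e by auto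
qed

section \<open>Graph embeddings and isometric subgroups\<close>

definition map_word :: "('u \<Rightarrow> 'v) \<Rightarrow> 'u word \<Rightarrow> 'v word" where
  "map_word f = map (\<lambda>(a, e). (f a, e))"

lemma map_word_simps [simp]:
  "map_word f [] = []" "map_word f (u @ v) = map_word f u @ map_word f v" "length (map_word f u) = length u"
  by (simp_all add: map_word_def)

lemma map_word_lists: "u \<in> words A \<Longrightarrow> map_word f u \<in> words (f ` A)"
  by (induction u) (auto simp: map_word_def)

lemma map_word_inv_word: "map_word f (inv_word u) = inv_word (map_word f u)"
  by (auto simp: map_word_def inv_word_def rev_map)

lemma map_alt: "map f (alt a b k) = alt (f a) (f b) k"
  by (induction k arbitrary: a b) auto

lemma map_word_alternating: "map_word f (alternating a b k) = alternating (f a) (f b) k"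
  by (induction k arbitrary: a b) (auto simp: map_word_def)

lemma alternating_lists: "a \<in> A \<Longrightarrow> b \<in> A \<Longrightarrow> alternating a b k \<in> words A"
  by (induction k arbitrary: a b) auto

lemma lists_image_cases:
  assumes "u \<in> words (f ` A)"
  obtains v where "v \<in> words A" "u = map_word f v"
proof -
  have "\<exists>v\<in>words A. u = map_word f v" using assms
  proof (induction u)
    case Nil
    show ?case by (intro bexI[of _ "[]"]) auto
  next
    case (Cons l u)
    then obtain v a e where "v \<in> words A" "u = map_word f v" "a \<in> A" "l = (f a, e)" by auto
    then show ?case by (intro bexI[of _ "(a, e) # v"]) (auto simp: map_word_def)
  qed
  then show ?thesis using that by blast
qed

text \<open>The source may have another vertex type: the identity will give induced subgraphs, and
  an enumeration the passage to graphs on natural numbers.\<close>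

definition full_embedding :: "('u \<Rightarrow> 'v) \<Rightarrow> 'u labeled_graph \<Rightarrow> 'v labeled_graph \<Rightarrow> bool" where
  "full_embedding f \<Delta> \<Gamma> \<longleftrightarrow> inj_on f (verts \<Delta>) \<and> f ` verts \<Delta> \<subseteq> verts \<Gamma>
     \<and> (\<forall>a\<in>verts \<Delta>. \<forall>b\<in>verts \<Delta>. {a, b} \<in> edges \<Delta> \<longleftrightarrow> {f a, f b} \<in> edges \<Gamma>)
     \<and> (\<forall>a\<in>verts \<Delta>. \<forall>b\<in>verts \<Delta>. {a, b} \<in> edges \<Delta> \<longrightarrow> label \<Delta> {a, b} = label \<Gamma> {f a, f b})"

context
  fixes f :: "'u \<Rightarrow> 'v" and \<Delta> :: "'u labeled_graph" and \<Gamma> :: "'v labeled_graph" and c :: bool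
  assumes \<Delta>: "finite_simplicial_labeled_graph \<Delta>" and \<Gamma>: "finite_simplicial_labeled_graph \<Gamma>"
    and f: "full_embedding f \<Delta> \<Gamma>"
begin

abbreviation (input) class\<Delta> where "class\<Delta> u \<equiv> pres_class (verts \<Delta>) (graph_relations c \<Delta>) u"
abbreviation (input) class\<Gamma> where "class\<Gamma> u \<equiv> pres_class (verts \<Gamma>) (graph_relations c \<Gamma>) u"

lemma map_word_verts: "u \<in> words (verts \<Delta>) \<Longrightarrow> map_word f u \<in> words (verts \<Gamma>)"
proof -
  have "words (f ` verts \<Delta>) \<subseteq> lists (verts \<Gamma> \<times> (UNIV::bool set))"
    using f by (intro lists_mono) (auto simp: full_embedding_def)
  then show "u \<in> words (verts \<Delta>) \<Longrightarrow> map_word f u \<in> words (verts \<Gamma>)"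
    using map_word_lists by blast
qed

lemma pres_eq_map_word:
  "pres_eq (verts \<Delta>) (graph_relations c \<Delta>) u v \<Longrightarrow>
     pres_eq (verts \<Gamma>) (graph_relations c \<Gamma>) (map_word f u) (map_word f v)"
proof (induction rule: pres_eq.induct)
  case (refl w)
  then show ?case by (intro pres_eq.refl map_word_verts)
next
  case (cancel a e)
  then have "f a \<in> verts \<Gamma>" using f by (auto simp: full_embedding_def)
  then show ?case using pres_eq.cancel[of "f a" "verts \<Gamma>" "graph_relations c \<Gamma>" e] by (simp add: map_word_def)
next
  case (rel u v)
  from rel(1) have "(map_word f u, map_word f v) \<in> graph_relations c \<Gamma>"
  proof (cases rule: graph_relations_cases)
    case (square a)
    then show ?thesis using f by (auto simp: graph_relations_def map_word_def full_embedding_def)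
  next
    case (braid a b)
    have "{f a, f b} \<in> edges \<Gamma>" "label \<Delta> {a, b} = label \<Gamma> {f a, f b}"
      using f braid(1) edge_ends[OF \<Delta> braid(1)] by (auto simp: full_embedding_def)
    then show ?thesis using braid(2,3) by (auto simp: graph_relations_def braid_relations_def map_word_alternating)
  qed
  then show ?case using rel map_word_verts by (blast intro: pres_eq.rel)
qed (auto intro: pres_eq.sym pres_eq.trans pres_eq.append)

lemma class_map_word_eq:
  assumes "u \<in> words (verts \<Delta>)" "v \<in> words (verts \<Delta>)" "class\<Delta> u = class\<Delta> v"
  shows "class\<Gamma> (map_word f u) = class\<Gamma> (map_word f v)"
  using assms pres_eq_map_word map_word_verts by (simp add: pres_class_eq_iff)

text \<open>A missing edge becomes 0, the code for \<infinity> in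
  \<open>coxeter_matrix\<close>.\<close>

definition edge_label :: "'v \<Rightarrow> 'v \<Rightarrow> nat" where
  "edge_label s t = (if {s, t} \<in> edges \<Gamma> then label \<Gamma> {s, t} else 0)"

definition gen :: "'v \<Rightarrow> 'u word set" where
  "gen x = class\<Delta> [(inv_into (verts \<Delta>) f x, True)]"

lemma gen_f: "a \<in> verts \<Delta> \<Longrightarrow> gen (f a) = class\<Delta> [(a, True)]"
  using f by (simp add: gen_def full_embedding_def)

lemma coxeter_retraction_graph:
  "coxeter_retraction (verts \<Gamma>) edge_label (graph_group c \<Delta>) (f ` verts \<Delta>) gen"
proof (intro coxeter_retraction.intro coxeter_matrix.intro coxeter_retraction_axioms.intro)
  show "finite (verts \<Gamma>)" using \<Gamma> by (simp add: finite_simplicial_labeled_graph_def)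
  show "edge_label s t = edge_label t s" for s t by (simp add: edge_label_def insert_commute)
  show "edge_label s t \<noteq> 1" for s t using edge_ends(4)[OF \<Gamma>, of s t] by (auto simp: edge_label_def)
  show "group (graph_group c \<Delta>)" unfolding graph_group_def by (rule group_presented_group)
  show "f ` verts \<Delta> \<subseteq> verts \<Gamma>" using f by (simp add: full_embedding_def)
  show "gen x \<in> carrier (graph_group c \<Delta>)" if x: "x \<in> f ` verts \<Delta>" for x
  proof -
    obtain a where "a \<in> verts \<Delta>" "x = f a" using x by blast
    moreover from this have "[(a, True)] \<in> words (verts \<Delta>)" by simp
    ultimately show ?thesis unfolding graph_group_def using gen_f pres_class_closed by metis
  qed
  fix x y assume "x \<in> f ` verts \<Delta>" "y \<in> f ` verts \<Delta>" "x \<noteq> y" "edge_label x y \<noteq> 0"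
  then obtain a b where ab: "a \<in> verts \<Delta>" "b \<in> verts \<Delta>" "x = f a" "y = f b" "{f a, f b} \<in> edges \<Gamma>"
    by (auto simp: edge_label_def split: if_splits)
  then have edge: "{a, b} \<in> edges \<Delta>" "edge_label x y = label \<Delta> {a, b}"
    using f by (auto simp: full_embedding_def edge_label_def)
  have prod: "word_prod (graph_group c \<Delta>) (map gen (alt (f a') (f b') k)) = class\<Delta> (alternating a' b' k)"
    if "a' \<in> verts \<Delta>" "b' \<in> verts \<Delta>" for a' b' k
  proof -
    have "map gen (alt (f a') (f b') k) = map (\<lambda>l. class\<Delta> [l]) (alternating a' b' k)"
      by (simp add: map_alt alternating_conv_alt gen_f that)
    then show ?thesis
      unfolding graph_group_def using word_prod_pres_class[OF alternating_lists[OF that]] by simp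
  qed
  have "(alternating a b (label \<Delta> {a, b}), alternating b a (label \<Delta> {a, b})) \<in> graph_relations c \<Delta>"
    using edge(1) by (auto simp: graph_relations_def braid_relations_def)
  then have "class\<Delta> (alternating a b (label \<Delta> {a, b})) = class\<Delta> (alternating b a (label \<Delta> {a, b}))"
    using ab by (simp add: pres_class_eq_iff alternating_lists pres_eq.rel)
  then show "word_prod (graph_group c \<Delta>) (map gen (alt x y (edge_label x y))) =
      word_prod (graph_group c \<Delta>) (map gen (alt y x (edge_label x y)))"
    using ab edge prod by simp
qed

interpretation ret: coxeter_retraction "verts \<Gamma>" edge_label "graph_group c \<Delta>" "f ` verts \<Delta>" gen
  by (rule coxeter_retraction_graph)

lemma val_f: "a \<in> verts \<Delta> \<Longrightarrow> ret.val (f a, e) = class\<Delta> [(a, e)]"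
  using inv_pres_class[of "[(a, True)]" "verts \<Delta>" "graph_relations c \<Delta>"]
  by (simp add: ret.val_def gen_f inv_word_def flip: graph_group_def)

lemma word_prod_val:
  assumes "u \<in> words (verts \<Delta>)"
  shows "word_prod (graph_group c \<Delta>) (map ret.val (map_word f u)) = class\<Delta> u"
proof -
  have "map ret.val (map_word f u) = map (\<lambda>l. class\<Delta> [l]) u"
    using assms val_f by (auto simp: map_word_def)
  then show ?thesis unfolding graph_group_def using word_prod_pres_class[OF assms] by simp
qed

lemma fold_step_graph:
  assumes "pres_eq (verts \<Gamma>) (graph_relations c \<Gamma>) u v" "st \<in> ret.D \<times> carrier (graph_group c \<Delta>)"
  shows "fold ret.step u st = fold ret.step v st"
proof (rule ret.fold_step_pres_eq[OF assms(1) _ assms(2)])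
  fix u v st assume uv: "(u, v) \<in> graph_relations c \<Gamma>" and st: "st \<in> ret.D \<times> carrier (graph_group c \<Delta>)"
  from uv show "fold ret.step u st = fold ret.step v st"
  proof (cases rule: graph_relations_cases)
    case (square a)
    have "gen x \<otimes>\<^bsub>graph_group c \<Delta>\<^esub> gen x = \<one>\<^bsub>graph_group c \<Delta>\<^esub>" if x: "x \<in> f ` verts \<Delta>" for x
    proof -
      obtain b where b: "b \<in> verts \<Delta>" "x = f b" using x by blast
      have "([(b, True), (b, True)], []) \<in> graph_relations c \<Delta>" using b square(1) by (simp add: graph_relations_def)
      then have "class\<Delta> [(b, True), (b, True)] = class\<Delta> []" using b by (simp add: pres_class_eq_iff pres_eq.rel)
      then show ?thesis using b mult_presented_group[of "[(b, True)]" "verts \<Delta>" "[(b, True)]" "graph_relations c \<Delta>"]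
        by (simp add: gen_f graph_group_def one_presented_group)
    qed
    then show ?thesis using ret.step_involution[OF st square(2)] square by simp
  next
    case (braid a b)
    obtain w g where "st = (w, g)" "w \<in> ret.D" "g \<in> carrier (graph_group c \<Delta>)" using st by auto
    moreover have "edge_label a b = label \<Gamma> {a, b}" using braid by (simp add: edge_label_def)
    ultimately show ?thesis
      using ret.run_braid[of w g a b] edge_ends[OF \<Gamma> braid(1)] braid
      by (simp add: ret.run_def alternating_conv_alt)
  qed
qed

text \<open>A shortest word of the small group maps forward. Conversely, reading a shortest word of
  the large group through the retraction gives a record with no more letters that represents the
  same element.\<close>

lemma word_length_map_word:
  assumes u: "u \<in> words (verts \<Delta>)"
  shows "word_length (graph_group c \<Gamma>) (pres_gens (verts \<Gamma>) (graph_relations c \<Gamma>)) (class\<Gamma> (map_word f u))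
    = word_length (graph_group c \<Delta>) (pres_gens (verts \<Delta>) (graph_relations c \<Delta>)) (class\<Delta> u)" (is "?l\<Gamma> = ?l\<Delta>")
proof (rule antisym)
  note fu = map_word_verts[OF u]
  obtain v where v: "v \<in> words (verts \<Delta>)" "class\<Delta> u = class\<Delta> v" "length v = ?l\<Delta>"
    using pres_word_length_word[OF pres_class_closed[OF u]] unfolding graph_group_def by metis
  have "class\<Gamma> (map_word f u) = class\<Gamma> (map_word f v)" using class_map_word_eq u v by blast
  then show "?l\<Gamma> \<le> ?l\<Delta>"
    using pres_word_length_le[OF map_word_verts[OF v(1)], of "graph_relations c \<Gamma>"] v(3)
    by (simp add: graph_group_def)
  obtain w where w: "w \<in> words (verts \<Gamma>)" "class\<Gamma> (map_word f u) = class\<Gamma> w" "length w = ?l\<Gamma>"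
    using pres_word_length_word[OF pres_class_closed[OF fu]] unfolding graph_group_def by metis
  have eq: "pres_eq (verts \<Gamma>) (graph_relations c \<Gamma>) w (map_word f u)"
    using w fu by (metis pres_class_eq_iff)
  have init: "(id, \<one>\<^bsub>graph_group c \<Delta>\<^esub>) \<in> ret.D \<times> carrier (graph_group c \<Delta>)" using ret.id_D by simp
  have "snd (fold ret.step w (id, \<one>\<^bsub>graph_group c \<Delta>\<^esub>)) = \<one>\<^bsub>graph_group c \<Delta>\<^esub> \<otimes>\<^bsub>graph_group c \<Delta>\<^esub> class\<Delta> u"
    unfolding fold_step_graph[OF eq init] ret.fold_step_X[OF map_word_lists[OF u] ret.H.one_closed]
    by (simp add: word_prod_val[OF u])
  also have "\<dots> = class\<Delta> u"
    using pres_class_closed[OF u, of "graph_relations c \<Delta>"] by (simp flip: graph_group_def)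
  finally obtain w' where w': "w' \<in> words (f ` verts \<Delta>)" "length w' \<le> length w"
    "class\<Delta> u = \<one>\<^bsub>graph_group c \<Delta>\<^esub> \<otimes>\<^bsub>graph_group c \<Delta>\<^esub> word_prod (graph_group c \<Delta>) (map ret.val w')"
    using ret.fold_step_word[OF w(1) ret.id_D ret.H.one_closed] by metis
  obtain v' where v': "v' \<in> words (verts \<Delta>)" "w' = map_word f v'" using w'(1) by (rule lists_image_cases)
  then have "class\<Delta> u = \<one>\<^bsub>graph_group c \<Delta>\<^esub> \<otimes>\<^bsub>graph_group c \<Delta>\<^esub> class\<Delta> v'" using w'(3) word_prod_val by simp
  also have "\<dots> = class\<Delta> v'"
    using pres_class_closed[OF v'(1), of "graph_relations c \<Delta>"] by (simp flip: graph_group_def)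
  finally show "?l\<Delta> \<le> ?l\<Gamma>"
    using pres_word_length_le[OF v'(1), of "graph_relations c \<Delta>"] w'(2) w(3) v'(2)
    by (simp add: graph_group_def)
qed

lemma pres_dist_map_word:
  assumes u: "u \<in> words (verts \<Delta>)" and v: "v \<in> words (verts \<Delta>)"
  shows "graph_dist c \<Gamma> (class\<Gamma> (map_word f u)) (class\<Gamma> (map_word f v))
    = graph_dist c \<Delta> (class\<Delta> u) (class\<Delta> v)"
proof -
  have *: "pres_dist S R (pres_class S R x) (pres_class S R y) =
      word_length (presented_group S R) (pres_gens S R) (pres_class S R (inv_word x @ y))"
    if "x \<in> words S" "y \<in> words S" for S and R :: "('w word \<times> 'w word) set" and x y
    using inv_pres_class[OF that(1), of R] mult_presented_group[OF inv_word_lists[OF that(1)] that(2), of R]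
      pres_class_closed[OF that(1), of R] pres_class_closed[OF that(2), of R]
    by (simp add: pres_dist_def word_dist_def)
  have "inv_word u @ v \<in> words (verts \<Delta>)" using inv_word_lists[OF u] v by simp
  from word_length_map_word[OF this] show ?thesis
    by (simp add: *[OF u v] *[OF map_word_verts[OF u] map_word_verts[OF v]] map_word_inv_word graph_group_def)
qed

text \<open>This carries a bound for the abstract group of \<Delta> over to its image with the
  metric of the large group, as the amalgam theorem needs it.\<close>

theorem unif_colorable_word_image:
  assumes "Metric_space.unif_colorable (graph_dist c \<Delta>) N {carrier (graph_group c \<Delta>)}"
  shows "Metric_space.unif_colorable (graph_dist c \<Gamma>) N
    {subgraph_image c \<Gamma> (f ` verts \<Delta>)}"
proof -
  note M\<Delta> = Metric_space_pres_dist[of "verts \<Delta>" "graph_relations c \<Delta>"]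
  note M\<Gamma> = Metric_space_pres_dist[of "verts \<Gamma>" "graph_relations c \<Gamma>"]
  define \<phi> where "\<phi> g = class\<Gamma> (map_word f (SOME u. u \<in> words (verts \<Delta>) \<and> class\<Delta> u = g))" for g
  have \<phi>: "\<phi> (class\<Delta> u) = class\<Gamma> (map_word f u)" if "u \<in> words (verts \<Delta>)" for u
  proof -
    let ?v = "SOME v. v \<in> words (verts \<Delta>) \<and> class\<Delta> v = class\<Delta> u"
    have "?v \<in> words (verts \<Delta>) \<and> class\<Delta> ?v = class\<Delta> u" by (rule someI[of _ u]) (use that in simp)
    then show ?thesis unfolding \<phi>_def using class_map_word_eq that by blast
  qed
  have carrier: "carrier (graph_group c \<Delta>) = (\<lambda>u. class\<Delta> u) ` words (verts \<Delta>)"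
    unfolding graph_group_def by (rule carrier_presented_group)
  have image: "\<phi> ` carrier (graph_group c \<Delta>) = subgraph_image c \<Gamma> (f ` verts \<Delta>)"
  proof (intro equalityI subsetI)
    fix x assume "x \<in> \<phi> ` carrier (graph_group c \<Delta>)"
    then obtain u where "u \<in> words (verts \<Delta>)" "x = class\<Gamma> (map_word f u)" using \<phi> carrier by auto
    then show "x \<in> subgraph_image c \<Gamma> (f ` verts \<Delta>)"
      unfolding word_image_def using map_word_lists by blast
  next
    fix x assume "x \<in> subgraph_image c \<Gamma> (f ` verts \<Delta>)"
    then obtain w where w: "w \<in> words (f ` verts \<Delta>)" "x = class\<Gamma> w" unfolding word_image_def by blast
    obtain u where u: "u \<in> words (verts \<Delta>)" "w = map_word f u" using w(1) by (rule lists_image_cases)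
    then have "x = \<phi> (class\<Delta> u)" using \<phi> w(2) by simp
    then show "x \<in> \<phi> ` carrier (graph_group c \<Delta>)" using u(1) unfolding carrier by blast
  qed
  have iso: "graph_dist c \<Gamma> (\<phi> x) (\<phi> y) = graph_dist c \<Delta> x y"
    if xy: "x \<in> carrier (graph_group c \<Delta>)" "y \<in> carrier (graph_group c \<Delta>)" for x y
  proof -
    obtain u v where "u \<in> words (verts \<Delta>)" "x = class\<Delta> u" "v \<in> words (verts \<Delta>)" "y = class\<Delta> v"
      using xy unfolding carrier by blast
    then show ?thesis using \<phi> pres_dist_map_word by simp
  qed
  show ?thesis
    unfolding Metric_space.unif_colorable_def[OF M\<Gamma>]
  proof (intro allI impI)
    fix r :: real assume "r > 0"
    then obtain D where "Metric_space.colorable (graph_dist c \<Delta>) N r D (carrier (graph_group c \<Delta>))"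
      using assms unfolding Metric_space.unif_colorable_def[OF M\<Delta>] by blast
    from colorable_isometry[OF M\<Delta> M\<Gamma> iso this]
    show "\<exists>D. \<forall>Y\<in>{subgraph_image c \<Gamma> (f ` verts \<Delta>)}.
        Metric_space.colorable (graph_dist c \<Gamma>) N r D Y"
      unfolding image by blast
  qed
qed

end

section \<open>Cliques and the final induction\<close>

lemma asdim_graph_group_le_iff:
  assumes "finite_simplicial_labeled_graph \<Gamma>"
  shows "asdim_group (graph_group c \<Gamma>) \<le> enat n \<longleftrightarrow>
    Metric_space.unif_colorable (graph_dist c \<Gamma>) (Suc n) {carrier (graph_group c \<Gamma>)}"
proof -
  have "finite (verts \<Gamma>)" using assms by (simp add: finite_simplicial_labeled_graph_def)
  then show ?thesis
    using group.asdim_group_le_iff[OF group_presented_group finite_generating_set_pres_gens]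
      Metric_space.asdim_at_most_iff_unif_colorable[OF Metric_space_pres_dist]
    unfolding graph_group_def pres_dist_def by metis
qed

lemma finite_cliques: "finite (verts \<Gamma>) \<Longrightarrow> finite (card ` {C. clique \<Gamma> C})"
  by (rule finite_imageI, rule finite_subset[of _ "Pow (verts \<Gamma>)"]) (auto simp: clique_def)

lemma card_clique_le_Sim: "finite (verts \<Gamma>) \<Longrightarrow> clique \<Gamma> C \<Longrightarrow> card C \<le> Sim \<Gamma>"
  unfolding Sim_def by (rule Max_ge[OF finite_cliques]) auto

lemma Sim_clique:
  assumes "finite (verts \<Gamma>)" obtains C where "clique \<Gamma> C" "card C = Sim \<Gamma>"
proof -
  have "clique \<Gamma> {}" by (simp add: clique_def)
  then have "Sim \<Gamma> \<in> card ` {C. clique \<Gamma> C}" unfolding Sim_def by (intro Max_in[OF finite_cliques[OF assms]]) auto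
  then show ?thesis using that by auto
qed

definition induced_subgraph :: "'v labeled_graph \<Rightarrow> 'v set \<Rightarrow> 'v labeled_graph" where
  "induced_subgraph \<Gamma> T = \<lparr>verts = T, edges = {e\<in>edges \<Gamma>. e \<subseteq> T}, label = label \<Gamma>\<rparr>"

lemma induced_subgraph_simps [simp]:
  "verts (induced_subgraph \<Gamma> T) = T" "edges (induced_subgraph \<Gamma> T) = {e\<in>edges \<Gamma>. e \<subseteq> T}"
  "label (induced_subgraph \<Gamma> T) = label \<Gamma>"
  by (simp_all add: induced_subgraph_def)

lemma finite_simplicial_induced_subgraph:
  "finite_simplicial_labeled_graph \<Gamma> \<Longrightarrow> T \<subseteq> verts \<Gamma> \<Longrightarrow> finite_simplicial_labeled_graph (induced_subgraph \<Gamma> T)"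
  by (auto simp: finite_simplicial_labeled_graph_def intro: finite_subset)

lemma full_embedding_induced_subgraph: "T \<subseteq> verts \<Gamma> \<Longrightarrow> full_embedding id (induced_subgraph \<Gamma> T) \<Gamma>"
  by (auto simp: full_embedding_def)

lemma clique_induced_subgraph: "T \<subseteq> verts \<Gamma> \<Longrightarrow> clique (induced_subgraph \<Gamma> T) C \<longleftrightarrow> clique \<Gamma> C \<and> C \<subseteq> T"
  by (auto simp: clique_def subset_iff)

lemma Sim_induced_subgraph_le:
  assumes "finite (verts \<Gamma>)" "T \<subseteq> verts \<Gamma>"
  shows "Sim (induced_subgraph \<Gamma> T) \<le> Sim \<Gamma>"
proof -
  have "finite (verts (induced_subgraph \<Gamma> T))" using assms by (auto intro: finite_subset)
  then obtain C where "clique (induced_subgraph \<Gamma> T) C" "card C = Sim (induced_subgraph \<Gamma> T)" by (rule Sim_clique)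
  then show ?thesis using card_clique_le_Sim[OF assms(1), of C] clique_induced_subgraph[OF assms(2)] by auto
qed

text \<open>A largest clique of T can be enlarged by a.\<close>

lemma Sim_link_less:
  assumes "finite (verts \<Gamma>)" "T \<subseteq> verts \<Gamma>" "a \<in> verts \<Gamma>" "a \<notin> T" "\<And>v. v \<in> T \<Longrightarrow> {a, v} \<in> edges \<Gamma>"
  shows "Sim (induced_subgraph \<Gamma> T) < Sim \<Gamma>"
proof -
  have "finite (verts (induced_subgraph \<Gamma> T))" using assms by (auto intro: finite_subset)
  then obtain C where C: "clique (induced_subgraph \<Gamma> T) C" "card C = Sim (induced_subgraph \<Gamma> T)" by (rule Sim_clique)
  then have C': "clique \<Gamma> C" "C \<subseteq> T" using clique_induced_subgraph[OF assms(2)] by auto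
  then have "clique \<Gamma> (insert a C)"
    using assms(3,5) by (auto simp: clique_def insert_commute)
  moreover have "card (insert a C) = Suc (card C)" using C'(2) assms by (intro card_insert_disjoint) (auto intro: finite_subset)
  ultimately show ?thesis using card_clique_le_Sim[OF assms(1)] C(2) by fastforce
qed

lemma Sim_complete:
  assumes "finite (verts \<Gamma>)" "free_of_infinity \<Gamma>" shows "Sim \<Gamma> = card (verts \<Gamma>)"
proof (rule antisym)
  obtain C where "clique \<Gamma> C" "card C = Sim \<Gamma>" using assms(1) by (rule Sim_clique)
  then show "Sim \<Gamma> \<le> card (verts \<Gamma>)" using assms(1) by (metis card_mono clique_def)
  have "clique \<Gamma> (verts \<Gamma>)" using assms(2) by (auto simp: clique_def free_of_infinity_def)
  then show "card (verts \<Gamma>) \<le> Sim \<Gamma>" by (rule card_clique_le_Sim[OF assms(1)])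
qed

lemma word_image_verts: "subgraph_image c \<Gamma> (verts \<Gamma>) = carrier (graph_group c \<Gamma>)"
  unfolding word_image_def graph_group_def carrier_presented_group ..

text \<open>The hypothesis covers complete graphs on natural numbers; a finite complete graph on any
  type is relabelled along an enumeration of its vertices.\<close>

lemma asdim_graph_group_complete:
  fixes \<Gamma> :: "'v labeled_graph"
  assumes \<Gamma>: "finite_simplicial_labeled_graph \<Gamma>" "free_of_infinity \<Gamma>"
    and complete: "\<And>\<Delta> :: nat labeled_graph. finite_simplicial_labeled_graph \<Delta> \<Longrightarrow> free_of_infinity \<Delta> \<Longrightarrow>
      asdim_group (graph_group c \<Delta>) \<le> enat (Sim \<Delta>)"
  shows "asdim_group (graph_group c \<Gamma>) \<le> enat (Sim \<Gamma>)"
proof -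
  have fin: "finite (verts \<Gamma>)" using \<Gamma> by (simp add: finite_simplicial_labeled_graph_def)
  define n where "n = card (verts \<Gamma>)"
  obtain f where f: "bij_betw f {..<n} (verts \<Gamma>)"
    using ex_bij_betw_nat_finite[OF fin] by (auto simp: n_def atLeast0LessThan)
  have inj: "inj_on f {..<n}" and image: "f ` {..<n} = verts \<Gamma>" using f by (auto simp: bij_betw_def)
  define \<Delta> where "\<Delta> = \<lparr>verts = {..<n}, edges = {{i, j} | i j. i < n \<and> j < n \<and> i \<noteq> j}, label = (\<lambda>e. label \<Gamma> (f ` e))\<rparr>"
  have edge: "{f i, f j} \<in> edges \<Gamma>" if "i < n" "j < n" "i \<noteq> j" for i j
    using \<Gamma>(2) image inj that unfolding free_of_infinity_def by (metis imageI inj_onD lessThan_iff)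
  have \<Delta>: "finite_simplicial_labeled_graph \<Delta>"
    using \<Gamma>(1) edge by (auto simp: finite_simplicial_labeled_graph_def \<Delta>_def)
  have complete\<Delta>: "free_of_infinity \<Delta>" by (auto simp: free_of_infinity_def \<Delta>_def)
  have "{i, j} \<in> edges \<Delta> \<longleftrightarrow> {f i, f j} \<in> edges \<Gamma>" if "i < n" "j < n" for i j
  proof (cases "i = j")
    case True
    then show ?thesis using edge_ends(1)[OF \<Gamma>(1), of "f i" "f i"] by (auto simp: \<Delta>_def doubleton_eq_iff)
  next
    case False
    then show ?thesis using edge that by (auto simp: \<Delta>_def)
  qed
  then have emb: "full_embedding f \<Delta> \<Gamma>" using inj image by (auto simp: full_embedding_def \<Delta>_def)
  have "Sim \<Delta> = Sim \<Gamma>" using Sim_complete[OF _ complete\<Delta>] Sim_complete[OF fin \<Gamma>(2)] by (simp add: \<Delta>_def n_def)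
  then have "Metric_space.unif_colorable (graph_dist c \<Delta>) (Suc (Sim \<Gamma>)) {carrier (graph_group c \<Delta>)}"
    using complete[OF \<Delta> complete\<Delta>] asdim_graph_group_le_iff[OF \<Delta>] by simp
  from unif_colorable_word_image[OF \<Delta> \<Gamma>(1) emb this] show ?thesis
    using asdim_graph_group_le_iff[OF \<Gamma>(1)] image word_image_verts[of \<Gamma> c] by (simp add: \<Delta>_def)
qed

lemma asdim_graph_group_le_Sim:
  fixes \<Gamma> :: "'v labeled_graph"
  assumes complete: "\<And>\<Delta> :: nat labeled_graph. finite_simplicial_labeled_graph \<Delta> \<Longrightarrow> free_of_infinity \<Delta> \<Longrightarrow>
      asdim_group (graph_group c \<Delta>) \<le> enat (Sim \<Delta>)"
    and "finite_simplicial_labeled_graph \<Gamma>"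
  shows "asdim_group (graph_group c \<Gamma>) \<le> enat (Sim \<Gamma>)"
  using assms(2)
proof (induction "card (verts \<Gamma>)" arbitrary: \<Gamma> rule: less_induct)
  case less
  note \<Gamma> = less.prems
  have fin: "finite (verts \<Gamma>)" using \<Gamma> by (simp add: finite_simplicial_labeled_graph_def)
  show ?case
  proof (cases "free_of_infinity \<Gamma>")
    case True
    then show ?thesis using asdim_graph_group_complete[OF \<Gamma> _ complete] by blast
  next
    case False
    then obtain a b where ab: "a \<in> verts \<Gamma>" "b \<in> verts \<Gamma>" "a \<noteq> b" "{a, b} \<notin> edges \<Gamma>"
      by (auto simp: free_of_infinity_def)
    define L where "L = {v\<in>verts \<Gamma>. {a, v} \<in> edges \<Gamma>}"
    define S1 where "S1 = insert a L"
    define S2 where "S2 = verts \<Gamma> - {a}"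
    have aL: "a \<notin> L" using edge_ends(1)[OF \<Gamma>, of a a] by (auto simp: L_def)
    \<comment> \<open>S1 misses b and S2 misses a, so the induction hypothesis applies to
      both.\<close>
    have sub: "L \<subset> verts \<Gamma>" "S1 \<subset> verts \<Gamma>" "S2 \<subset> verts \<Gamma>" using ab by (auto simp: L_def S1_def S2_def)
    have un: "S1 \<union> S2 = verts \<Gamma>" "S1 \<inter> S2 = L" using ab aL by (auto simp: L_def S1_def S2_def)
    have IH: "Metric_space.unif_colorable (graph_dist c \<Gamma>) (Suc (Sim (induced_subgraph \<Gamma> T)))
        {subgraph_image c \<Gamma> T}" if T: "T \<subset> verts \<Gamma>" for T
    proof -
      let ?\<Delta> = "induced_subgraph \<Gamma> T"
      have \<Delta>: "finite_simplicial_labeled_graph ?\<Delta>" using finite_simplicial_induced_subgraph \<Gamma> T by blast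
      have "card (verts ?\<Delta>) < card (verts \<Gamma>)" using psubset_card_mono[OF fin T] by simp
      then have "asdim_group (graph_group c ?\<Delta>) \<le> enat (Sim ?\<Delta>)" using less.hyps \<Delta> by blast
      then have col: "Metric_space.unif_colorable (graph_dist c ?\<Delta>) (Suc (Sim ?\<Delta>)) {carrier (graph_group c ?\<Delta>)}"
        using asdim_graph_group_le_iff[OF \<Delta>] by blast
      have "full_embedding id ?\<Delta> \<Gamma>" using full_embedding_induced_subgraph T by blast
      from unif_colorable_word_image[OF \<Delta> \<Gamma> this col] show ?thesis by simp
    qed
    interpret am: amalgam_presentation S1 S2 "graph_relations c \<Gamma>"
    proof
      fix u v assume "(u, v) \<in> graph_relations c \<Gamma>"
      then show "\<exists>A\<in>{S1, S2}. u \<in> words A \<and> v \<in> words A"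
      proof (cases rule: graph_relations_cases)
        case (square x)
        then show ?thesis by (cases "x = a") (auto simp: S1_def S2_def)
      next
        case (braid x y)
        note ends = edge_ends[OF \<Gamma> braid(1)]
        \<comment> \<open>An edge at a lies in the star of a; every other edge avoids a.\<close>
        have "(x \<in> S1 \<and> y \<in> S1) \<or> (x \<in> S2 \<and> y \<in> S2)"
          using ends braid(1) by (auto simp: S1_def S2_def L_def insert_commute)
        then obtain T where T: "T \<in> {S1, S2}" "x \<in> T" "y \<in> T" by blast
        then show ?thesis
          unfolding braid(2,3) using alternating_lists[OF T(2,3)] alternating_lists[OF T(3,2)] by (intro bexI conjI)
      qed
    qed
    \<comment> \<open>Strictness gains the one colour: the link needs at most Sim \<Gamma> of the
      \<open>Suc (Sim \<Gamma>)\<close> colours.\<close>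
    have "Sim (induced_subgraph \<Gamma> L) < Sim \<Gamma>"
      using sub aL ab by (intro Sim_link_less[OF fin, of L a]) (auto simp: L_def)
    then have C: "am.unif_colorable (Sim \<Gamma>) {word_image am.S (graph_relations c \<Gamma>) (S1 \<inter> S2)}"
      using am.unif_colorable_mono[OF IH[OF sub(1), folded un(1)], of "Sim \<Gamma>" "{word_image am.S (graph_relations c \<Gamma>) (S1 \<inter> S2)}"]
      unfolding un by auto
    have F: "am.unif_colorable (Suc (Sim \<Gamma>)) {word_image am.S (graph_relations c \<Gamma>) T}" if T: "T \<subset> verts \<Gamma>" for T
      using am.unif_colorable_mono[OF IH[OF T, folded un(1)], of "Suc (Sim \<Gamma>)" "{word_image am.S (graph_relations c \<Gamma>) T}"]
        Sim_induced_subgraph_le[OF fin, of T] T by auto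
    have "am.unif_colorable (Suc (Sim \<Gamma>)) {carrier am.G}"
      by (rule am.unif_colorable_amalgam[OF C F[OF sub(2)] F[OF sub(3)]])
    then show ?thesis using asdim_graph_group_le_iff[OF \<Gamma>] unfolding un graph_group_def by blast
  qed
qed

theorem theorem1p3:
  shows
    "((\<forall>\<Gamma> :: nat labeled_graph.
          finite_simplicial_labeled_graph \<Gamma> \<and> free_of_infinity \<Gamma>
            \<longrightarrow> asdim_group (artin_group \<Gamma>) \<le> enat (Sim \<Gamma>))
        \<longrightarrow> (\<forall>\<Gamma> :: 'v labeled_graph.
          finite_simplicial_labeled_graph \<Gamma>
            \<longrightarrow> asdim_group (artin_group \<Gamma>) \<le> enat (Sim \<Gamma>)))
     \<and>
     ((\<forall>\<Gamma> :: nat labeled_graph.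
          finite_simplicial_labeled_graph \<Gamma> \<and> free_of_infinity \<Gamma>
            \<longrightarrow> asdim_group (coxeter_group \<Gamma>) \<le> enat (Sim \<Gamma>))
        \<longrightarrow> (\<forall>\<Gamma> :: 'v labeled_graph.
          finite_simplicial_labeled_graph \<Gamma>
            \<longrightarrow> asdim_group (coxeter_group \<Gamma>) \<le> enat (Sim \<Gamma>)))"
  unfolding artin_group_eq coxeter_group_eq
  using asdim_graph_group_le_Sim[of False] asdim_graph_group_le_Sim[of True] by blast

end
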